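(* Let $\mathcal{T}$ be a triangulated category with set indexed coproducts and suspension functor $\Sigma$. Suppose $S$ is a compact simply connected corigid object of $\mathcal{T}$ and assume that $\{\Sigma^{i}S \mid i\in\mathbb{Z}\}$ is a generating set for $\mathcal{T}$. Then the following pair $(\mathcal{A},\mathcal{B})$ of full subcategories forms a non-degenerate co-$t$-structure on $\mathcal{T}$: $$\mathcal{A} = \{X\in\mathcal{T} \mid \mathrm{Hom}_{\mathcal{T}}(S,\Sigma^{i}X)=0 \text{ for } i<0\},$$ $$\mathcal{B} = \{X\in\mathcal{T} \mid \mathrm{Hom}_{\mathcal{T}}(S,\Sigma^{i}X)=0 \text{ for } i>0\}.$$ Moreover, its coheart $\mathcal{C}=\mathcal{A}\cap\mathcal{B}$ is an abelian subcategory of $\mathcal{T}$, and the functor $$\mathrm{Hom}_{\mathcal{T}}(S,-):\mathcal{C}\rightarrow\mathrm{Mod}(\mathrm{End}(S)^{\mathrm{op}})$$ is an equivalence of categories.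
   Context: Let $\mathcal{T}$ be a triangulated category with set indexed coproducts and suspension $\Sigma$. An object $S$ is compact if the canonical map $\coprod_{i\in I}\mathrm{Hom}_{\mathcal{T}}(S,X_i)\to \mathrm{Hom}_{\mathcal{T}}(S,\coprod_{i\in I}X_i)$ is an isomorphism for every family $\{X_i\}_{i\in I}$ of objects indexed by a set $I$. A set of objects $\mathcal{G}$ is a generating set for $\mathcal{T}$ if any object $X$ with $\mathrm{Hom}_{\mathcal{T}}(G,X)=0$ for all $G\in\mathcal{G}$ satisfies $X=0$. An object $S$ is a simply connected corigid object if: (1) $\mathrm{Hom}_{\mathcal{T}}(\Sigma^{i}S,S)=0$ for all $i>0$; (2) $\mathrm{Hom}_{\mathcal{T}}(S,\Sigma S)=0$; (3) $\mathrm{End}(S)$ is a division ring. A pair of full subcategories $(\mathcal{A},\mathcal{B})$ of $\mathcal{T}$ is a co-$t$-structure if: (0) $\mathcal{A}$ and $\mathcal{B}$ are closed under direct summands; (1) $\Sigma^{-1}\mathcal{A}\subseteq\mathcal{A}$ and $\mathcal{B}\subseteq\Sigma^{-1}\mathcal{B}$; (2) $\mathrm{Hom}_{\mathcal{T}}(\Sigma^{-1}A,B)=0$ for all $A\in\mathcal{A}$, $B\in\mathcal{B}$; (3) for every object $X$ of $\mathcal{T}$ there is a distinguished triangle $\Sigma^{-1}A\to X\to B\to A$ with $A\in\mathcal{A}$ and $B\in\mathcal{B}$. It is non-degenerate if $\bigcap_{n\in\mathbb{Z}}\Sigma^{n}\mathcal{A}=\bigcap_{n\in\mathbb{Z}}\Sigma^{n}\mathcal{B}=\{0\}$.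 Its coheart is $\mathcal{C}=\mathcal{A}\cap\mathcal{B}$, a full subcategory of $\mathcal{T}$. $\mathrm{Mod}(\mathrm{End}(S)^{\mathrm{op}})$ denotes the category of right $\mathrm{End}(S)$-modules; $\mathrm{Hom}_{\mathcal{T}}(S,X)$ is a right $\mathrm{End}(S)$-module by precomposition. That $\mathcal{C}$ is an abelian subcategory means that the full subcategory $\mathcal{C}$ is itself an abelian category. *)

theory Defs
  imports "HOL-Algebra.Module" "HOL-Algebra.Free_Abelian_Groups"
begin

unbundle cardinal_syntax

section \<open>Size\<close>

text \<open>
  The distinction between sets and classes is made relative to an uncountable regular cardinal
  \<open>\<kappa>\<close>, given as a cardinal order on the type \<open>'m\<close> of arrows: a ``set'' is a set of cardinality
  below \<open>\<kappa>\<close>.  Taking \<open>\<kappa>\<close> strongly inaccessible gives the sets of a universe, but the strong limit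
  property is not imposed.  Since \<open>\<kappa>\<close> lives on \<open>'m\<close>, every small set of any type is in bijection
  with a small subset of \<open>'m\<close>, so index sets and carriers of modules may be taken in \<open>'m\<close>.
  Asking for \<open>\<kappa>\<close> to live on \<open>'m\<close> is no restriction, because the arrows of a category only form
  a subset \<open>Arr C\<close> of \<open>'m\<close>, and \<open>'m\<close> can be as large as desired.
\<close>

definition universe_cardinal :: "'a rel \<Rightarrow> bool" where
  "universe_cardinal \<kappa> \<longleftrightarrow> Card_order \<kappa> \<and> natLeq <o \<kappa> \<and> regularCard \<kappa>"

definition small :: "'a rel \<Rightarrow> 'b set \<Rightarrow> bool" where
  "small \<kappa> A \<longleftrightarrow> |A| <o \<kappa>"


section \<open>Categories and functors\<close>

record ('o, 'm) cat =
  Obj :: "'o set"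
  Arr :: "'m set"
  Dom :: "'m \<Rightarrow> 'o"
  Cod :: "'m \<Rightarrow> 'o"
  Idt :: "'o \<Rightarrow> 'm"
  Comp :: "'m \<Rightarrow> 'm \<Rightarrow> 'm"  (infixl \<open>\<cdot>\<index>\<close> 70)

definition Hom :: "('o, 'm, 'z) cat_scheme \<Rightarrow> 'o \<Rightarrow> 'o \<Rightarrow> 'm set" where
  "Hom C X Y = {f \<in> Arr C. Dom C f = X \<and> Cod C f = Y}"

locale category =
  fixes C :: "('o, 'm, 'z) cat_scheme" (structure)
  assumes dom_obj: "f \<in> Arr C \<Longrightarrow> Dom C f \<in> Obj C"
    and cod_obj: "f \<in> Arr C \<Longrightarrow> Cod C f \<in> Obj C"
    and idt_hom: "X \<in> Obj C \<Longrightarrow> Idt C X \<in> Hom C X X"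
    and comp_hom: "\<lbrakk>f \<in> Hom C X Y; g \<in> Hom C Y Z\<rbrakk> \<Longrightarrow> g \<cdot> f \<in> Hom C X Z"
    and comp_idt_left: "f \<in> Hom C X Y \<Longrightarrow> Idt C Y \<cdot> f = f"
    and comp_idt_right: "f \<in> Hom C X Y \<Longrightarrow> f \<cdot> Idt C X = f"
    and comp_assoc: "\<lbrakk>f \<in> Hom C W X; g \<in> Hom C X Y; h \<in> Hom C Y Z\<rbrakk>
      \<Longrightarrow> (h \<cdot> g) \<cdot> f = h \<cdot> (g \<cdot> f)"

definition locally_small :: "'a rel \<Rightarrow> ('o, 'm, 'z) cat_scheme \<Rightarrow> bool" where
  "locally_small \<kappa> C \<longleftrightarrow> (\<forall>X\<in>Obj C. \<forall>Y\<in>Obj C. small \<kappa> (Hom C X Y))"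

definition is_iso :: "('o, 'm, 'z) cat_scheme \<Rightarrow> 'm \<Rightarrow> bool" where
  "is_iso C f \<longleftrightarrow> f \<in> Arr C \<and> (\<exists>g\<in>Hom C (Cod C f) (Dom C f).
     g \<cdot>\<^bsub>C\<^esub> f = Idt C (Dom C f) \<and> f \<cdot>\<^bsub>C\<^esub> g = Idt C (Cod C f))"

definition is_mono :: "('o, 'm, 'z) cat_scheme \<Rightarrow> 'm \<Rightarrow> bool" where
  "is_mono C f \<longleftrightarrow> f \<in> Arr C \<and> (\<forall>W\<in>Obj C. \<forall>g\<in>Hom C W (Dom C f). \<forall>h\<in>Hom C W (Dom C f).
     f \<cdot>\<^bsub>C\<^esub> g = f \<cdot>\<^bsub>C\<^esub> h \<longrightarrow> g = h)"

definition is_epi :: "('o, 'm, 'z) cat_scheme \<Rightarrow> 'm \<Rightarrow> bool" where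
  "is_epi C f \<longleftrightarrow> f \<in> Arr C \<and> (\<forall>W\<in>Obj C. \<forall>g\<in>Hom C (Cod C f) W. \<forall>h\<in>Hom C (Cod C f) W.
     g \<cdot>\<^bsub>C\<^esub> f = h \<cdot>\<^bsub>C\<^esub> f \<longrightarrow> g = h)"

definition is_zero_object :: "('o, 'm, 'z) cat_scheme \<Rightarrow> 'o \<Rightarrow> bool" where
  "is_zero_object C Z \<longleftrightarrow> Z \<in> Obj C \<and>
     (\<forall>X\<in>Obj C. (\<exists>!f. f \<in> Hom C X Z) \<and> (\<exists>!f. f \<in> Hom C Z X))"

definition is_coproduct ::
  "('o, 'm, 'z) cat_scheme \<Rightarrow> 'i set \<Rightarrow> ('i \<Rightarrow> 'o) \<Rightarrow> 'o \<Rightarrow> ('i \<Rightarrow> 'm) \<Rightarrow> bool" where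
  "is_coproduct C I X P \<iota> \<longleftrightarrow> P \<in> Obj C \<and> (\<forall>i\<in>I. \<iota> i \<in> Hom C (X i) P) \<and>
     (\<forall>Y\<in>Obj C. \<forall>f. (\<forall>i\<in>I. f i \<in> Hom C (X i) Y) \<longrightarrow>
        (\<exists>!h. h \<in> Hom C P Y \<and> (\<forall>i\<in>I. h \<cdot>\<^bsub>C\<^esub> \<iota> i = f i)))"

definition has_small_coproducts :: "'m rel \<Rightarrow> ('o, 'm, 'z) cat_scheme \<Rightarrow> bool" where
  "has_small_coproducts \<kappa> C \<longleftrightarrow>
     (\<forall>(I :: 'm set) X. small \<kappa> I \<longrightarrow> X ` I \<subseteq> Obj C \<longrightarrow> (\<exists>P \<iota>. is_coproduct C I X P \<iota>))"

locale cat_functor = C: category C + D: category D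
  for C :: "('o, 'm, 'z) cat_scheme" and D :: "('p, 'n, 'y) cat_scheme" +
  fixes Fo :: "'o \<Rightarrow> 'p" and Fa :: "'m \<Rightarrow> 'n"
  assumes map_obj: "X \<in> Obj C \<Longrightarrow> Fo X \<in> Obj D"
    and map_hom: "f \<in> Hom C X Y \<Longrightarrow> Fa f \<in> Hom D (Fo X) (Fo Y)"
    and map_idt: "X \<in> Obj C \<Longrightarrow> Fa (Idt C X) = Idt D (Fo X)"
    and map_comp: "\<lbrakk>f \<in> Hom C X Y; g \<in> Hom C Y Z\<rbrakk> \<Longrightarrow> Fa (g \<cdot>\<^bsub>C\<^esub> f) = Fa g \<cdot>\<^bsub>D\<^esub> Fa f"

definition natural_iso ::
  "('o, 'm, 'z) cat_scheme \<Rightarrow> ('p, 'n, 'y) cat_scheme \<Rightarrow>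
     ('o \<Rightarrow> 'p) \<Rightarrow> ('m \<Rightarrow> 'n) \<Rightarrow> ('o \<Rightarrow> 'p) \<Rightarrow> ('m \<Rightarrow> 'n) \<Rightarrow> ('o \<Rightarrow> 'n) \<Rightarrow> bool" where
  "natural_iso C D Fo Fa Go Ga \<eta> \<longleftrightarrow>
     (\<forall>X\<in>Obj C. \<eta> X \<in> Hom D (Fo X) (Go X) \<and> is_iso D (\<eta> X)) \<and>
     (\<forall>X Y. \<forall>f\<in>Hom C X Y. \<eta> Y \<cdot>\<^bsub>D\<^esub> Fa f = Ga f \<cdot>\<^bsub>D\<^esub> \<eta> X)"

definition equivalence_of_categories ::
  "('o, 'm, 'z) cat_scheme \<Rightarrow> ('p, 'n, 'y) cat_scheme \<Rightarrow> ('o \<Rightarrow> 'p) \<Rightarrow> ('m \<Rightarrow> 'n) \<Rightarrow> bool" where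
  "equivalence_of_categories C D Fo Fa \<longleftrightarrow> cat_functor C D Fo Fa \<and>
     (\<exists>Go Ga \<eta> \<epsilon>. cat_functor D C Go Ga \<and>
        natural_iso C C id id (Go \<circ> Fo) (Ga \<circ> Fa) \<eta> \<and>
        natural_iso D D (Fo \<circ> Go) (Fa \<circ> Ga) id id \<epsilon>)"


section \<open>Additive and abelian categories\<close>

record ('o, 'm) addcat = "('o, 'm) cat" +
  Add :: "'m \<Rightarrow> 'm \<Rightarrow> 'm"  (infixl \<open>\<boxplus>\<index>\<close> 65)
  Zero :: "'o \<Rightarrow> 'o \<Rightarrow> 'm"

definition hom_group :: "('o, 'm, 'z) addcat_scheme \<Rightarrow> 'o \<Rightarrow> 'o \<Rightarrow> 'm monoid" where
  "hom_group C X Y = \<lparr>carrier = Hom C X Y, monoid.mult = Add C, one = Zero C X Y\<rparr>"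

definition Neg :: "('o, 'm, 'z) addcat_scheme \<Rightarrow> 'm \<Rightarrow> 'm" where
  "Neg C f = inv\<^bsub>hom_group C (Dom C f) (Cod C f)\<^esub> f"

definition hom_zero :: "('o, 'm, 'z) addcat_scheme \<Rightarrow> 'o \<Rightarrow> 'o \<Rightarrow> bool" where
  "hom_zero C X Y \<longleftrightarrow> Hom C X Y = {Zero C X Y}"

locale preadditive_category = category C
  for C :: "('o, 'm, 'z) addcat_scheme" (structure) +
  assumes hom_comm_group: "\<lbrakk>X \<in> Obj C; Y \<in> Obj C\<rbrakk> \<Longrightarrow> comm_group (hom_group C X Y)"
    and comp_add_left: "\<lbrakk>f \<in> Hom C X Y; f' \<in> Hom C X Y; g \<in> Hom C Y Z\<rbrakk>
      \<Longrightarrow> g \<cdot> (f \<boxplus> f') = g \<cdot> f \<boxplus> g \<cdot> f'"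
    and comp_add_right: "\<lbrakk>f \<in> Hom C X Y; g \<in> Hom C Y Z; g' \<in> Hom C Y Z\<rbrakk>
      \<Longrightarrow> (g \<boxplus> g') \<cdot> f = g \<cdot> f \<boxplus> g' \<cdot> f"

definition is_biproduct ::
  "('o, 'm, 'z) addcat_scheme \<Rightarrow> 'o \<Rightarrow> 'o \<Rightarrow> 'o \<Rightarrow> 'm \<Rightarrow> 'm \<Rightarrow> 'm \<Rightarrow> 'm \<Rightarrow> bool" where
  "is_biproduct C X Y P i j p q \<longleftrightarrow>
     X \<in> Obj C \<and> Y \<in> Obj C \<and> P \<in> Obj C \<and>
     i \<in> Hom C X P \<and> j \<in> Hom C Y P \<and> p \<in> Hom C P X \<and> q \<in> Hom C P Y \<and>
     p \<cdot>\<^bsub>C\<^esub> i = Idt C X \<and> q \<cdot>\<^bsub>C\<^esub> j = Idt C Y \<and>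
     q \<cdot>\<^bsub>C\<^esub> i = Zero C X Y \<and> p \<cdot>\<^bsub>C\<^esub> j = Zero C Y X \<and>
     i \<cdot>\<^bsub>C\<^esub> p \<boxplus>\<^bsub>C\<^esub> j \<cdot>\<^bsub>C\<^esub> q = Idt C P"

locale additive_category = preadditive_category C
  for C :: "('o, 'm, 'z) addcat_scheme" (structure) +
  assumes ex_zero_object: "\<exists>Z. is_zero_object C Z"
    and ex_biproduct: "\<lbrakk>X \<in> Obj C; Y \<in> Obj C\<rbrakk> \<Longrightarrow> \<exists>P i j p q. is_biproduct C X Y P i j p q"

definition is_kernel :: "('o, 'm, 'z) addcat_scheme \<Rightarrow> 'm \<Rightarrow> 'm \<Rightarrow> bool" where
  "is_kernel C f k \<longleftrightarrow> f \<in> Arr C \<and> k \<in> Arr C \<and> Cod C k = Dom C f \<and>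
     f \<cdot>\<^bsub>C\<^esub> k = Zero C (Dom C k) (Cod C f) \<and>
     (\<forall>W\<in>Obj C. \<forall>g\<in>Hom C W (Dom C f). f \<cdot>\<^bsub>C\<^esub> g = Zero C W (Cod C f) \<longrightarrow>
        (\<exists>!h. h \<in> Hom C W (Dom C k) \<and> k \<cdot>\<^bsub>C\<^esub> h = g))"

definition is_cokernel :: "('o, 'm, 'z) addcat_scheme \<Rightarrow> 'm \<Rightarrow> 'm \<Rightarrow> bool" where
  "is_cokernel C f c \<longleftrightarrow> f \<in> Arr C \<and> c \<in> Arr C \<and> Dom C c = Cod C f \<and>
     c \<cdot>\<^bsub>C\<^esub> f = Zero C (Dom C f) (Cod C c) \<and>
     (\<forall>W\<in>Obj C. \<forall>g\<in>Hom C (Cod C f) W. g \<cdot>\<^bsub>C\<^esub> f = Zero C (Dom C f) W \<longrightarrow>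
        (\<exists>!h. h \<in> Hom C (Cod C c) W \<and> h \<cdot>\<^bsub>C\<^esub> c = g))"

locale abelian_category = additive_category C
  for C :: "('o, 'm, 'z) addcat_scheme" (structure) +
  assumes ex_kernel: "f \<in> Arr C \<Longrightarrow> \<exists>k. is_kernel C f k"
    and ex_cokernel: "f \<in> Arr C \<Longrightarrow> \<exists>c. is_cokernel C f c"
    and mono_is_kernel: "is_mono C m \<Longrightarrow> \<exists>f. is_kernel C f m"
    and epi_is_cokernel: "is_epi C e \<Longrightarrow> \<exists>f. is_cokernel C f e"

definition full_subcat :: "('o, 'm, 'z) addcat_scheme \<Rightarrow> 'o set \<Rightarrow> ('o, 'm) addcat" where
  "full_subcat C A =
     \<lparr>Obj = A, Arr = {f \<in> Arr C. Dom C f \<in> A \<and> Cod C f \<in> A},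
      Dom = Dom C, Cod = Cod C, Idt = Idt C, Comp = Comp C, Add = Add C, Zero = Zero C\<rparr>"

definition closed_under_summands :: "('o, 'm, 'z) addcat_scheme \<Rightarrow> 'o set \<Rightarrow> bool" where
  "closed_under_summands C A \<longleftrightarrow>
     (\<forall>X Y P i j p q. is_biproduct C X Y P i j p q \<longrightarrow> P \<in> A \<longrightarrow> X \<in> A)"


section \<open>Triangulated categories\<close>

text \<open>
  An arrow determines its domain and codomain, so a triangle is a triple \<open>(u, v, w)\<close> of arrows
  \<open>X \<rightarrow> Y \<rightarrow> Z \<rightarrow> \<Sigma>X\<close>.
\<close>

record ('o, 'm) tricat = "('o, 'm) addcat" +
  Susp :: "'o \<Rightarrow> 'o"
  SuspA :: "'m \<Rightarrow> 'm"
  Tri :: "('m \<times> 'm \<times> 'm) set"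

definition candidate_triangle :: "('o, 'm, 'z) tricat_scheme \<Rightarrow> 'm \<Rightarrow> 'm \<Rightarrow> 'm \<Rightarrow> bool" where
  "candidate_triangle T u v w \<longleftrightarrow>
     u \<in> Arr T \<and> v \<in> Arr T \<and> w \<in> Arr T \<and>
     Dom T v = Cod T u \<and> Dom T w = Cod T v \<and> Cod T w = Susp T (Dom T u)"

text \<open>
  As in Verdier's definition, the suspension is an automorphism, so that its negative powers are
  literally defined.
\<close>

locale triangulated_category = additive_category T
  for T :: "('o, 'm, 'z) tricat_scheme" (structure) +
  assumes susp_functor: "cat_functor T T (Susp T) (SuspA T)"
    and susp_add: "\<lbrakk>f \<in> Hom T X Y; g \<in> Hom T X Y\<rbrakk>
      \<Longrightarrow> SuspA T (f \<boxplus> g) = SuspA T f \<boxplus> SuspA T g"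
    and susp_bij_obj: "bij_betw (Susp T) (Obj T) (Obj T)"
    and susp_bij_arr: "bij_betw (SuspA T) (Arr T) (Arr T)"
    and tri_candidate: "(u, v, w) \<in> Tri T \<Longrightarrow> candidate_triangle T u v w"
    and tri_iso:
      "\<lbrakk>(u, v, w) \<in> Tri T; candidate_triangle T u' v' w';
        a \<in> Hom T (Dom T u) (Dom T u'); b \<in> Hom T (Cod T u) (Cod T u');
        c \<in> Hom T (Cod T v) (Cod T v'); is_iso T a; is_iso T b; is_iso T c;
        b \<cdot> u = u' \<cdot> a; c \<cdot> v = v' \<cdot> b; SuspA T a \<cdot> w = w' \<cdot> c\<rbrakk>
       \<Longrightarrow> (u', v', w') \<in> Tri T"
    and tri_idt:
      "\<lbrakk>X \<in> Obj T; is_zero_object T Z\<rbrakk>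
       \<Longrightarrow> (Idt T X, Zero T X Z, Zero T Z (Susp T X)) \<in> Tri T"
    and tri_cone: "u \<in> Arr T \<Longrightarrow> \<exists>v w. (u, v, w) \<in> Tri T"
    and tri_rotate:
      "candidate_triangle T u v w
       \<Longrightarrow> (u, v, w) \<in> Tri T \<longleftrightarrow> (v, w, Neg T (SuspA T u)) \<in> Tri T"
    and tri_morphism:
      "\<lbrakk>(u, v, w) \<in> Tri T; (u', v', w') \<in> Tri T;
        a \<in> Hom T (Dom T u) (Dom T u'); b \<in> Hom T (Cod T u) (Cod T u'); b \<cdot> u = u' \<cdot> a\<rbrakk>
       \<Longrightarrow> \<exists>c\<in>Hom T (Cod T v) (Cod T v'). c \<cdot> v = v' \<cdot> b \<and> SuspA T a \<cdot> w = w' \<cdot> c"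
    and octahedral:
      "\<lbrakk>u \<in> Hom T X Y; v \<in> Hom T Y Z;
        (u, j, k) \<in> Tri T; (v, l, i) \<in> Tri T; (v \<cdot> u, m, n) \<in> Tri T\<rbrakk>
       \<Longrightarrow> \<exists>f\<in>Hom T (Cod T j) (Cod T m). \<exists>g\<in>Hom T (Cod T m) (Cod T l).
             (f, g, SuspA T j \<cdot> i) \<in> Tri T \<and>
             f \<cdot> j = m \<cdot> v \<and> n \<cdot> f = k \<and> g \<cdot> m = l \<and> i \<cdot> g = SuspA T u \<cdot> n"

definition Desusp :: "('o, 'm, 'z) tricat_scheme \<Rightarrow> 'o \<Rightarrow> 'o" where
  "Desusp T = inv_into (Obj T) (Susp T)"

definition susp_pow :: "('o, 'm, 'z) tricat_scheme \<Rightarrow> int \<Rightarrow> 'o \<Rightarrow> 'o" where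
  "susp_pow T n X =
     (if n \<ge> 0 then (Susp T ^^ nat n) X else (Desusp T ^^ nat (- n)) X)"


section \<open>Compact, generating and simply connected corigid objects\<close>

text \<open>
  The coproduct of the abelian groups \<open>Hom(S, X i)\<close> consists of the finitely supported families,
  and the canonical map sends such a family \<open>f\<close> to the finite sum of the \<open>\<iota> i \<cdot> f i\<close>.
\<close>

definition compact_object :: "'m rel \<Rightarrow> ('o, 'm, 'z) addcat_scheme \<Rightarrow> 'o \<Rightarrow> bool" where
  "compact_object \<kappa> T S \<longleftrightarrow> S \<in> Obj T \<and>
     (\<forall>(I :: 'm set) X P \<iota>. small \<kappa> I \<longrightarrow> X ` I \<subseteq> Obj T \<longrightarrow> is_coproduct T I X P \<iota> \<longrightarrow>
        (\<lambda>f. gfinprod (hom_group T S P) (\<lambda>i. \<iota> i \<cdot>\<^bsub>T\<^esub> f i) I)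
          \<in> iso (sum_group I (\<lambda>i. hom_group T S (X i))) (hom_group T S P))"

definition generating_set :: "'a rel \<Rightarrow> ('o, 'm, 'z) addcat_scheme \<Rightarrow> 'o set \<Rightarrow> bool" where
  "generating_set \<kappa> T G \<longleftrightarrow> G \<subseteq> Obj T \<and> small \<kappa> G \<and>
     (\<forall>X\<in>Obj T. (\<forall>Y\<in>G. hom_zero T Y X) \<longrightarrow> is_zero_object T X)"

definition End_ring :: "('o, 'm, 'z) addcat_scheme \<Rightarrow> 'o \<Rightarrow> 'm ring" where
  "End_ring T S =
     \<lparr>carrier = Hom T S S, monoid.mult = Comp T, one = Idt T S, ring.zero = Zero T S S, ring.add = Add T\<rparr>"

definition division_ring :: "('a, 'x) ring_scheme \<Rightarrow> bool" where
  "division_ring R \<longleftrightarrow> ring R \<and> \<one>\<^bsub>R\<^esub> \<noteq> \<zero>\<^bsub>R\<^esub> \<and> Units R = carrier R - {\<zero>\<^bsub>R\<^esub>}"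

definition simply_connected_corigid :: "('o, 'm, 'z) tricat_scheme \<Rightarrow> 'o \<Rightarrow> bool" where
  "simply_connected_corigid T S \<longleftrightarrow> S \<in> Obj T \<and>
     (\<forall>i>0. hom_zero T (susp_pow T i S) S) \<and>
     hom_zero T S (Susp T S) \<and>
     division_ring (End_ring T S)"


section \<open>Co-t-structures\<close>

definition co_t_structure :: "('o, 'm, 'z) tricat_scheme \<Rightarrow> 'o set \<Rightarrow> 'o set \<Rightarrow> bool" where
  "co_t_structure T A B \<longleftrightarrow> A \<subseteq> Obj T \<and> B \<subseteq> Obj T \<and>
     closed_under_summands T A \<and> closed_under_summands T B \<and>
     Desusp T ` A \<subseteq> A \<and> B \<subseteq> Desusp T ` B \<and>
     (\<forall>X\<in>A. \<forall>Y\<in>B. hom_zero T (Desusp T X) Y) \<and>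
     (\<forall>X\<in>Obj T. \<exists>Y\<in>A. \<exists>Z\<in>B. \<exists>u\<in>Hom T (Desusp T Y) X. \<exists>v\<in>Hom T X Z. \<exists>w\<in>Hom T Z Y.
        (u, v, w) \<in> Tri T)"

definition nondegenerate_co_t_structure ::
  "('o, 'm, 'z) tricat_scheme \<Rightarrow> 'o set \<Rightarrow> 'o set \<Rightarrow> bool" where
  "nondegenerate_co_t_structure T A B \<longleftrightarrow> co_t_structure T A B \<and>
     (\<Inter>n. susp_pow T n ` A) = {X. is_zero_object T X} \<and>
     (\<Inter>n. susp_pow T n ` B) = {X. is_zero_object T X}"

definition coheart :: "('o, 'm, 'z) addcat_scheme \<Rightarrow> 'o set \<Rightarrow> 'o set \<Rightarrow> ('o, 'm) addcat" where
  "coheart T A B = full_subcat T (A \<inter> B)"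


section \<open>Right modules and the functor represented by an object\<close>

text \<open>
  As in \<open>HOL-Algebra.Module\<close>, the fields \<open>mult\<close> and \<open>one\<close> of a module are not used.  The scalar
  \<open>a\<close> acts on \<open>x\<close> from the right although \<open>a \<odot> x\<close> is written with the scalar first.
\<close>

locale right_module = R?: ring R + M?: abelian_group M
  for R :: "('a, 'x) ring_scheme" (structure) and M :: "('a, 'b, 'y) module_scheme" (structure) +
  assumes act_closed: "\<lbrakk>a \<in> carrier R; x \<in> carrier M\<rbrakk> \<Longrightarrow> a \<odot>\<^bsub>M\<^esub> x \<in> carrier M"
    and act_add: "\<lbrakk>a \<in> carrier R; x \<in> carrier M; y \<in> carrier M\<rbrakk>
      \<Longrightarrow> a \<odot>\<^bsub>M\<^esub> (x \<oplus>\<^bsub>M\<^esub> y) = a \<odot>\<^bsub>M\<^esub> x \<oplus>\<^bsub>M\<^esub> a \<odot>\<^bsub>M\<^esub> y"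
    and add_act: "\<lbrakk>a \<in> carrier R; b \<in> carrier R; x \<in> carrier M\<rbrakk>
      \<Longrightarrow> (a \<oplus>\<^bsub>R\<^esub> b) \<odot>\<^bsub>M\<^esub> x = a \<odot>\<^bsub>M\<^esub> x \<oplus>\<^bsub>M\<^esub> b \<odot>\<^bsub>M\<^esub> x"
    and act_act: "\<lbrakk>a \<in> carrier R; b \<in> carrier R; x \<in> carrier M\<rbrakk>
      \<Longrightarrow> b \<odot>\<^bsub>M\<^esub> (a \<odot>\<^bsub>M\<^esub> x) = (a \<otimes>\<^bsub>R\<^esub> b) \<odot>\<^bsub>M\<^esub> x"
    and one_act: "x \<in> carrier M \<Longrightarrow> \<one>\<^bsub>R\<^esub> \<odot>\<^bsub>M\<^esub> x = x"

definition module_homs ::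
  "('a, 'x) ring_scheme \<Rightarrow> ('a, 'b) module \<Rightarrow> ('a, 'b) module \<Rightarrow> ('b \<Rightarrow> 'b) set" where
  "module_homs R M N =
     {f \<in> carrier M \<rightarrow>\<^sub>E carrier N.
        (\<forall>x\<in>carrier M. \<forall>y\<in>carrier M. f (x \<oplus>\<^bsub>M\<^esub> y) = f x \<oplus>\<^bsub>N\<^esub> f y) \<and>
        (\<forall>a\<in>carrier R. \<forall>x\<in>carrier M. f (a \<odot>\<^bsub>M\<^esub> x) = a \<odot>\<^bsub>N\<^esub> f x)}"

type_synonym ('a, 'b) module_arr = "('a, 'b) module \<times> ('b \<Rightarrow> 'b) \<times> ('a, 'b) module"

definition right_Mod ::
  "'c rel \<Rightarrow> ('a, 'x) ring_scheme \<Rightarrow> (('a, 'b) module, ('a, 'b) module_arr) cat" where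
  "right_Mod \<kappa> R =
     \<lparr>Obj = {M. right_module R M \<and> small \<kappa> (carrier M)},
      Arr = {(M, f, N). right_module R M \<and> small \<kappa> (carrier M) \<and>
               right_module R N \<and> small \<kappa> (carrier N) \<and> f \<in> module_homs R M N},
      Dom = (\<lambda>(M, f, N). M),
      Cod = (\<lambda>(M, f, N). N),
      Idt = (\<lambda>M. (M, \<lambda>x\<in>carrier M. x, M)),
      Comp = (\<lambda>(N, g, P) (M, f, N'). (M, compose (carrier M) g f, P))\<rparr>"

definition hom_obj :: "('o, 'm, 'z) addcat_scheme \<Rightarrow> 'o \<Rightarrow> 'o \<Rightarrow> ('m, 'm) module" where
  "hom_obj T S X =
     \<lparr>carrier = Hom T S X, monoid.mult = undefined, one = undefined,
      ring.zero = Zero T S X, ring.add = Add T, smult = (\<lambda>a x. x \<cdot>\<^bsub>T\<^esub> a)\<rparr>"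

definition hom_arr :: "('o, 'm, 'z) addcat_scheme \<Rightarrow> 'o \<Rightarrow> 'm \<Rightarrow> ('m, 'm) module_arr" where
  "hom_arr T S f =
     (hom_obj T S (Dom T f), \<lambda>g\<in>Hom T S (Dom T f). f \<cdot>\<^bsub>T\<^esub> g, hom_obj T S (Cod T f))"

end

theory Submission
  imports Defs
begin

text \<open>
  Write \<open>H\<^sup>i(X)\<close> for \<open>Hom(S, \<Sigma>\<^sup>i X) = Hom(cell i, X)\<close> with \<open>cell i = \<Sigma>\<close>-power \<open>-i\<close> of \<open>S\<close>.
  These are right vector spaces over the division ring \<open>End(S)\<close>, they vanish together only if
  \<open>X = 0\<close>, and \<open>S\<close> itself has no cohomology in negative degrees and in degree \<open>1\<close>.  The last
  two facts make the following cell attachment minimal.  A basis of \<open>H\<^sup>m(X)\<close> gives a map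
  \<open>p : P \<rightarrow> X\<close> from a coproduct of copies of \<open>cell m\<close> that is bijective on \<open>H\<^sup>m\<close>, and its cone
  \<open>X'\<close> satisfies \<open>H\<^sup>m(X') = 0\<close>, while \<open>H\<^sup>i(X) = H\<^sup>i(X')\<close> for all \<open>i < m\<close> (\<open>attach_cells\<close>).

  Doing this for \<open>m = N, N + 1, \<dots>\<close> and passing to the homotopy colimit \<open>L\<close>, whose cohomology is
  the colimit of the cohomologies because \<open>S\<close> is compact (\<open>telescope\<close>), gives a map \<open>X \<rightarrow> L\<close>
  that is bijective on \<open>H\<^sup>i\<close> for \<open>i < N\<close>, with \<open>H\<^sup>i(L) = 0\<close> for \<open>i \<ge> N\<close>.  Moreover every map from
  \<open>X\<close> to an object \<open>W\<close> without cohomology in degrees \<open>\<ge> N\<close> factors through \<open>L\<close>, since it extends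
  over each cell (\<open>truncation\<close>).  Everything follows from this.  For \<open>N = 1\<close> the map \<open>X \<rightarrow> L\<close> and
  its cone form the triangle of the co-t-structure.  If \<open>X\<close> has no cohomology in degrees \<open>< N\<close>
  then \<open>L = 0\<close> and so \<open>Hom(X, W) = 0\<close> (\<open>orthogonality\<close>), which is the orthogonality of the
  co-t-structure.

  The object \<open>S\<close> need not lie in the coheart, as \<open>H\<^sup>2(S)\<close> may be nonzero.  But for \<open>X\<close> and
  \<open>Y\<close> in the coheart, the cone of \<open>p : P \<rightarrow> X\<close> for \<open>m = 0\<close> has cohomology in positive degrees
  only, so orthogonality shows that \<open>Hom(X, Y) = Hom(P, Y)\<close>; this is the set of linear maps from
  \<open>H\<^sup>0(X)\<close> to \<open>H\<^sup>0(Y)\<close> (\<open>hom_S_faithful\<close>, \<open>hom_S_full\<close>).  A vector space with basis \<open>I\<close> is \<open>H\<^sup>0\<close> of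
  the coproduct of \<open>I\<close> copies of \<open>S\<close>, and truncating that coproduct at \<open>1\<close> yields an object of the
  coheart with the same \<open>H\<^sup>0\<close> (\<open>coheart_realization\<close>).  This is the equivalence.  The coheart is
  abelian because, as for vector spaces, every arrow \<open>f\<close> has some \<open>g\<close> with \<open>f g f = f\<close> and
  idempotents split (\<open>abelian_if_regular\<close>).
\<close>

section \<open>Preadditive categories\<close>

lemma HomI: "f \<in> Arr C \<Longrightarrow> Dom C f = X \<Longrightarrow> Cod C f = Y \<Longrightarrow> f \<in> Hom C X Y"
  and HomD: "f \<in> Hom C X Y \<Longrightarrow> f \<in> Arr C" "f \<in> Hom C X Y \<Longrightarrow> Dom C f = X"
    "f \<in> Hom C X Y \<Longrightarrow> Cod C f = Y"
  by (auto simp: Hom_def)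

context category
begin

lemma hom_objs:
  assumes "f \<in> Hom C X Y"
  shows hom_dom_obj: "X \<in> Obj C" and hom_cod_obj: "Y \<in> Obj C"
  using assms dom_obj cod_obj by (auto simp: Hom_def)

lemma zero_object_hom_unique:
  assumes "is_zero_object C Z" "f \<in> Hom C X Z" "g \<in> Hom C X Z"
  shows "f = g"
  using assms hom_objs(1) unfolding is_zero_object_def by metis

lemma zero_object_hom_unique':
  assumes "is_zero_object C Z" "f \<in> Hom C Z X" "g \<in> Hom C Z X"
  shows "f = g"
  using assms hom_objs(2) unfolding is_zero_object_def by metis

lemma coproduct_hom_eqI:
  assumes "is_coproduct C I X P \<iota>" "g \<in> Hom C P Y" "h \<in> Hom C P Y"
    and eq: "\<And>i. i \<in> I \<Longrightarrow> g \<cdot> \<iota> i = h \<cdot> \<iota> i"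
  shows "g = h"
proof -
  have "\<forall>i\<in>I. g \<cdot> \<iota> i \<in> Hom C (X i) Y"
    using assms comp_hom unfolding is_coproduct_def by blast
  then have "\<exists>!k. k \<in> Hom C P Y \<and> (\<forall>i\<in>I. k \<cdot> \<iota> i = g \<cdot> \<iota> i)"
    using assms(1) hom_cod_obj[OF assms(2)] unfolding is_coproduct_def by simp
  then show ?thesis using assms by metis
qed

lemma coproduct_hom_ex:
  assumes "is_coproduct C I X P \<iota>" "Y \<in> Obj C" "\<And>i. i \<in> I \<Longrightarrow> f i \<in> Hom C (X i) Y"
  obtains h where "h \<in> Hom C P Y" "\<And>i. i \<in> I \<Longrightarrow> h \<cdot> \<iota> i = f i"
proof -
  have "\<exists>!h. h \<in> Hom C P Y \<and> (\<forall>i\<in>I. h \<cdot> \<iota> i = f i)"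
    using assms unfolding is_coproduct_def by simp
  then show ?thesis using that by blast
qed

lemma is_coproduct_reindex:
  assumes "inj e" "is_coproduct C (e ` J) (X \<circ> inv_into UNIV e) P \<iota>"
  shows "is_coproduct C J X P (\<iota> \<circ> e)"
  unfolding is_coproduct_def
proof (intro conjI ballI allI impI)
  show "P \<in> Obj C" using assms(2) by (simp add: is_coproduct_def)
  show "(\<iota> \<circ> e) j \<in> Hom C (X j) P" if "j \<in> J" for j
    using assms that by (auto simp: is_coproduct_def)
next
  fix Y f assume Y: "Y \<in> Obj C" and f: "\<forall>i\<in>J. f i \<in> Hom C (X i) Y"
  have "\<forall>Y\<in>Obj C. \<forall>f. (\<forall>j\<in>J. f (e j) \<in> Hom C (X j) Y) \<longrightarrow>
      (\<exists>!h. h \<in> Hom C P Y \<and> (\<forall>j\<in>J. h \<cdot> \<iota> (e j) = f (e j)))"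
    using assms(2) by (simp add: is_coproduct_def inv_f_f[OF assms(1)])
  from this[rule_format, OF Y, of "f \<circ> inv_into UNIV e"]
  show "\<exists>!h. h \<in> Hom C P Y \<and> (\<forall>i\<in>J. h \<cdot> (\<iota> \<circ> e) i = f i)"
    using f by (simp add: inv_f_f[OF assms(1)])
qed

end

context preadditive_category
begin

lemma zero_hom: "X \<in> Obj C \<Longrightarrow> Y \<in> Obj C \<Longrightarrow> Zero C X Y \<in> Hom C X Y"
  using monoid.one_closed[OF comm_monoid.axioms(1)[OF comm_group.axioms(1)[OF hom_comm_group]]]
  by (fastforce simp: hom_group_def)

lemma hom_comm_group': "f \<in> Hom C X Y \<Longrightarrow> comm_group (hom_group C X Y)"
  using hom_comm_group hom_objs by blast

lemma add_hom: "f \<in> Hom C X Y \<Longrightarrow> g \<in> Hom C X Y \<Longrightarrow> f \<boxplus> g \<in> Hom C X Y"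
  using monoid.m_closed[OF comm_monoid.axioms(1)[OF comm_group.axioms(1)[OF hom_comm_group']], of f X Y f g]
  by (simp add: hom_group_def)

lemma neg_hom: "f \<in> Hom C X Y \<Longrightarrow> Neg C f \<in> Hom C X Y"
  using group.inv_closed[OF comm_group.axioms(2)[OF hom_comm_group'], of f X Y f]
  by (simp add: Neg_def HomD) (simp add: hom_group_def)

lemma add_assoc: "f \<in> Hom C X Y \<Longrightarrow> g \<in> Hom C X Y \<Longrightarrow> h \<in> Hom C X Y \<Longrightarrow>
    (f \<boxplus> g) \<boxplus> h = f \<boxplus> (g \<boxplus> h)"
  using monoid.m_assoc[OF comm_monoid.axioms(1)[OF comm_group.axioms(1)[OF hom_comm_group']], of f X Y f g h]
  by (simp add: hom_group_def)

lemma add_comm: "f \<in> Hom C X Y \<Longrightarrow> g \<in> Hom C X Y \<Longrightarrow> f \<boxplus> g = g \<boxplus> f"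
  using comm_monoid.m_comm[OF comm_group.axioms(1)[OF hom_comm_group'], of f X Y f g]
  by (simp add: hom_group_def)

lemma zero_add: "f \<in> Hom C X Y \<Longrightarrow> Zero C X Y \<boxplus> f = f"
  using monoid.l_one[OF comm_monoid.axioms(1)[OF comm_group.axioms(1)[OF hom_comm_group']], of f X Y f]
  by (simp add: hom_group_def)

lemma add_zero: "f \<in> Hom C X Y \<Longrightarrow> f \<boxplus> Zero C X Y = f"
  using zero_add add_comm zero_hom hom_objs by metis

lemma add_neg: "f \<in> Hom C X Y \<Longrightarrow> f \<boxplus> Neg C f = Zero C X Y"
  using group.r_inv[OF comm_group.axioms(2)[OF hom_comm_group'], of f X Y f]
  by (simp add: Neg_def HomD) (simp add: hom_group_def)

lemma neg_add: "f \<in> Hom C X Y \<Longrightarrow> Neg C f \<boxplus> f = Zero C X Y"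
  using add_neg add_comm neg_hom by metis

lemma add_left_cancel:
  assumes "f \<in> Hom C X Y" "g \<in> Hom C X Y" "h \<in> Hom C X Y" "f \<boxplus> g = f \<boxplus> h"
  shows "g = h"
proof -
  have "Neg C f \<boxplus> (f \<boxplus> g) = Neg C f \<boxplus> (f \<boxplus> h)" using assms(4) by simp
  then show ?thesis
    using assms(1-3) neg_hom[OF assms(1)] by (simp add: add_assoc[symmetric] neg_add zero_add)
qed

lemma neg_unique:
  assumes "f \<in> Hom C X Y" "g \<in> Hom C X Y" "f \<boxplus> g = Zero C X Y"
  shows "g = Neg C f"
  using assms add_left_cancel add_neg neg_hom by metis

lemma diff_zero_eq:
  assumes "f \<in> Hom C X Y" "g \<in> Hom C X Y" "f \<boxplus> Neg C g = Zero C X Y"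
  shows "f = g"
  using assms add_left_cancel add_neg neg_hom add_comm by metis

lemma comp_zero:
  assumes "g \<in> Hom C Y Z" "X \<in> Obj C"
  shows "g \<cdot> Zero C X Y = Zero C X Z"
proof -
  have z: "Zero C X Y \<in> Hom C X Y" and z': "Zero C X Z \<in> Hom C X Z"
    using assms zero_hom hom_objs by blast+
  have c: "g \<cdot> Zero C X Y \<in> Hom C X Z" using comp_hom z assms by blast
  have "g \<cdot> Zero C X Y \<boxplus> g \<cdot> Zero C X Y = g \<cdot> (Zero C X Y \<boxplus> Zero C X Y)"
    using comp_add_left[OF z z assms(1)] by simp
  also have "\<dots> = g \<cdot> Zero C X Y \<boxplus> Zero C X Z" using z c by (simp add: zero_add add_zero)
  finally show ?thesis using add_left_cancel[OF c c z'] by simp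
qed

lemma zero_comp:
  assumes "f \<in> Hom C X Y" "Z \<in> Obj C"
  shows "Zero C Y Z \<cdot> f = Zero C X Z"
proof -
  have z: "Zero C Y Z \<in> Hom C Y Z" and z': "Zero C X Z \<in> Hom C X Z"
    using assms zero_hom hom_objs by blast+
  have c: "Zero C Y Z \<cdot> f \<in> Hom C X Z" using comp_hom z assms by blast
  have "Zero C Y Z \<cdot> f \<boxplus> Zero C Y Z \<cdot> f = (Zero C Y Z \<boxplus> Zero C Y Z) \<cdot> f"
    using comp_add_right[OF assms(1) z z] by simp
  also have "\<dots> = Zero C Y Z \<cdot> f \<boxplus> Zero C X Z" using z c by (simp add: zero_add add_zero)
  finally show ?thesis using add_left_cancel[OF c c z'] by simp
qed

lemma comp_neg:
  assumes "f \<in> Hom C X Y" "g \<in> Hom C Y Z"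
  shows "g \<cdot> Neg C f = Neg C (g \<cdot> f)"
proof (rule neg_unique)
  show "g \<cdot> f \<in> Hom C X Z" "g \<cdot> Neg C f \<in> Hom C X Z"
    using comp_hom[OF assms] comp_hom[OF neg_hom[OF assms(1)] assms(2)] by blast+
  show "g \<cdot> f \<boxplus> g \<cdot> Neg C f = Zero C X Z"
    using comp_add_left[OF assms(1) neg_hom[OF assms(1)] assms(2)]
      comp_zero[OF assms(2) hom_dom_obj[OF assms(1)]] add_neg[OF assms(1)] by simp
qed

lemma neg_comp:
  assumes "f \<in> Hom C X Y" "g \<in> Hom C Y Z"
  shows "Neg C g \<cdot> f = Neg C (g \<cdot> f)"
proof (rule neg_unique)
  show "g \<cdot> f \<in> Hom C X Z" "Neg C g \<cdot> f \<in> Hom C X Z"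
    using comp_hom[OF assms] comp_hom[OF assms(1) neg_hom[OF assms(2)]] by blast+
  show "g \<cdot> f \<boxplus> Neg C g \<cdot> f = Zero C X Z"
    using comp_add_right[OF assms(1) assms(2) neg_hom[OF assms(2)]]
      zero_comp[OF assms(1) hom_cod_obj[OF assms(2)]] add_neg[OF assms(2)] by simp
qed

lemma neg_zero: "X \<in> Obj C \<Longrightarrow> Y \<in> Obj C \<Longrightarrow> Neg C (Zero C X Y) = Zero C X Y"
  using neg_unique zero_hom zero_add by metis

lemma neg_neg: "f \<in> Hom C X Y \<Longrightarrow> Neg C (Neg C f) = f"
  using neg_unique neg_hom neg_add by metis

lemma hom_zeroD: "hom_zero C X Y \<Longrightarrow> f \<in> Hom C X Y \<Longrightarrow> f = Zero C X Y"
  by (simp add: hom_zero_def)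

lemma hom_zeroI:
  assumes "X \<in> Obj C" "Y \<in> Obj C" "\<And>f. f \<in> Hom C X Y \<Longrightarrow> f = Zero C X Y"
  shows "hom_zero C X Y"
  using assms zero_hom by (auto simp: hom_zero_def)

lemma zero_object_hom_zero:
  assumes "is_zero_object C Z" "X \<in> Obj C"
  shows "hom_zero C X Z" "hom_zero C Z X"
proof -
  have "Z \<in> Obj C" using assms(1) by (simp add: is_zero_object_def)
  with assms show "hom_zero C X Z" "hom_zero C Z X"
    using zero_object_hom_unique zero_object_hom_unique' zero_hom by (blast intro: hom_zeroI)+
qed

lemma zero_objectI:
  assumes "Z \<in> Obj C" "hom_zero C Z Z"
  shows "is_zero_object C Z"
proof -
  have id: "Idt C Z = Zero C Z Z" using assms idt_hom by (auto simp: hom_zero_def)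
  have "f = Zero C X Z" if "f \<in> Hom C X Z" for f X
    using comp_idt_left[OF that] id zero_comp[OF that assms(1)] by simp
  moreover have "f = Zero C Z X" if "f \<in> Hom C Z X" for f X
    using comp_idt_right[OF that] id comp_zero[OF that assms(1)] by simp
  ultimately show ?thesis
    using assms(1) zero_hom unfolding is_zero_object_def by metis
qed

lemma hom_zero_retract:
  assumes "hom_zero C W P" "i \<in> Hom C X P" "p \<in> Hom C P X" "p \<cdot> i = Idt C X" "W \<in> Obj C"
  shows "hom_zero C W X"
proof (intro hom_zeroI)
  show "W \<in> Obj C" "X \<in> Obj C" using assms hom_objs by blast+
  fix f assume f: "f \<in> Hom C W X"
  have "i \<cdot> f = Zero C W P" using assms(1) comp_hom[OF f assms(2)] by (auto simp: hom_zero_def)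
  then have "p \<cdot> (i \<cdot> f) = Zero C W X" using comp_zero assms by simp
  then show "f = Zero C W X"
    using comp_assoc[OF f assms(2,3)] assms(4) comp_idt_left[OF f] by simp
qed

end

context additive_category
begin

lemma coproduct_proj:
  assumes "is_coproduct C I X P \<iota>" "i \<in> I" "X ` I \<subseteq> Obj C"
  obtains p where "p \<in> Hom C P (X i)" "p \<cdot> \<iota> i = Idt C (X i)"
    "\<And>j. j \<in> I \<Longrightarrow> j \<noteq> i \<Longrightarrow> p \<cdot> \<iota> j = Zero C (X j) (X i)"
proof -
  let ?f = "\<lambda>j. if j = i then Idt C (X i) else Zero C (X j) (X i)"
  have X: "X j \<in> Obj C" if "j \<in> I" for j using assms(3) that by blast
  have "?f j \<in> Hom C (X j) (X i)" if "j \<in> I" for j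
    using idt_hom[OF X[OF assms(2)]] zero_hom[OF X[OF that] X[OF assms(2)]] by simp
  from coproduct_hom_ex[OF assms(1) X[OF assms(2)] this]
  obtain h where h: "h \<in> Hom C P (X i)" "\<And>j. j \<in> I \<Longrightarrow> h \<cdot> \<iota> j = ?f j" by blast
  show ?thesis
  proof (rule that)
    show "h \<in> Hom C P (X i)" by (rule h)
    show "h \<cdot> \<iota> i = Idt C (X i)" using h(2)[OF assms(2)] by simp
    show "h \<cdot> \<iota> j = Zero C (X j) (X i)" if "j \<in> I" "j \<noteq> i" for j using h(2)[OF that(1)] that(2) by simp
  qed
qed

lemma idt_minus_comp:
  assumes "e \<in> Hom C Y Y" "f \<in> Hom C X Y"
  shows "(Idt C Y \<boxplus> Neg C e) \<cdot> f = f \<boxplus> Neg C (e \<cdot> f)"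
  using comp_add_right[OF assms(2) idt_hom neg_hom[OF assms(1)]] neg_comp[OF assms(2,1)]
    comp_idt_left[OF assms(2)] hom_cod_obj[OF assms(2)] by simp

lemma comp_idt_minus:
  assumes "e \<in> Hom C X X" "f \<in> Hom C X Y"
  shows "f \<cdot> (Idt C X \<boxplus> Neg C e) = f \<boxplus> Neg C (f \<cdot> e)"
  using comp_add_left[OF idt_hom neg_hom[OF assms(1)] assms(2)] comp_neg[OF assms]
    comp_idt_right[OF assms(2)] hom_dom_obj[OF assms(2)] by simp

lemma idt_minus_hom: "e \<in> Hom C X X \<Longrightarrow> Idt C X \<boxplus> Neg C e \<in> Hom C X X"
  using add_hom[OF idt_hom neg_hom] hom_objs(1) by blast

lemma idt_minus_idem:
  assumes "e \<in> Hom C X X" "e \<cdot> e = e"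
  shows "(Idt C X \<boxplus> Neg C e) \<cdot> (Idt C X \<boxplus> Neg C e) = Idt C X \<boxplus> Neg C e"
proof -
  let ?d = "Idt C X \<boxplus> Neg C e"
  have X: "X \<in> Obj C" using assms hom_objs by blast
  have "e \<cdot> ?d = Zero C X X" using comp_idt_minus[OF assms(1,1)] assms(2) add_neg[OF assms(1)] by simp
  then show ?thesis
    using idt_minus_comp[OF assms(1) idt_minus_hom[OF assms(1)]] neg_zero[OF X X]
      add_zero[OF idt_minus_hom[OF assms(1)]] by simp
qed

lemma split_kernel:
  assumes f: "f \<in> Hom C X Y" and g: "g \<in> Hom C Y X" "f \<cdot> (g \<cdot> f) = f"
    and s: "s \<in> Hom C K X" and r: "r \<in> Hom C X K"
    and sr: "s \<cdot> r = Idt C X \<boxplus> Neg C (g \<cdot> f)" and rs: "r \<cdot> s = Idt C K"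
  shows "is_kernel C f s"
proof -
  have X: "X \<in> Obj C" and Y: "Y \<in> Obj C" and K: "K \<in> Obj C" using f s hom_objs by blast+
  have gf: "g \<cdot> f \<in> Hom C X X" using comp_hom[OF f g(1)] .
  have "f \<cdot> (s \<cdot> r) = Zero C X Y" using comp_idt_minus[OF gf f] sr g(2) add_neg[OF f] by simp
  then have "(f \<cdot> s) \<cdot> r = Zero C X Y" using comp_assoc[OF r s f] by simp
  then have "((f \<cdot> s) \<cdot> r) \<cdot> s = Zero C K Y" using zero_comp[OF s Y] by simp
  then have fs: "f \<cdot> s = Zero C K Y"
    using comp_assoc[OF s r comp_hom[OF s f]] rs comp_idt_right[OF comp_hom[OF s f]] by simp
  have "\<exists>!k. k \<in> Hom C W K \<and> s \<cdot> k = h" if h: "h \<in> Hom C W X" "f \<cdot> h = Zero C W Y" for W h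
  proof
    have W: "W \<in> Obj C" using h hom_objs by blast
    have "(g \<cdot> f) \<cdot> h = Zero C W X"
      using comp_assoc[OF h(1) f g(1)] h(2) comp_zero[OF g(1) W] by simp
    then have "(s \<cdot> r) \<cdot> h = h"
      using sr idt_minus_comp[OF gf h(1)] neg_zero[OF W X] add_zero[OF h(1)] by simp
    then show "r \<cdot> h \<in> Hom C W K \<and> s \<cdot> (r \<cdot> h) = h"
      using comp_assoc[OF h(1) r s] comp_hom[OF h(1) r] by simp
    fix k assume k: "k \<in> Hom C W K \<and> s \<cdot> k = h"
    then have "r \<cdot> (s \<cdot> k) = k" using comp_assoc[of k W K s X r K] s r rs comp_idt_left[of k W K] by simp
    then show "k = r \<cdot> h" using k by simp
  qed
  then show ?thesis
    using fs HomD[OF f] HomD[OF s] by (simp add: is_kernel_def)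
qed

lemma split_cokernel:
  assumes f: "f \<in> Hom C X Y" and g: "g \<in> Hom C Y X" "f \<cdot> (g \<cdot> f) = f"
    and s: "s \<in> Hom C K Y" and r: "r \<in> Hom C Y K"
    and sr: "s \<cdot> r = Idt C Y \<boxplus> Neg C (f \<cdot> g)" and rs: "r \<cdot> s = Idt C K"
  shows "is_cokernel C f r"
proof -
  have X: "X \<in> Obj C" and Y: "Y \<in> Obj C" and K: "K \<in> Obj C" using f s hom_objs by blast+
  have fg: "f \<cdot> g \<in> Hom C Y Y" using comp_hom[OF g(1) f] .
  have fgf: "(f \<cdot> g) \<cdot> f = f" using comp_assoc[OF f g(1) f] g(2) by simp
  have "(s \<cdot> r) \<cdot> f = Zero C X Y" using idt_minus_comp[OF fg f] sr fgf add_neg[OF f] by simp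
  then have "s \<cdot> (r \<cdot> f) = Zero C X Y" using comp_assoc[OF f r s] by simp
  then have "r \<cdot> (s \<cdot> (r \<cdot> f)) = Zero C X K" using comp_zero[OF r X] by simp
  then have rf: "r \<cdot> f = Zero C X K"
    using comp_assoc[OF comp_hom[OF f r] s r] rs comp_idt_left[OF comp_hom[OF f r]] by simp
  have "\<exists>!k. k \<in> Hom C K W \<and> k \<cdot> r = h" if h: "h \<in> Hom C Y W" "h \<cdot> f = Zero C X W" for W h
  proof
    have W: "W \<in> Obj C" using h hom_objs by blast
    have "h \<cdot> (f \<cdot> g) = Zero C Y W"
      using comp_assoc[OF g(1) f h(1)] h(2) zero_comp[OF g(1) W] by simp
    then have "h \<cdot> (s \<cdot> r) = h"
      using sr comp_idt_minus[OF fg h(1)] neg_zero[OF Y W] add_zero[OF h(1)] by simp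
    then show "h \<cdot> s \<in> Hom C K W \<and> (h \<cdot> s) \<cdot> r = h"
      using comp_assoc[OF r s h(1)] comp_hom[OF s h(1)] by simp
    fix k assume k: "k \<in> Hom C K W \<and> k \<cdot> r = h"
    then have "(k \<cdot> r) \<cdot> s = k" using comp_assoc[of s K Y r K k W] s r rs comp_idt_right[of k K W] by simp
    then show "k = h \<cdot> s" using k by simp
  qed
  then show ?thesis
    using rf HomD[OF f] HomD[OF r] by (simp add: is_cokernel_def)
qed

lemma split_mono_kernel:
  assumes f: "f \<in> Hom C X Y" and g: "g \<in> Hom C Y X" "g \<cdot> f = Idt C X"
  shows "is_kernel C (Idt C Y \<boxplus> Neg C (f \<cdot> g)) f"
proof -
  let ?d = "Idt C Y \<boxplus> Neg C (f \<cdot> g)"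
  have X: "X \<in> Obj C" and Y: "Y \<in> Obj C" using f hom_objs by blast+
  have fg: "f \<cdot> g \<in> Hom C Y Y" using comp_hom[OF g(1) f] .
  have df: "?d \<cdot> f = Zero C X Y"
    using idt_minus_comp[OF fg f] comp_assoc[OF f g(1) f] g(2) comp_idt_right[OF f] add_neg[OF f] by simp
  have "\<exists>!k. k \<in> Hom C W X \<and> f \<cdot> k = h" if h: "h \<in> Hom C W Y" "?d \<cdot> h = Zero C W Y" for W h
  proof
    have "h \<boxplus> Neg C ((f \<cdot> g) \<cdot> h) = Zero C W Y" using h(2) idt_minus_comp[OF fg h(1)] by simp
    then have "h = (f \<cdot> g) \<cdot> h" using diff_zero_eq[OF h(1) comp_hom[OF h(1) fg]] by blast
    also have "\<dots> = f \<cdot> (g \<cdot> h)" using comp_assoc[OF h(1) g(1) f] .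
    finally show "g \<cdot> h \<in> Hom C W X \<and> f \<cdot> (g \<cdot> h) = h"
      using comp_hom[OF h(1) g(1)] by simp
    fix k assume k: "k \<in> Hom C W X \<and> f \<cdot> k = h"
    then have "g \<cdot> (f \<cdot> k) = k" using comp_assoc[of k W X f Y g X] f g comp_idt_left[of k W X] by simp
    then show "k = g \<cdot> h" using k by simp
  qed
  then show ?thesis
    using df HomD[OF f] HomD[OF idt_minus_hom[OF fg]] by (simp add: is_kernel_def)
qed

lemma split_epi_cokernel:
  assumes f: "f \<in> Hom C X Y" and g: "g \<in> Hom C Y X" "f \<cdot> g = Idt C Y"
  shows "is_cokernel C (Idt C X \<boxplus> Neg C (g \<cdot> f)) f"
proof -
  let ?d = "Idt C X \<boxplus> Neg C (g \<cdot> f)"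
  have X: "X \<in> Obj C" and Y: "Y \<in> Obj C" using f hom_objs by blast+
  have gf: "g \<cdot> f \<in> Hom C X X" using comp_hom[OF f g(1)] .
  have fd: "f \<cdot> ?d = Zero C X Y"
    using comp_idt_minus[OF gf f] comp_assoc[OF f g(1) f, symmetric] g(2) comp_idt_left[OF f]
      add_neg[OF f] by simp
  have "\<exists>!k. k \<in> Hom C Y W \<and> k \<cdot> f = h" if h: "h \<in> Hom C X W" "h \<cdot> ?d = Zero C X W" for W h
  proof
    have "h \<boxplus> Neg C (h \<cdot> (g \<cdot> f)) = Zero C X W" using h(2) comp_idt_minus[OF gf h(1)] by simp
    then have "h = h \<cdot> (g \<cdot> f)" using diff_zero_eq[OF h(1) comp_hom[OF gf h(1)]] by blast
    also have "\<dots> = (h \<cdot> g) \<cdot> f" using comp_assoc[OF f g(1) h(1)] by simp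
    finally show "h \<cdot> g \<in> Hom C Y W \<and> (h \<cdot> g) \<cdot> f = h"
      using comp_hom[OF g(1) h(1)] by simp
    fix k assume k: "k \<in> Hom C Y W \<and> k \<cdot> f = h"
    then have "(k \<cdot> f) \<cdot> g = k" using comp_assoc[of g Y X f Y k W] f g comp_idt_right[of k Y W] by simp
    then show "k = h \<cdot> g" using k by simp
  qed
  then show ?thesis
    using fd HomD[OF f] HomD[OF idt_minus_hom[OF gf]] by (simp add: is_cokernel_def)
qed

text \<open>
  If \<open>f g f = f\<close> then \<open>1 - g f\<close> and \<open>1 - f g\<close> are idempotents, and the inclusion and the
  projection obtained by splitting them are a kernel and a cokernel of \<open>f\<close>.  If moreover \<open>f\<close> is
  mono then \<open>g f = 1\<close>, so that \<open>f\<close> is a kernel of \<open>1 - f g\<close>, and dually.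
\<close>

lemma abelian_if_regular:
  assumes reg: "\<And>X Y f. f \<in> Hom C X Y \<Longrightarrow> \<exists>g\<in>Hom C Y X. f \<cdot> (g \<cdot> f) = f"
    and split: "\<And>X e. e \<in> Hom C X X \<Longrightarrow> e \<cdot> e = e \<Longrightarrow>
      \<exists>K. \<exists>s\<in>Hom C K X. \<exists>r\<in>Hom C X K. s \<cdot> r = e \<and> r \<cdot> s = Idt C K"
  shows "abelian_category C"
proof (intro abelian_category.intro abelian_category_axioms.intro)
  show "additive_category C" by (rule additive_category_axioms)
next
  fix f assume "f \<in> Arr C"
  then obtain X Y where f: "f \<in> Hom C X Y" by (auto simp: Hom_def)
  then obtain g where g: "g \<in> Hom C Y X" "f \<cdot> (g \<cdot> f) = f" using reg by blast
  have gf: "g \<cdot> f \<in> Hom C X X" using comp_hom[OF f g(1)] .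
  have fg: "f \<cdot> g \<in> Hom C Y Y" using comp_hom[OF g(1) f] .
  have gf_idem: "(g \<cdot> f) \<cdot> (g \<cdot> f) = g \<cdot> f" using comp_assoc[OF gf f g(1)] g(2) by simp
  have "(f \<cdot> g) \<cdot> (f \<cdot> g) = ((f \<cdot> g) \<cdot> f) \<cdot> g" using comp_assoc[OF g(1) f fg] by simp
  also have "\<dots> = f \<cdot> g" using comp_assoc[OF f g(1) f] g(2) by simp
  finally have fg_idem: "(f \<cdot> g) \<cdot> (f \<cdot> g) = f \<cdot> g" .
  show "\<exists>k. is_kernel C f k"
    using split[OF idt_minus_hom[OF gf] idt_minus_idem[OF gf gf_idem]] split_kernel[OF f g] by blast
  show "\<exists>c. is_cokernel C f c"
    using split[OF idt_minus_hom[OF fg] idt_minus_idem[OF fg fg_idem]] split_cokernel[OF f g] by blast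
next
  fix f assume m: "is_mono C f"
  then obtain X Y where f: "f \<in> Hom C X Y" by (auto simp: Hom_def is_mono_def)
  then obtain g where g: "g \<in> Hom C Y X" "f \<cdot> (g \<cdot> f) = f" using reg by blast
  have X: "X \<in> Obj C" using f hom_objs by blast
  have "f \<cdot> (g \<cdot> f) = f \<cdot> Idt C X" using g(2) comp_idt_right[OF f] by simp
  then have "g \<cdot> f = Idt C X"
    using m X comp_hom[OF f g(1)] idt_hom[OF X] HomD(2)[OF f] by (auto simp: is_mono_def)
  then show "\<exists>h. is_kernel C h f" using split_mono_kernel[OF f g(1)] by blast
next
  fix f assume e: "is_epi C f"
  then obtain X Y where f: "f \<in> Hom C X Y" by (auto simp: Hom_def is_epi_def)
  then obtain g where g: "g \<in> Hom C Y X" "f \<cdot> (g \<cdot> f) = f" using reg by blast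
  have Y: "Y \<in> Obj C" using f hom_objs by blast
  have "(f \<cdot> g) \<cdot> f = Idt C Y \<cdot> f"
    using g(2) comp_assoc[OF f g(1) f] comp_idt_left[OF f] by simp
  then have "f \<cdot> g = Idt C Y"
    using e Y comp_hom[OF g(1) f] idt_hom[OF Y] HomD(3)[OF f] by (auto simp: is_epi_def)
  then show "\<exists>h. is_cokernel C h f" using split_epi_cokernel[OF f g(1)] by blast
qed

end

section \<open>Right vector spaces over a division ring\<close>

inductive_set rspan :: "('a, 'x) ring_scheme \<Rightarrow> ('a, 'b, 'y) module_scheme \<Rightarrow> 'b set \<Rightarrow> 'b set"
  for R M U where
    rspan_zero: "\<zero>\<^bsub>M\<^esub> \<in> rspan R M U"
  | rspan_step: "\<lbrakk>v \<in> rspan R M U; u \<in> U; a \<in> carrier R\<rbrakk> \<Longrightarrow> v \<oplus>\<^bsub>M\<^esub> (a \<odot>\<^bsub>M\<^esub> u) \<in> rspan R M U"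

definition rindep :: "('a, 'x) ring_scheme \<Rightarrow> ('a, 'b, 'y) module_scheme \<Rightarrow> 'b set \<Rightarrow> bool" where
  "rindep R M U \<longleftrightarrow> (\<forall>u\<in>U. u \<notin> rspan R M (U - {u}))"

lemma rspan_mono: "U \<subseteq> V \<Longrightarrow> rspan R M U \<subseteq> rspan R M V"
proof
  fix v assume UV: "U \<subseteq> V" and "v \<in> rspan R M U"
  from this(2) show "v \<in> rspan R M V"
    by induction (use UV in \<open>auto intro: rspan.intros\<close>)
qed

lemma rspan_finite: "v \<in> rspan R M U \<Longrightarrow> \<exists>F\<subseteq>U. finite F \<and> v \<in> rspan R M F"
proof (induction rule: rspan.induct)
  case rspan_zero
  then show ?case using rspan.rspan_zero by blast
next
  case (rspan_step v u a)
  then obtain F where F: "F \<subseteq> U" "finite F" "v \<in> rspan R M F" by blast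
  have "v \<in> rspan R M (insert u F)" using F(3) rspan_mono[OF subset_insertI] by (rule rev_subsetD)
  then have "v \<oplus>\<^bsub>M\<^esub> (a \<odot>\<^bsub>M\<^esub> u) \<in> rspan R M (insert u F)"
    using rspan_step by (intro rspan.rspan_step) auto
  then show ?case using F rspan_step by (intro exI[of _ "insert u F"]) auto
qed

context right_module
begin

lemma act_zero: "a \<in> carrier R \<Longrightarrow> a \<odot>\<^bsub>M\<^esub> \<zero>\<^bsub>M\<^esub> = \<zero>\<^bsub>M\<^esub>"
  using act_add[of a "\<zero>\<^bsub>M\<^esub>" "\<zero>\<^bsub>M\<^esub>"] act_closed[of a "\<zero>\<^bsub>M\<^esub>"]
  by (metis M.add.r_cancel_one' M.l_zero M.zero_closed)

lemma zero_act: "x \<in> carrier M \<Longrightarrow> \<zero>\<^bsub>R\<^esub> \<odot>\<^bsub>M\<^esub> x = \<zero>\<^bsub>M\<^esub>"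
  using add_act[of "\<zero>\<^bsub>R\<^esub>" "\<zero>\<^bsub>R\<^esub>" x] act_closed[of "\<zero>\<^bsub>R\<^esub>" x]
  by (metis M.add.r_cancel_one' R.l_zero R.zero_closed)

lemma neg_act: "a \<in> carrier R \<Longrightarrow> x \<in> carrier M \<Longrightarrow> (\<ominus>\<^bsub>R\<^esub> a) \<odot>\<^bsub>M\<^esub> x = \<ominus>\<^bsub>M\<^esub> (a \<odot>\<^bsub>M\<^esub> x)"
  using add_act[of "\<ominus>\<^bsub>R\<^esub> a" a x] zero_act
  by (metis M.minus_equality R.add.inv_closed R.l_neg act_closed)

lemma submodule:
  assumes V: "V \<subseteq> carrier M" and zero: "\<zero>\<^bsub>M\<^esub> \<in> V"
    and add: "\<And>x y. x \<in> V \<Longrightarrow> y \<in> V \<Longrightarrow> x \<oplus>\<^bsub>M\<^esub> y \<in> V"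
    and act: "\<And>a x. a \<in> carrier R \<Longrightarrow> x \<in> V \<Longrightarrow> a \<odot>\<^bsub>M\<^esub> x \<in> V"
  shows "right_module R (M\<lparr>carrier := V\<rparr>)"
proof (intro right_module.intro right_module_axioms.intro)
  show "ring R" by (rule R.ring_axioms)
  show "abelian_group (M\<lparr>carrier := V\<rparr>)"
  proof (rule abelian_groupI)
    fix x assume "x \<in> carrier (M\<lparr>carrier := V\<rparr>)"
    then have x: "x \<in> V" "x \<in> carrier M" using V by auto
    have "(\<ominus>\<^bsub>R\<^esub> \<one>\<^bsub>R\<^esub>) \<odot>\<^bsub>M\<^esub> x \<in> V" using act x(1) by simp
    then show "\<exists>y\<in>carrier (M\<lparr>carrier := V\<rparr>). y \<oplus>\<^bsub>M\<lparr>carrier := V\<rparr>\<^esub> x = \<zero>\<^bsub>M\<lparr>carrier := V\<rparr>\<^esub>"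
      using neg_act[OF R.one_closed x(2)] one_act[OF x(2)] M.l_neg[OF x(2)]
      by (intro bexI[of _ "\<ominus>\<^bsub>M\<^esub> x"]) simp_all
  qed (use V zero add in \<open>auto simp: subset_iff M.a_ac\<close>)
qed (use V act in \<open>auto simp: subset_iff act_add add_act act_act one_act\<close>)

lemma rspan_closed: "U \<subseteq> carrier M \<Longrightarrow> v \<in> rspan R M U \<Longrightarrow> v \<in> carrier M"
  by (erule rspan.induct) (auto intro: act_closed)

lemma rspan_add:
  assumes U: "U \<subseteq> carrier M" and v: "v \<in> rspan R M U" and w: "w \<in> rspan R M U"
  shows "v \<oplus>\<^bsub>M\<^esub> w \<in> rspan R M U"
  using w
proof induction
  case rspan_zero
  then show ?case using v rspan_closed[OF U v] by simp
next
  case (rspan_step w u a)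
  have "v \<oplus>\<^bsub>M\<^esub> (w \<oplus>\<^bsub>M\<^esub> a \<odot>\<^bsub>M\<^esub> u) = (v \<oplus>\<^bsub>M\<^esub> w) \<oplus>\<^bsub>M\<^esub> a \<odot>\<^bsub>M\<^esub> u"
    using rspan_step U v rspan_closed[OF U] by (auto simp: M.a_assoc act_closed)
  then show ?case using rspan_step rspan.rspan_step by metis
qed

lemma rspan_act:
  assumes U: "U \<subseteq> carrier M" and a: "a \<in> carrier R" and v: "v \<in> rspan R M U"
  shows "a \<odot>\<^bsub>M\<^esub> v \<in> rspan R M U"
  using v
proof induction
  case rspan_zero
  then show ?case using a act_zero by (simp add: rspan.rspan_zero)
next
  case (rspan_step w u b)
  have "a \<odot>\<^bsub>M\<^esub> (w \<oplus>\<^bsub>M\<^esub> b \<odot>\<^bsub>M\<^esub> u) = a \<odot>\<^bsub>M\<^esub> w \<oplus>\<^bsub>M\<^esub> (b \<otimes>\<^bsub>R\<^esub> a) \<odot>\<^bsub>M\<^esub> u"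
    using rspan_step U a rspan_closed[OF U] by (auto simp: act_add act_closed act_act)
  then show ?case using rspan_step a by (auto intro: rspan.rspan_step)
qed

lemma rspan_neg:
  assumes U: "U \<subseteq> carrier M" and v: "v \<in> rspan R M U"
  shows "\<ominus>\<^bsub>M\<^esub> v \<in> rspan R M U"
proof -
  have "(\<ominus>\<^bsub>R\<^esub> \<one>\<^bsub>R\<^esub>) \<odot>\<^bsub>M\<^esub> v \<in> rspan R M U" using rspan_act[OF U _ v] by simp
  then show ?thesis using neg_act[OF R.one_closed] rspan_closed[OF U v] one_act by simp
qed

lemma rspan_base: "U \<subseteq> carrier M \<Longrightarrow> u \<in> U \<Longrightarrow> u \<in> rspan R M U"
  using rspan_step[OF rspan_zero, of u U "\<one>\<^bsub>R\<^esub>" R M] one_act[of u] by auto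

lemma rspan_insert:
  assumes U: "insert x U \<subseteq> carrier M" and v: "v \<in> rspan R M (insert x U)"
  obtains w a where "w \<in> rspan R M U" "a \<in> carrier R" "v = w \<oplus>\<^bsub>M\<^esub> a \<odot>\<^bsub>M\<^esub> x"
proof -
  have U': "U \<subseteq> carrier M" and x: "x \<in> carrier M" using U by auto
  have "\<exists>w a. w \<in> rspan R M U \<and> a \<in> carrier R \<and> v = w \<oplus>\<^bsub>M\<^esub> a \<odot>\<^bsub>M\<^esub> x"
    using v
  proof induction
    case rspan_zero
    then show ?case
      using zero_act[OF x] by (intro exI[of _ "\<zero>\<^bsub>M\<^esub>"] exI[of _ "\<zero>\<^bsub>R\<^esub>"]) (simp add: rspan.rspan_zero)
  next
    case (rspan_step v u b)
    then obtain w a where w: "w \<in> rspan R M U" "a \<in> carrier R" "v = w \<oplus>\<^bsub>M\<^esub> a \<odot>\<^bsub>M\<^esub> x" by blast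
    have wc: "w \<in> carrier M" using rspan_closed[OF U' w(1)] .
    show ?case
    proof (cases "u = x")
      case True
      have "v \<oplus>\<^bsub>M\<^esub> b \<odot>\<^bsub>M\<^esub> u = w \<oplus>\<^bsub>M\<^esub> (a \<oplus>\<^bsub>R\<^esub> b) \<odot>\<^bsub>M\<^esub> x"
        using w(2,3) wc x rspan_step(3) True by (simp add: add_act M.a_assoc act_closed)
      then show ?thesis using w rspan_step(3) R.a_closed by blast
    next
      case False
      then have u: "u \<in> U" "u \<in> carrier M" using rspan_step(2) U by auto
      have "v \<oplus>\<^bsub>M\<^esub> b \<odot>\<^bsub>M\<^esub> u = (w \<oplus>\<^bsub>M\<^esub> b \<odot>\<^bsub>M\<^esub> u) \<oplus>\<^bsub>M\<^esub> a \<odot>\<^bsub>M\<^esub> x"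
        using w(2,3) wc x u rspan_step(3) by (simp add: M.a_ac act_closed)
      then show ?thesis using w rspan_step(3) u rspan.rspan_step by metis
    qed
  qed
  then show ?thesis using that by blast
qed

lemma rspan_subspace:
  assumes "U \<subseteq> W" and "\<zero>\<^bsub>M\<^esub> \<in> W" and "\<And>x y. x \<in> W \<Longrightarrow> y \<in> W \<Longrightarrow> x \<oplus>\<^bsub>M\<^esub> y \<in> W"
    and "\<And>a x. a \<in> carrier R \<Longrightarrow> x \<in> W \<Longrightarrow> a \<odot>\<^bsub>M\<^esub> x \<in> W"
  shows "rspan R M U \<subseteq> W"
proof
  fix v assume "v \<in> rspan R M U"
  then show "v \<in> W" by induction (use assms in auto)
qed

end

lemma module_homsD:
  assumes "f \<in> module_homs R M N"
  shows module_homs_funcset: "f \<in> carrier M \<rightarrow>\<^sub>E carrier N"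
    and module_homs_closed: "x \<in> carrier M \<Longrightarrow> f x \<in> carrier N"
    and module_homs_add: "x \<in> carrier M \<Longrightarrow> y \<in> carrier M \<Longrightarrow> f (x \<oplus>\<^bsub>M\<^esub> y) = f x \<oplus>\<^bsub>N\<^esub> f y"
    and module_homs_act: "a \<in> carrier R \<Longrightarrow> x \<in> carrier M \<Longrightarrow> f (a \<odot>\<^bsub>M\<^esub> x) = a \<odot>\<^bsub>N\<^esub> f x"
  using assms by (auto simp: module_homs_def)

lemma module_homsI:
  assumes "f \<in> carrier M \<rightarrow>\<^sub>E carrier N"
    and "\<And>x y. x \<in> carrier M \<Longrightarrow> y \<in> carrier M \<Longrightarrow> f (x \<oplus>\<^bsub>M\<^esub> y) = f x \<oplus>\<^bsub>N\<^esub> f y"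
    and "\<And>a x. a \<in> carrier R \<Longrightarrow> x \<in> carrier M \<Longrightarrow> f (a \<odot>\<^bsub>M\<^esub> x) = a \<odot>\<^bsub>N\<^esub> f x"
  shows "f \<in> module_homs R M N"
  using assms by (simp add: module_homs_def)

lemma module_homs_eqI:
  assumes "f \<in> module_homs R M N" "g \<in> module_homs R M N" "\<And>x. x \<in> carrier M \<Longrightarrow> f x = g x"
  shows "f = g"
  using assms by (meson PiE_ext module_homs_funcset)

lemma module_homs_compose:
  assumes f: "f \<in> module_homs R M N" and g: "g \<in> module_homs R N P" and M: "right_module R M"
  shows "compose (carrier M) g f \<in> module_homs R M P"
proof (rule module_homsI)
  interpret right_module R M by (rule M)
  show "compose (carrier M) g f \<in> carrier M \<rightarrow>\<^sub>E carrier P"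
    using module_homs_closed[OF f] module_homs_closed[OF g] by (auto simp: compose_def)
  show "compose (carrier M) g f (x \<oplus>\<^bsub>M\<^esub> y) = compose (carrier M) g f x \<oplus>\<^bsub>P\<^esub> compose (carrier M) g f y"
    if "x \<in> carrier M" "y \<in> carrier M" for x y
    using that f g by (simp add: compose_def module_homs_add module_homs_closed)
  show "compose (carrier M) g f (a \<odot>\<^bsub>M\<^esub> x) = a \<odot>\<^bsub>P\<^esub> compose (carrier M) g f x"
    if "a \<in> carrier R" "x \<in> carrier M" for a x
    using that f g by (simp add: compose_def module_homs_act module_homs_closed act_closed)
qed

lemma module_homs_id: "right_module R M \<Longrightarrow> (\<lambda>x\<in>carrier M. x) \<in> module_homs R M M"
  by (rule module_homsI)
    (auto simp: right_module.act_closed abelian_groupE(1) right_module_def)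

lemma module_homs_zero:
  assumes "f \<in> module_homs R M N" "right_module R M" "right_module R N"
  shows "f \<zero>\<^bsub>M\<^esub> = \<zero>\<^bsub>N\<^esub>"
proof -
  interpret M: right_module R M by fact
  interpret N: right_module R N by fact
  have "f (\<zero>\<^bsub>R\<^esub> \<odot>\<^bsub>M\<^esub> \<zero>\<^bsub>M\<^esub>) = \<zero>\<^bsub>R\<^esub> \<odot>\<^bsub>N\<^esub> f \<zero>\<^bsub>M\<^esub>"
    using module_homs_act[OF assms(1)] by simp
  then show ?thesis using M.zero_act N.zero_act module_homs_closed[OF assms(1)] by simp
qed

lemma module_homs_inverse:
  assumes f: "f \<in> module_homs R M N" and b: "bij_betw f (carrier M) (carrier N)"
    and M: "right_module R M" and N: "right_module R N"
  shows "(\<lambda>y\<in>carrier N. inv_into (carrier M) f y) \<in> module_homs R N M"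
proof (rule module_homsI)
  interpret M: right_module R M by (rule M)
  interpret N: right_module R N by (rule N)
  let ?g = "\<lambda>y\<in>carrier N. inv_into (carrier M) f y"
  have g: "?g y \<in> carrier M" "f (?g y) = y" if "y \<in> carrier N" for y
    using that b bij_betw_inv_into_right[OF b that] inv_into_into[of y f "carrier M"]
    by (simp_all add: bij_betw_def)
  have gf: "?g (f x) = x" if "x \<in> carrier M" for x
    using bij_betw_inv_into_left[OF b that] module_homs_closed[OF f that] by simp
  show "?g \<in> carrier N \<rightarrow>\<^sub>E carrier M" using g(1) by auto
  show "?g (x \<oplus>\<^bsub>N\<^esub> y) = ?g x \<oplus>\<^bsub>M\<^esub> ?g y" if "x \<in> carrier N" "y \<in> carrier N" for x y
    using gf[of "?g x \<oplus>\<^bsub>M\<^esub> ?g y"] module_homs_add[OF f g(1)[OF that(1)] g(1)[OF that(2)]]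
      g[OF that(1)] g[OF that(2)] M.M.a_closed by metis
  show "?g (a \<odot>\<^bsub>N\<^esub> x) = a \<odot>\<^bsub>M\<^esub> ?g x" if "a \<in> carrier R" "x \<in> carrier N" for a x
    using gf[of "a \<odot>\<^bsub>M\<^esub> ?g x"] module_homs_act[OF f that(1) g(1)[OF that(2)]]
      g[OF that(2)] M.act_closed[OF that(1)] by metis
qed

lemma module_homs_eq_on_rspan:
  assumes "f \<in> module_homs R M N" "g \<in> module_homs R M N" "right_module R M" "right_module R N"
    and "U \<subseteq> carrier M" "\<And>u. u \<in> U \<Longrightarrow> f u = g u" "v \<in> rspan R M U"
  shows "f v = g v"
  using assms(7)
proof induction
  case rspan_zero
  then show ?case using module_homs_zero assms by metis
next
  case (rspan_step v u a)
  interpret M: right_module R M by fact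
  have "v \<in> carrier M" "u \<in> carrier M" "a \<odot>\<^bsub>M\<^esub> u \<in> carrier M"
    using rspan_step assms(5) M.rspan_closed M.act_closed by auto
  then show ?case
    using rspan_step assms(6) by (simp add: module_homs_add[OF assms(1)] module_homs_add[OF assms(2)]
      module_homs_act[OF assms(1)] module_homs_act[OF assms(2)])
qed

definition prod_module ::
  "('a, 'b, 'y) module_scheme \<Rightarrow> ('a, 'c, 'w) module_scheme \<Rightarrow> ('a, 'b \<times> 'c) module" where
  "prod_module M N =
     \<lparr>carrier = carrier M \<times> carrier N, monoid.mult = undefined, one = undefined,
      ring.zero = (\<zero>\<^bsub>M\<^esub>, \<zero>\<^bsub>N\<^esub>), ring.add = (\<lambda>(x, y) (x', y'). (x \<oplus>\<^bsub>M\<^esub> x', y \<oplus>\<^bsub>N\<^esub> y')),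
      smult = (\<lambda>a (x, y). (a \<odot>\<^bsub>M\<^esub> x, a \<odot>\<^bsub>N\<^esub> y))\<rparr>"

lemma prod_module_simps [simp]:
  "carrier (prod_module M N) = carrier M \<times> carrier N"
  "\<zero>\<^bsub>prod_module M N\<^esub> = (\<zero>\<^bsub>M\<^esub>, \<zero>\<^bsub>N\<^esub>)"
  "(x, y) \<oplus>\<^bsub>prod_module M N\<^esub> (x', y') = (x \<oplus>\<^bsub>M\<^esub> x', y \<oplus>\<^bsub>N\<^esub> y')"
  "a \<odot>\<^bsub>prod_module M N\<^esub> (x, y) = (a \<odot>\<^bsub>M\<^esub> x, a \<odot>\<^bsub>N\<^esub> y)"
  by (simp_all add: prod_module_def)

lemma right_module_prod:
  assumes "right_module R M" "right_module R N"
  shows "right_module R (prod_module M N)"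
proof -
  interpret M: right_module R M by fact
  interpret N: right_module R N by fact
  show ?thesis
  proof (intro right_module.intro right_module_axioms.intro)
    show "ring R" by (rule M.R.ring_axioms)
    show "abelian_group (prod_module M N)"
    proof (rule abelian_groupI)
      fix x assume "x \<in> carrier (prod_module M N)"
      then show "\<exists>y\<in>carrier (prod_module M N). y \<oplus>\<^bsub>prod_module M N\<^esub> x = \<zero>\<^bsub>prod_module M N\<^esub>"
        by (intro bexI[of _ "(\<ominus>\<^bsub>M\<^esub> fst x, \<ominus>\<^bsub>N\<^esub> snd x)"]) (auto simp: M.M.l_neg N.M.l_neg)
    qed (auto simp: M.M.a_ac N.M.a_ac)
  qed (auto simp: M.act_closed N.act_closed M.act_add N.act_add M.add_act N.add_act
      M.act_act N.act_act M.one_act N.one_act)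
qed

text \<open>
  The submodule of \<open>M \<times> N\<close> generated by the graph of \<open>d\<close> on \<open>U\<close>.  If \<open>U\<close> is a basis, it is the
  graph of the linear extension of \<open>d\<close>.
\<close>

abbreviation lin_graph ::
  "('a, 'x) ring_scheme \<Rightarrow> ('a, 'b, 'y) module_scheme \<Rightarrow> ('a, 'c, 'w) module_scheme \<Rightarrow>
    'b set \<Rightarrow> ('b \<Rightarrow> 'c) \<Rightarrow> ('b \<times> 'c) set" where
  "lin_graph R M N U d \<equiv> rspan R (prod_module M N) ((\<lambda>u. (u, d u)) ` U)"

lemma lin_graph_fst: "p \<in> lin_graph R M N U d \<Longrightarrow> fst p \<in> rspan R M U"
proof (induction rule: rspan.induct)
  case rspan_zero
  then show ?case by (simp add: rspan.rspan_zero)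
next
  case (rspan_step p q a)
  then obtain u where "u \<in> U" "q = (u, d u)" by blast
  moreover obtain m n where "p = (m, n)" by fastforce
  ultimately show ?case using rspan_step by (simp add: rspan.rspan_step)
qed

lemma rspan_lin_graph: "m \<in> rspan R M U \<Longrightarrow> \<exists>n. (m, n) \<in> lin_graph R M N U d"
proof (induction rule: rspan.induct)
  case rspan_zero
  then show ?case using rspan.rspan_zero[of "prod_module M N" R] by auto
next
  case (rspan_step m u a)
  then obtain n where n: "(m, n) \<in> lin_graph R M N U d" by blast
  from rspan.rspan_step[OF n, of "(u, d u)" a] rspan_step show ?case by auto
qed

locale right_vector_space = right_module R M
  for R :: "('a, 'x) ring_scheme" (structure) and M :: "('a, 'b, 'y) module_scheme" (structure) +
  assumes division: "division_ring R"
begin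

lemma inverse_ex:
  assumes "a \<in> carrier R" "a \<noteq> \<zero>\<^bsub>R\<^esub>"
  obtains b where "b \<in> carrier R" "a \<otimes>\<^bsub>R\<^esub> b = \<one>\<^bsub>R\<^esub>"
  using assms division unfolding division_ring_def Units_def by blast

lemma rspan_exchange:
  assumes U: "insert x U \<subseteq> carrier M" and w: "w \<in> rspan R M U" and a: "a \<in> carrier R" "a \<noteq> \<zero>\<^bsub>R\<^esub>"
    and v: "w \<oplus>\<^bsub>M\<^esub> a \<odot>\<^bsub>M\<^esub> x \<in> rspan R M U"
  shows "x \<in> rspan R M U"
proof -
  have U': "U \<subseteq> carrier M" and x: "x \<in> carrier M" using U by auto
  obtain b where b: "b \<in> carrier R" "a \<otimes>\<^bsub>R\<^esub> b = \<one>\<^bsub>R\<^esub>" using inverse_ex a by blast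
  have wc: "w \<in> carrier M" using rspan_closed[OF U' w] .
  have "\<ominus>\<^bsub>M\<^esub> w \<oplus>\<^bsub>M\<^esub> (w \<oplus>\<^bsub>M\<^esub> a \<odot>\<^bsub>M\<^esub> x) \<in> rspan R M U"
    using rspan_add[OF U' rspan_neg[OF U' w] v] .
  then have "a \<odot>\<^bsub>M\<^esub> x \<in> rspan R M U"
    using wc act_closed[OF a(1) x] M.r_neg2[of "\<ominus>\<^bsub>M\<^esub> w"] by (simp add: M.r_neg1)
  then have "b \<odot>\<^bsub>M\<^esub> (a \<odot>\<^bsub>M\<^esub> x) \<in> rspan R M U" using rspan_act[OF U' b(1)] by blast
  then show ?thesis using act_act[OF a(1) b(1) x] b(2) one_act[OF x] by simp
qed

lemma rindep_insert:
  assumes U: "insert x U \<subseteq> carrier M" and ind: "rindep R M U" and x: "x \<notin> rspan R M U"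
  shows "rindep R M (insert x U)"
  unfolding rindep_def
proof (intro ballI notI)
  have U': "U \<subseteq> carrier M" using U by auto
  have xU: "x \<notin> U" using x rspan_base[OF U'] by blast
  fix u assume u: "u \<in> insert x U" and span: "u \<in> rspan R M (insert x U - {u})"
  show False
  proof (cases "u = x")
    case True
    then show ?thesis using span x xU by simp
  next
    case False
    then have uU: "u \<in> U" and eq: "insert x U - {u} = insert x (U - {u})" using u by auto
    have sub: "insert x (U - {u}) \<subseteq> carrier M" using U by auto
    obtain w a where w: "w \<in> rspan R M (U - {u})" "a \<in> carrier R" "u = w \<oplus>\<^bsub>M\<^esub> a \<odot>\<^bsub>M\<^esub> x"
      using rspan_insert[OF sub] span eq by metis
    show ?thesis
    proof (cases "a = \<zero>\<^bsub>R\<^esub>")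
      case True
      have "x \<in> carrier M" "w \<in> carrier M" using U U' rspan_closed[OF _ w(1)] by auto
      then have "w = u" using w(3) True zero_act by simp
      then have "u \<in> rspan R M (U - {u})" using w(1) by metis
      then show ?thesis using uU ind by (auto simp: rindep_def)
    next
      case False
      have "w \<in> rspan R M U" using w(1) rspan_mono[of "U - {u}" U] by blast
      then show ?thesis
        using rspan_exchange[OF U _ w(2) False] w(3) rspan_base[OF U' uU] x by simp
    qed
  qed
qed

text \<open>
  A maximal independent set between \<open>V\<close> and \<open>W\<close> exists by Zorn's lemma, since membership in a
  span involves only finitely many of its generators.
\<close>

lemma basis_extension:
  assumes W: "W \<subseteq> carrier M" and V: "V \<subseteq> W" "rindep R M V"
  obtains B where "V \<subseteq> B" "B \<subseteq> W" "rindep R M B" "W \<subseteq> rspan R M B"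
proof -
  let ?A = "{B. V \<subseteq> B \<and> B \<subseteq> W \<and> rindep R M B}"
  have "\<exists>B\<in>?A. \<forall>X\<in>?A. B \<subseteq> X \<longrightarrow> X = B"
  proof (rule subset_Zorn_nonempty)
    show "?A \<noteq> {}" using V by auto
  next
    fix \<C> assume ne: "\<C> \<noteq> {}" and ch: "subset.chain ?A \<C>"
    have span: "\<exists>X\<in>\<C>. u \<in> X \<and> v \<in> rspan R M (X - {u})"
      if u: "u \<in> \<Union>\<C>" and v: "v \<in> rspan R M (\<Union>\<C> - {u})" for u v
      using v
    proof induction
      case rspan_zero
      then show ?case using u by (auto intro: rspan.rspan_zero)
    next
      case (rspan_step v w a)
      then obtain X Y where XY: "X \<in> \<C>" "Y \<in> \<C>" "u \<in> X" "v \<in> rspan R M (X - {u})" "w \<in> Y - {u}" by blast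
      then have "X \<subseteq> Y \<or> Y \<subseteq> X" using ch unfolding subset.chain_def by blast
      then obtain Z where Z: "Z \<in> \<C>" "X \<subseteq> Z" "Y \<subseteq> Z" using XY by blast
      have "v \<in> rspan R M (Z - {u})" using XY(4) Z rspan_mono[of "X - {u}" "Z - {u}"] by blast
      moreover have "w \<in> Z - {u}" using XY Z by blast
      ultimately have "v \<oplus>\<^bsub>M\<^esub> a \<odot>\<^bsub>M\<^esub> w \<in> rspan R M (Z - {u})"
        using rspan_step(3) rspan.rspan_step by metis
      then show ?case using XY Z by blast
    qed
    have "rindep R M (\<Union>\<C>)"
      unfolding rindep_def
    proof (intro ballI notI)
      fix u assume "u \<in> \<Union>\<C>" "u \<in> rspan R M (\<Union>\<C> - {u})"
      then obtain X where "X \<in> \<C>" "u \<in> X" "u \<in> rspan R M (X - {u})" using span by blast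
      moreover have "\<C> \<subseteq> ?A" using ch by (simp add: subset.chain_def)
      ultimately show False by (auto simp: rindep_def)
    qed
    moreover have "\<C> \<subseteq> ?A" using ch by (simp add: subset.chain_def)
    then have "V \<subseteq> \<Union>\<C>" "\<Union>\<C> \<subseteq> W" using ne by auto
    ultimately show "\<Union>\<C> \<in> ?A" by simp
  qed
  then obtain B where "B \<in> ?A" and "\<forall>X\<in>?A. B \<subseteq> X \<longrightarrow> X = B" ..
  then have B: "V \<subseteq> B" "B \<subseteq> W" "rindep R M B"
    and max: "\<And>X. V \<subseteq> X \<Longrightarrow> X \<subseteq> W \<Longrightarrow> rindep R M X \<Longrightarrow> B \<subseteq> X \<Longrightarrow> X = B" by simp_all
  have "W \<subseteq> rspan R M B"
  proof
    fix x assume x: "x \<in> W"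
    show "x \<in> rspan R M B"
    proof (rule ccontr)
      assume nx: "x \<notin> rspan R M B"
      have sub: "insert x B \<subseteq> carrier M" using x B W by auto
      have "insert x B = B" using max[of "insert x B"] rindep_insert[OF sub B(3) nx] x B by auto
      then show False using nx rspan_base[of B x] sub by auto
    qed
  qed
  then show ?thesis using that B by blast
qed

text \<open>
  A pair in \<open>lin_graph\<close> involves only finitely many generators, and they can be removed one at a
  time: in a relation \<open>0 = m' + a u\<close> with \<open>m'\<close> in the span of the others, independence forces
  \<open>a = 0\<close>.
\<close>

lemma lin_graph_functional:
  assumes N: "right_module R N" and U: "U \<subseteq> carrier M" "rindep R M U"
    and d: "\<And>u. u \<in> U \<Longrightarrow> d u \<in> carrier N" and G: "(\<zero>\<^bsub>M\<^esub>, n) \<in> lin_graph R M N U d"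
  shows "n = \<zero>\<^bsub>N\<^esub>"
proof -
  interpret N: right_module R N by (rule N)
  interpret P: right_module R "prod_module M N" by (rule right_module_prod[OF right_module_axioms N])
  have "n = \<zero>\<^bsub>N\<^esub>" if "finite F" "F \<subseteq> U" "(\<zero>\<^bsub>M\<^esub>, n) \<in> lin_graph R M N F d" for F n
    using that
  proof (induction F arbitrary: n rule: finite_induct)
    case empty
    then show ?case by (auto elim: rspan.cases)
  next
    case (insert u F)
    have F: "insert u F \<subseteq> carrier M" "u \<in> carrier M" "d u \<in> carrier N" using insert U d by auto
    have sub: "insert (u, d u) ((\<lambda>u. (u, d u)) ` F) \<subseteq> carrier (prod_module M N)"
      using insert U d by auto
    have "(\<zero>\<^bsub>M\<^esub>, n) \<in> rspan R (prod_module M N) (insert (u, d u) ((\<lambda>u. (u, d u)) ` F))"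
      using insert.prems(2) by simp
    then obtain p a where p: "p \<in> lin_graph R M N F d" "a \<in> carrier R"
      "(\<zero>\<^bsub>M\<^esub>, n) = p \<oplus>\<^bsub>prod_module M N\<^esub> a \<odot>\<^bsub>prod_module M N\<^esub> (u, d u)"
      by (rule P.rspan_insert[OF sub])
    obtain m' n' where mn: "p = (m', n')" by fastforce
    have c: "m' \<in> carrier M" "n' \<in> carrier N" using P.rspan_closed[OF _ p(1)] sub mn by auto
    have eq: "\<zero>\<^bsub>M\<^esub> = m' \<oplus>\<^bsub>M\<^esub> a \<odot>\<^bsub>M\<^esub> u" "n = n' \<oplus>\<^bsub>N\<^esub> a \<odot>\<^bsub>N\<^esub> d u" using p(3) mn by simp_all
    have m': "m' \<in> rspan R M F" using lin_graph_fst[OF p(1)] mn by simp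
    have "a = \<zero>\<^bsub>R\<^esub>"
    proof (rule ccontr)
      assume "a \<noteq> \<zero>\<^bsub>R\<^esub>"
      then have "u \<in> rspan R M F"
        using rspan_exchange[OF F(1) m' p(2)] eq(1)[symmetric] by (simp add: rspan_zero)
      moreover have "F \<subseteq> U - {u}" using insert by auto
      ultimately have "u \<in> rspan R M (U - {u})" using rspan_mono by blast
      then show False using U(2) insert.prems(1) unfolding rindep_def by blast
    qed
    then have "m' = \<zero>\<^bsub>M\<^esub>" "n = n'" using eq zero_act[OF F(2)] N.zero_act[OF F(3)] c by simp_all
    then show ?case using insert.IH insert.prems(1) p(1) mn by simp
  qed
  moreover obtain E where E: "E \<subseteq> (\<lambda>u. (u, d u)) ` U" "finite E" "(\<zero>\<^bsub>M\<^esub>, n) \<in> rspan R (prod_module M N) E"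
    using rspan_finite[OF G] by blast
  obtain F where "F \<subseteq> U" "finite F" "E = (\<lambda>u. (u, d u)) ` F"
    using finite_subset_image[OF E(2,1)] by blast
  ultimately show ?thesis using E(3) by simp
qed

end

lemma linear_extension:
  fixes M N :: "('a, 'b) module"
  assumes M: "right_vector_space R M" and N: "right_module R N"
    and U: "U \<subseteq> carrier M" "rindep R M U" "carrier M \<subseteq> rspan R M U"
    and d: "\<And>u. u \<in> U \<Longrightarrow> d u \<in> carrier N"
  shows "\<exists>\<phi>\<in>module_homs R M N. \<forall>u\<in>U. \<phi> u = d u"
proof -
  interpret M: right_vector_space R M by (rule M)
  interpret N: right_module R N by (rule N)
  let ?P = "prod_module M N"
  interpret P: right_module R ?P by (rule right_module_prod[OF M.right_module_axioms N])
  let ?G = "lin_graph R M N U d"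
  have sub: "(\<lambda>u. (u, d u)) ` U \<subseteq> carrier ?P" using U(1) d by auto
  have closed: "m \<in> carrier M" "n \<in> carrier N" if "(m, n) \<in> ?G" for m n
    using P.rspan_closed[OF sub that] by auto
  have unique: "n = n'" if n: "(m, n) \<in> ?G" and n': "(m, n') \<in> ?G" for m n n'
  proof -
    have c: "m \<in> carrier M" "n \<in> carrier N" "n' \<in> carrier N" using closed n n' by blast+
    have "(\<ominus>\<^bsub>R\<^esub> \<one>\<^bsub>R\<^esub>) \<odot>\<^bsub>?P\<^esub> (m, n') \<in> ?G" using P.rspan_act[OF sub _ n'] by simp
    then have "(\<ominus>\<^bsub>M\<^esub> m, \<ominus>\<^bsub>N\<^esub> n') \<in> ?G"
      using c by (simp add: M.neg_act N.neg_act M.one_act N.one_act)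
    from P.rspan_add[OF sub n this] have "(\<zero>\<^bsub>M\<^esub>, n \<oplus>\<^bsub>N\<^esub> \<ominus>\<^bsub>N\<^esub> n') \<in> ?G" using c by (simp add: M.M.r_neg)
    then have "n \<oplus>\<^bsub>N\<^esub> \<ominus>\<^bsub>N\<^esub> n' = \<zero>\<^bsub>N\<^esub>"
      using M.lin_graph_functional[where d = d, OF N U(1,2) d] by blast
    then show ?thesis using c by (metis N.M.add.inv_closed N.M.minus_equality N.M.minus_minus)
  qed
  define \<phi> where "\<phi> = (\<lambda>m\<in>carrier M. THE n. (m, n) \<in> ?G)"
  have \<phi>: "\<phi> m = n" if "(m, n) \<in> ?G" for m n
    using that closed[OF that] unique unfolding \<phi>_def by (auto intro: the_equality)
  have graph: "(m, \<phi> m) \<in> ?G" if "m \<in> carrier M" for m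
  proof -
    have "m \<in> rspan R M U" using U(3) that by blast
    then obtain n where "(m, n) \<in> ?G" using rspan_lin_graph[of m R M U N d] by blast
    then show ?thesis using \<phi> by metis
  qed
  show ?thesis
  proof (intro bexI[of _ \<phi>] ballI)
    show "\<phi> \<in> module_homs R M N"
    proof (rule module_homsI)
      show "\<phi> \<in> carrier M \<rightarrow>\<^sub>E carrier N"
        using closed(2)[OF graph] by (auto simp: \<phi>_def)
      show "\<phi> (x \<oplus>\<^bsub>M\<^esub> y) = \<phi> x \<oplus>\<^bsub>N\<^esub> \<phi> y" if "x \<in> carrier M" "y \<in> carrier M" for x y
        using \<phi> P.rspan_add[OF sub graph[OF that(1)] graph[OF that(2)]] by simp
      show "\<phi> (a \<odot>\<^bsub>M\<^esub> x) = a \<odot>\<^bsub>N\<^esub> \<phi> x" if "a \<in> carrier R" "x \<in> carrier M" for a x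
        using \<phi> P.rspan_act[OF sub that(1) graph[OF that(2)]] by simp
    qed
    show "\<phi> u = d u" if u: "u \<in> U" for u
      by (rule \<phi>, rule P.rspan_base[OF sub]) (use u in simp)
  qed
qed

text \<open>
  A basis of the image of \<open>f\<close>, extended to the whole space, allows to choose preimages of the
  basis vectors that lie in the image.
\<close>

lemma module_hom_regular:
  fixes M N :: "('a, 'b) module"
  assumes M: "right_module R M" and N: "right_vector_space R N" and f: "f \<in> module_homs R M N"
  obtains g where "g \<in> module_homs R N M" "\<And>x. x \<in> carrier M \<Longrightarrow> f (g (f x)) = f x"
proof -
  interpret M: right_module R M by (rule M)
  interpret N: right_vector_space R N by (rule N)
  have N': "right_module R N" by unfold_locales
  have im: "f ` carrier M \<subseteq> carrier N" using module_homs_closed[OF f] by blast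
  have emp: "rindep R N {}" by (simp add: rindep_def)
  obtain V where "{} \<subseteq> V"
    and V: "V \<subseteq> f ` carrier M" "rindep R N V" "f ` carrier M \<subseteq> rspan R N V"
    by (rule N.basis_extension[OF im empty_subsetI emp])
  have VN: "V \<subseteq> carrier N" using V im by blast
  obtain B where B: "V \<subseteq> B" "B \<subseteq> carrier N" "rindep R N B" "carrier N \<subseteq> rspan R N B"
    by (rule N.basis_extension[OF subset_refl VN V(2)])
  define d where "d v = (if v \<in> V then (SOME x. x \<in> carrier M \<and> f x = v) else \<zero>\<^bsub>M\<^esub>)" for v
  have d: "d v \<in> carrier M \<and> f (d v) = v" if "v \<in> V" for v
  proof -
    have "\<exists>x. x \<in> carrier M \<and> f x = v" using that V(1) by blast
    then show ?thesis using that someI_ex[of "\<lambda>x. x \<in> carrier M \<and> f x = v"] by (simp add: d_def)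
  qed
  have dB: "d v \<in> carrier M" if "v \<in> B" for v
    using d by (cases "v \<in> V") (auto simp: d_def)
  obtain g where g: "g \<in> module_homs R N M" "\<And>v. v \<in> B \<Longrightarrow> g v = d v"
    using linear_extension[where d = d, OF N M B(2-4) dB] by blast
  show ?thesis
  proof (rule that[OF g(1)])
    fix x assume x: "x \<in> carrier M"
    have "compose (carrier N) f g (f x) = (\<lambda>x\<in>carrier N. x) (f x)"
    proof (rule module_homs_eq_on_rspan[where v = "f x" and f = "compose (carrier N) f g" and g = "\<lambda>x\<in>carrier N. x", OF _ _ N' N' VN])
      show "compose (carrier N) f g \<in> module_homs R N N"
        using module_homs_compose[OF g(1) f N'] .
      show "(\<lambda>x\<in>carrier N. x) \<in> module_homs R N N" using module_homs_id[OF N'] .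
      show "compose (carrier N) f g v = (\<lambda>x\<in>carrier N. x) v" if "v \<in> V" for v
        using that d[OF that] g(2) B(1) VN by (auto simp: compose_def)
      show "f x \<in> rspan R N V" using V(3) x by blast
    qed
    then show "f (g (f x)) = f x" using module_homs_closed[OF f x] by (simp add: compose_def)
  qed
qed

text \<open>The inverse is the linear extension of the inverse bijection between the bases.\<close>

lemma basis_bij:
  fixes M N :: "('a, 'b) module"
  assumes M: "right_module R M" and N: "right_vector_space R N" and f: "f \<in> module_homs R M N"
    and U: "U \<subseteq> carrier M" "carrier M \<subseteq> rspan R M U" "inj_on f U"
    and fU: "rindep R N (f ` U)" "carrier N \<subseteq> rspan R N (f ` U)"
  shows "bij_betw f (carrier M) (carrier N)"
proof -
  interpret M: right_module R M by (rule M)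
  interpret N: right_vector_space R N by (rule N)
  have N': "right_module R N" by unfold_locales
  have fUN: "f ` U \<subseteq> carrier N" using U(1) module_homs_closed[OF f] by blast
  have d: "inv_into U f v \<in> carrier M" if "v \<in> f ` U" for v
    using that U(1) inv_into_into[of v f U] by blast
  obtain g where g: "g \<in> module_homs R N M" "\<And>v. v \<in> f ` U \<Longrightarrow> g v = inv_into U f v"
    using linear_extension[where d = "inv_into U f", OF N M fUN fU d] by blast
  have gf: "g (f x) = x" if x: "x \<in> carrier M" for x
  proof -
    have "compose (carrier M) g f x = (\<lambda>x\<in>carrier M. x) x"
    proof (rule module_homs_eq_on_rspan[where v = x and f = "compose (carrier M) g f" and g = "\<lambda>x\<in>carrier M. x", OF _ _ M M U(1)])
      show "compose (carrier M) g f \<in> module_homs R M M" using module_homs_compose[OF f g(1) M] .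
      show "(\<lambda>x\<in>carrier M. x) \<in> module_homs R M M" using module_homs_id[OF M] .
      show "compose (carrier M) g f u = (\<lambda>x\<in>carrier M. x) u" if "u \<in> U" for u
        using that U g(2) by (auto simp: compose_def)
      show "x \<in> rspan R M U" using U(2) x by blast
    qed
    then show ?thesis using x by (simp add: compose_def)
  qed
  have fg: "f (g y) = y" if y: "y \<in> carrier N" for y
  proof -
    have "compose (carrier N) f g y = (\<lambda>x\<in>carrier N. x) y"
    proof (rule module_homs_eq_on_rspan[where v = y and f = "compose (carrier N) f g" and g = "\<lambda>x\<in>carrier N. x", OF _ _ N' N' fUN])
      show "compose (carrier N) f g \<in> module_homs R N N" using module_homs_compose[OF g(1) f N'] .
      show "(\<lambda>x\<in>carrier N. x) \<in> module_homs R N N" using module_homs_id[OF N'] .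
      show "compose (carrier N) f g u = (\<lambda>x\<in>carrier N. x) u" if "u \<in> f ` U" for u
        using that U g(2)[OF that] fUN by (auto simp: compose_def)
      show "y \<in> rspan R N (f ` U)" using fU(2) y by blast
    qed
    then show ?thesis using y by (simp add: compose_def)
  qed
  show ?thesis
  proof (rule bij_betw_byWitness[where f' = g])
    show "\<forall>x\<in>carrier M. g (f x) = x" by (intro ballI gf)
    show "\<forall>y\<in>carrier N. f (g y) = y" by (intro ballI fg)
    show "f ` carrier M \<subseteq> carrier N" by (rule image_subsetI) (rule module_homs_closed[OF f])
    show "g ` carrier N \<subseteq> carrier M" by (rule image_subsetI) (rule module_homs_closed[OF g(1)])
  qed
qed

section \<open>Exactness of distinguished triangles\<close>

definition triangle :: "('o, 'm, 'z) tricat_scheme \<Rightarrow> 'o \<Rightarrow> 'o \<Rightarrow> 'o \<Rightarrow> 'm \<Rightarrow> 'm \<Rightarrow> 'm \<Rightarrow> bool" where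
  "triangle T X Y Z u v w \<longleftrightarrow> (u, v, w) \<in> Tri T \<and>
     u \<in> Hom T X Y \<and> v \<in> Hom T Y Z \<and> w \<in> Hom T Z (Susp T X)"

context triangulated_category
begin

lemma susp_obj: "X \<in> Obj T \<Longrightarrow> Susp T X \<in> Obj T"
  by (rule cat_functor.map_obj[OF susp_functor])

lemma susp_hom: "f \<in> Hom T X Y \<Longrightarrow> SuspA T f \<in> Hom T (Susp T X) (Susp T Y)"
  by (rule cat_functor.map_hom[OF susp_functor])

lemma susp_idt: "X \<in> Obj T \<Longrightarrow> SuspA T (Idt T X) = Idt T (Susp T X)"
  by (rule cat_functor.map_idt[OF susp_functor])

lemma susp_comp: "f \<in> Hom T X Y \<Longrightarrow> g \<in> Hom T Y Z \<Longrightarrow> SuspA T (g \<cdot> f) = SuspA T g \<cdot> SuspA T f"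
  by (rule cat_functor.map_comp[OF susp_functor])

lemma susp_zero:
  assumes "X \<in> Obj T" "Y \<in> Obj T"
  shows "SuspA T (Zero T X Y) = Zero T (Susp T X) (Susp T Y)"
proof -
  note z = zero_hom[OF assms] and s = susp_hom[OF zero_hom[OF assms]]
  have "SuspA T (Zero T X Y) \<boxplus> SuspA T (Zero T X Y) = SuspA T (Zero T X Y)"
    using susp_add[OF z z] zero_add[OF z] by simp
  also have "\<dots> = SuspA T (Zero T X Y) \<boxplus> Zero T (Susp T X) (Susp T Y)"
    using add_zero[OF s] by simp
  finally show ?thesis
    using add_left_cancel[OF s s zero_hom[OF susp_obj susp_obj]] assms by blast
qed

lemma susp_neg:
  assumes "f \<in> Hom T X Y"
  shows "SuspA T (Neg T f) = Neg T (SuspA T f)"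
proof (rule neg_unique[OF susp_hom[OF assms] susp_hom[OF neg_hom[OF assms]]])
  show "SuspA T f \<boxplus> SuspA T (Neg T f) = Zero T (Susp T X) (Susp T Y)"
    using susp_add[OF assms neg_hom[OF assms]] add_neg[OF assms] susp_zero hom_objs[OF assms] by simp
qed

lemma susp_inj: "f \<in> Hom T X Y \<Longrightarrow> g \<in> Hom T X Y \<Longrightarrow> SuspA T f = SuspA T g \<Longrightarrow> f = g"
  using susp_bij_arr by (auto simp: bij_betw_def inj_on_def Hom_def)

lemma susp_obj_inj: "X \<in> Obj T \<Longrightarrow> Y \<in> Obj T \<Longrightarrow> Susp T X = Susp T Y \<Longrightarrow> X = Y"
  using susp_bij_obj by (auto simp: bij_betw_def inj_on_def)

lemma susp_hom_ex:
  assumes g: "g \<in> Hom T (Susp T X) (Susp T Y)" and X: "X \<in> Obj T" and Y: "Y \<in> Obj T"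
  obtains f where "f \<in> Hom T X Y" "SuspA T f = g"
proof -
  have "g \<in> SuspA T ` Arr T" using susp_bij_arr HomD(1)[OF g] by (simp add: bij_betw_def)
  then obtain f where f: "f \<in> Arr T" "SuspA T f = g" by blast
  have f': "f \<in> Hom T (Dom T f) (Cod T f)" using f by (simp add: HomI)
  have "Susp T (Dom T f) = Susp T X" "Susp T (Cod T f) = Susp T Y"
    using HomD(2,3)[OF g] HomD(2,3)[OF susp_hom[OF f']] f(2) by simp_all
  then have "Dom T f = X" "Cod T f = Y" using susp_obj_inj X Y hom_objs[OF f'] by blast+
  then show ?thesis using that f f' by simp
qed

lemma desusp_obj: "X \<in> Obj T \<Longrightarrow> Desusp T X \<in> Obj T"
  using susp_bij_obj inv_into_into[of X "Susp T" "Obj T"] by (simp add: Desusp_def bij_betw_def)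

lemma susp_desusp: "X \<in> Obj T \<Longrightarrow> Susp T (Desusp T X) = X"
  using susp_bij_obj by (simp add: Desusp_def bij_betw_inv_into_right)

lemma desusp_susp: "X \<in> Obj T \<Longrightarrow> Desusp T (Susp T X) = X"
  using susp_bij_obj by (simp add: Desusp_def bij_betw_inv_into_left)

lemma hom_zero_susp:
  assumes "X \<in> Obj T" "Y \<in> Obj T"
  shows "hom_zero T (Susp T X) (Susp T Y) \<longleftrightarrow> hom_zero T X Y"
proof
  assume h: "hom_zero T (Susp T X) (Susp T Y)"
  show "hom_zero T X Y"
  proof (rule hom_zeroI[OF assms])
    fix f assume f: "f \<in> Hom T X Y"
    then have "SuspA T f = SuspA T (Zero T X Y)"
      using hom_zeroD[OF h susp_hom[OF f]] susp_zero assms by simp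
    then show "f = Zero T X Y" using susp_inj[OF f zero_hom[OF assms]] by blast
  qed
next
  assume h: "hom_zero T X Y"
  show "hom_zero T (Susp T X) (Susp T Y)"
  proof (rule hom_zeroI)
    show "Susp T X \<in> Obj T" "Susp T Y \<in> Obj T" using assms susp_obj by blast+
    fix g assume "g \<in> Hom T (Susp T X) (Susp T Y)"
    then obtain f where "f \<in> Hom T X Y" "SuspA T f = g" using susp_hom_ex assms by blast
    then show "g = Zero T (Susp T X) (Susp T Y)"
      using hom_zeroD[OF h] susp_zero[OF assms] by blast
  qed
qed

lemma susp_zero_object:
  assumes "is_zero_object T Z"
  shows "is_zero_object T (Susp T Z)"
proof -
  have Z: "Z \<in> Obj T" using assms by (simp add: is_zero_object_def)
  then have "hom_zero T (Susp T Z) (Susp T Z)"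
    using hom_zero_susp[OF Z Z] zero_object_hom_zero(1)[OF assms Z] by simp
  then show ?thesis using zero_objectI[OF susp_obj[OF Z]] by blast
qed

lemma triangle_objs:
  assumes "triangle T X Y Z u v w"
  shows "X \<in> Obj T" "Y \<in> Obj T" "Z \<in> Obj T"
  using assms hom_objs unfolding triangle_def by blast+

lemma triangle_cone:
  assumes u: "u \<in> Hom T X Y"
  obtains Z v w where "triangle T X Y Z u v w"
proof -
  obtain v w where t: "(u, v, w) \<in> Tri T" using tri_cone HomD(1)[OF u] by blast
  then have "triangle T X Y (Cod T v) u v w"
    using tri_candidate[OF t] u by (auto simp: triangle_def candidate_triangle_def Hom_def)
  then show ?thesis using that by blast
qed

lemma triangle_rotate:
  assumes t: "triangle T X Y Z u v w"
  shows "triangle T Y Z (Susp T X) v w (Neg T (SuspA T u))"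
proof -
  have "candidate_triangle T u v w" using t tri_candidate by (simp add: triangle_def)
  then show ?thesis
    using t tri_rotate neg_hom[OF susp_hom[of u X Y]] by (simp add: triangle_def)
qed

lemma triangle_unrotate:
  assumes t: "triangle T Y Z (Susp T X) v w d" and X: "X \<in> Obj T"
  obtains u where "triangle T X Y Z u v w"
proof -
  have h: "v \<in> Hom T Y Z" "w \<in> Hom T Z (Susp T X)" "d \<in> Hom T (Susp T X) (Susp T Y)"
    using t by (simp_all add: triangle_def)
  have "Neg T d \<in> Hom T (Susp T X) (Susp T Y)" using neg_hom[OF h(3)] .
  then obtain u where u: "u \<in> Hom T X Y" "SuspA T u = Neg T d"
    using susp_hom_ex X hom_objs h(1) by blast
  have "candidate_triangle T u v w"
    using u h by (simp add: candidate_triangle_def Hom_def)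
  then have "(u, v, w) \<in> Tri T"
    using tri_rotate t u(2) neg_neg[OF h(3)] by (simp add: triangle_def)
  then show ?thesis using that u h by (simp add: triangle_def)
qed

lemma triangle_comp_zero:
  assumes t: "triangle T X Y Z u v w"
  shows "v \<cdot> u = Zero T X Z"
proof -
  have h: "u \<in> Hom T X Y" "v \<in> Hom T Y Z" "(u, v, w) \<in> Tri T" using t by (auto simp: triangle_def)
  note o = triangle_objs[OF t]
  obtain N where N: "is_zero_object T N" using ex_zero_object by blast
  then have NO: "N \<in> Obj T" by (simp add: is_zero_object_def)
  note id = tri_idt[OF o(1) N] and idX = idt_hom[OF o(1)]
  have "\<exists>c\<in>Hom T N Z. c \<cdot> Zero T X N = v \<cdot> u"
    using tri_morphism[OF id h(3), of "Idt T X" u] idX HomD[OF idX] HomD[OF h(1)] HomD[OF h(2)] h(1)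
      HomD[OF zero_hom[OF o(1) NO]] by auto
  then show ?thesis using comp_zero o(1) by metis
qed

text \<open>
  Exactness of \<open>Hom(W, -)\<close> at \<open>Y\<close>: the square formed by \<open>f\<close> and the zero arrow is completed to a
  morphism from the rotated triangle \<open>W \<rightarrow> 0 \<rightarrow> \<Sigma>W\<close>, and the third component is desuspended.
\<close>

lemma triangle_lift:
  assumes t: "triangle T X Y Z u v w" and f: "f \<in> Hom T W Y" "v \<cdot> f = Zero T W Z"
  obtains g where "g \<in> Hom T W X" "u \<cdot> g = f"
proof -
  have h: "u \<in> Hom T X Y" "v \<in> Hom T Y Z" "w \<in> Hom T Z (Susp T X)" using t by (auto simp: triangle_def)
  note o = triangle_objs[OF t]
  have W: "W \<in> Obj T" using f hom_objs by blast
  obtain N where N: "is_zero_object T N" using ex_zero_object by blast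
  then have NO: "N \<in> Obj T" by (simp add: is_zero_object_def)
  have "triangle T W W N (Idt T W) (Zero T W N) (Zero T N (Susp T W))"
    using tri_idt[OF W N] idt_hom[OF W] zero_hom[OF W NO] zero_hom[OF NO susp_obj[OF W]]
    by (simp add: triangle_def)
  from triangle_rotate[OF this]
  have s: "triangle T W N (Susp T W) (Zero T W N) (Zero T N (Susp T W)) (Neg T (Idt T (Susp T W)))"
    using susp_idt[OF W] by simp
  note t' = triangle_rotate[OF t]
  have zn: "Zero T N Z \<in> Hom T N Z" using zero_hom[OF NO o(3)] .
  have "Zero T N Z \<cdot> Zero T W N = v \<cdot> f" using zero_comp[OF zero_hom[OF W NO] o(3)] f(2) by simp
  then have "\<exists>c\<in>Hom T (Susp T W) (Susp T X). SuspA T f \<cdot> Neg T (Idt T (Susp T W)) = Neg T (SuspA T u) \<cdot> c"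
    using tri_morphism[of "Zero T W N" "Zero T N (Susp T W)" "Neg T (Idt T (Susp T W))" v w
        "Neg T (SuspA T u)" f "Zero T N Z"] s t' f(1) zn
    by (auto simp: triangle_def HomD)
  then obtain c where c: "c \<in> Hom T (Susp T W) (Susp T X)"
    "SuspA T f \<cdot> Neg T (Idt T (Susp T W)) = Neg T (SuspA T u) \<cdot> c" by blast
  obtain g where g: "g \<in> Hom T W X" "SuspA T g = c" using susp_hom_ex[OF c(1) W o(1)] by blast
  note sf = susp_hom[OF f(1)] and su = susp_hom[OF h(1)] and ug = comp_hom[OF g(1) h(1)]
  have "Neg T (SuspA T f) = Neg T (SuspA T (u \<cdot> g))"
    using c(2) g(2) comp_neg[OF idt_hom[OF susp_obj[OF W]] sf] comp_idt_right[OF sf]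
      neg_comp[OF c(1) su] susp_comp[OF g(1) h(1)] by simp
  then have "SuspA T f = SuspA T (u \<cdot> g)"
    using neg_neg[OF sf] neg_neg[OF susp_hom[OF ug]] by metis
  then have "u \<cdot> g = f" using susp_inj[OF f(1) ug] by simp
  then show ?thesis using that g(1) by blast
qed

text \<open>
  Exactness of \<open>Hom(-, W)\<close> at \<open>Y\<close>: dually, \<open>g\<close> is completed to a morphism to the triangle
  \<open>0 \<rightarrow> W \<rightarrow> W\<close>.
\<close>

lemma triangle_extend:
  assumes t: "triangle T X Y Z u v w" and g: "g \<in> Hom T Y W" "g \<cdot> u = Zero T X W"
  obtains h where "h \<in> Hom T Z W" "h \<cdot> v = g"
proof -
  have h: "u \<in> Hom T X Y" "v \<in> Hom T Y Z" "w \<in> Hom T Z (Susp T X)" "(u, v, w) \<in> Tri T"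
    using t by (auto simp: triangle_def)
  note o = triangle_objs[OF t]
  have W: "W \<in> Obj T" using g hom_objs by blast
  obtain N where N: "is_zero_object T N" using ex_zero_object by blast
  then have NO: "N \<in> Obj T" by (simp add: is_zero_object_def)
  have sN: "is_zero_object T (Susp T N)" and sNO: "Susp T N \<in> Obj T"
    using susp_zero_object[OF N] susp_obj[OF NO] .
  have "triangle T W W (Susp T N) (Idt T W) (Zero T W (Susp T N)) (Zero T (Susp T N) (Susp T W))"
    using tri_idt[OF W sN] idt_hom[OF W] zero_hom[OF W sNO] zero_hom[OF sNO susp_obj[OF W]]
    by (simp add: triangle_def)
  then obtain k where k: "triangle T N W W k (Idt T W) (Zero T W (Susp T N))"
    using triangle_unrotate NO by blast
  have kh: "k \<in> Hom T N W" using k by (simp add: triangle_def)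
  have zx: "Zero T X N \<in> Hom T X N" using zero_hom[OF o(1) NO] .
  have "g \<cdot> u = k \<cdot> Zero T X N" using g(2) comp_zero[OF kh o(1)] by simp
  then have "\<exists>c\<in>Hom T Z W. c \<cdot> v = Idt T W \<cdot> g"
    using tri_morphism[of u v w k "Idt T W" "Zero T W (Susp T N)" "Zero T X N" g] h k g(1) zx
    by (auto simp: triangle_def HomD)
  then show ?thesis using that comp_idt_left[OF g(1)] by auto
qed

text \<open>
  \<open>\<Sigma>g \<cdot> w\<close> is the obstruction to extending \<open>g\<close> along \<open>u\<close>: this is exactness of \<open>Hom(-, \<Sigma>W)\<close> for the
  twice rotated triangle.
\<close>

lemma triangle_extend3:
  assumes t: "triangle T X Y Z u v w" and g: "g \<in> Hom T X W" "SuspA T g \<cdot> w = Zero T Z (Susp T W)"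
  obtains h where "h \<in> Hom T Y W" "h \<cdot> u = g"
proof -
  have u: "u \<in> Hom T X Y" using t by (simp add: triangle_def)
  have W: "W \<in> Obj T" and Y: "Y \<in> Obj T" using g u hom_objs by blast+
  obtain h' where h': "h' \<in> Hom T (Susp T Y) (Susp T W)" "h' \<cdot> Neg T (SuspA T u) = SuspA T g"
    using triangle_extend[OF triangle_rotate[OF triangle_rotate[OF t]] susp_hom[OF g(1)] g(2)] by blast
  obtain h where h: "h \<in> Hom T Y W" "SuspA T h = h'" using susp_hom_ex[OF h'(1) Y W] by blast
  have n: "Neg T h \<in> Hom T Y W" using neg_hom[OF h(1)] .
  have "SuspA T (Neg T h \<cdot> u) = Neg T h' \<cdot> SuspA T u"
    using susp_comp[OF u n] susp_neg[OF h(1)] h(2) by simp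
  also have "\<dots> = SuspA T g"
    using neg_comp[OF susp_hom[OF u] h'(1)] comp_neg[OF susp_hom[OF u] h'(1)] h'(2) by simp
  finally have "Neg T h \<cdot> u = g" using susp_inj[OF comp_hom[OF u n] g(1)] by blast
  then show ?thesis using that n by blast
qed

lemma triangle_connecting_zero:
  assumes t: "triangle T X Y Z u v w" and f: "f \<in> Hom T (Susp T W) Z" and W: "W \<in> Obj T"
  obtains c where "c \<in> Hom T W X" "SuspA T c = w \<cdot> f" "u \<cdot> c = Zero T W Y"
proof -
  have h: "u \<in> Hom T X Y" "w \<in> Hom T Z (Susp T X)" using t by (auto simp: triangle_def)
  note o = triangle_objs[OF t]
  have "w \<cdot> f \<in> Hom T (Susp T W) (Susp T X)" using comp_hom[OF f h(2)] .
  then obtain c where c: "c \<in> Hom T W X" "SuspA T c = w \<cdot> f" using susp_hom_ex W o(1) by blast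
  note su = susp_hom[OF h(1)]
  have nw: "Neg T (SuspA T u) \<cdot> w = Zero T Z (Susp T Y)"
    using triangle_comp_zero[OF triangle_rotate[OF triangle_rotate[OF t]]] by simp
  have "Neg T (SuspA T u \<cdot> (w \<cdot> f)) = (Neg T (SuspA T u) \<cdot> w) \<cdot> f"
    using comp_assoc[OF f h(2) neg_hom[OF su]] neg_comp[OF comp_hom[OF f h(2)] su] by simp
  also have "\<dots> = Zero T (Susp T W) (Susp T Y)" using nw zero_comp[OF f susp_obj[OF o(2)]] by simp
  finally have "SuspA T u \<cdot> (w \<cdot> f) = Zero T (Susp T W) (Susp T Y)"
    using neg_neg[OF comp_hom[OF comp_hom[OF f h(2)] su]] neg_zero[OF susp_obj[OF W] susp_obj[OF o(2)]]
    by metis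
  then have "SuspA T (u \<cdot> c) = SuspA T (Zero T W Y)"
    using susp_comp[OF c(1) h(1)] c(2) susp_zero[OF W o(2)] by simp
  then have "u \<cdot> c = Zero T W Y" using susp_inj[OF comp_hom[OF c(1) h(1)] zero_hom[OF W o(2)]] by blast
  then show ?thesis using that c by blast
qed

text \<open>
  In the exact sequence \<open>Hom(\<Sigma>W, Y) \<rightarrow> Hom(\<Sigma>W, Z) \<rightarrow> Hom(W, X) \<rightarrow> Hom(W, Y)\<close>, injectivity of the last
  map makes the first one surjective.
\<close>

lemma triangle_hom_surj:
  assumes t: "triangle T X Y Z u v w" and W: "W \<in> Obj T"
    and inj: "\<And>c. c \<in> Hom T W X \<Longrightarrow> u \<cdot> c = Zero T W Y \<Longrightarrow> c = Zero T W X"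
    and f: "f \<in> Hom T (Susp T W) Z"
  obtains y where "y \<in> Hom T (Susp T W) Y" "v \<cdot> y = f"
proof -
  obtain c where c: "c \<in> Hom T W X" "SuspA T c = w \<cdot> f" "u \<cdot> c = Zero T W Y"
    using triangle_connecting_zero[OF t f W] by blast
  have "w \<cdot> f = Zero T (Susp T W) (Susp T X)"
    using inj[OF c(1,3)] c(2) susp_zero W triangle_objs(1)[OF t] by simp
  then show ?thesis using triangle_lift[OF triangle_rotate[OF t] f] that by blast
qed

end

section \<open>Iterated suspensions and compactness\<close>

context triangulated_category
begin

lemma susp_pow_0: "susp_pow T 0 X = X"
  by (simp add: susp_pow_def)

lemma desusp_iter_obj: "X \<in> Obj T \<Longrightarrow> (Desusp T ^^ n) X \<in> Obj T"
  by (induction n) (auto simp: desusp_obj)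

lemma susp_iter_obj: "X \<in> Obj T \<Longrightarrow> (Susp T ^^ n) X \<in> Obj T"
  by (induction n) (auto simp: susp_obj)

lemma susp_pow_obj: "X \<in> Obj T \<Longrightarrow> susp_pow T n X \<in> Obj T"
  by (simp add: susp_pow_def desusp_iter_obj susp_iter_obj)

lemma susp_pow_Suc:
  assumes "X \<in> Obj T"
  shows "susp_pow T (n + 1) X = Susp T (susp_pow T n X)"
proof (cases "n \<ge> 0")
  case True
  then have "nat (n + 1) = Suc (nat n)" by simp
  then show ?thesis using True by (simp add: susp_pow_def)
next
  case False
  then have "nat (- n) = Suc (nat (- (n + 1)))" by simp
  then have "susp_pow T n X = Desusp T ((Desusp T ^^ nat (- (n + 1))) X)"
    using False by (simp add: susp_pow_def)
  then have "Susp T (susp_pow T n X) = (Desusp T ^^ nat (- (n + 1))) X"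
    using susp_desusp desusp_iter_obj[OF assms] by simp
  moreover have "n + 1 = 0 \<or> n + 1 < 0" using False by auto
  ultimately show ?thesis by (auto simp: susp_pow_def)
qed

lemma susp_pow_pred: "X \<in> Obj T \<Longrightarrow> susp_pow T (n - 1) X = Desusp T (susp_pow T n X)"
  using susp_pow_Suc[of X "n - 1"] desusp_susp[OF susp_pow_obj[of X "n - 1"]] by simp

lemma susp_pow_add:
  assumes "X \<in> Obj T"
  shows "susp_pow T (m + n) X = susp_pow T m (susp_pow T n X)"
proof (induction m rule: int_induct[of _ 0])
  case base
  then show ?case by (simp add: susp_pow_0)
next
  case (step1 m)
  then show ?case
    using susp_pow_Suc[OF assms, of "m + n"] susp_pow_Suc[OF susp_pow_obj[OF assms], of m n]
    by (simp add: algebra_simps)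
next
  case (step2 m)
  then show ?case
    using susp_pow_pred[OF assms, of "m + n"] susp_pow_pred[OF susp_pow_obj[OF assms], of m n]
    by (simp add: algebra_simps)
qed

lemma hom_zero_susp_pow:
  assumes "X \<in> Obj T" "Y \<in> Obj T"
  shows "hom_zero T (susp_pow T n X) (susp_pow T n Y) \<longleftrightarrow> hom_zero T X Y"
proof (induction n rule: int_induct[of _ 0])
  case base
  then show ?case by (simp add: susp_pow_0)
next
  case (step1 n)
  then show ?case
    using susp_pow_Suc assms hom_zero_susp[OF susp_pow_obj[OF assms(1)] susp_pow_obj[OF assms(2)]] by simp
next
  case (step2 n)
  have "susp_pow T n X = Susp T (susp_pow T (n - 1) X)" "susp_pow T n Y = Susp T (susp_pow T (n - 1) Y)"
    using susp_pow_Suc[OF assms(1), of "n - 1"] susp_pow_Suc[OF assms(2), of "n - 1"] by simp_all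
  then show ?case
    using step2 hom_zero_susp[OF susp_pow_obj[OF assms(1)] susp_pow_obj[OF assms(2)]] by simp
qed

text \<open>
  \<open>\<Sigma>\<close> is an automorphism, so it preserves and reflects coproducts.
\<close>

lemma coproduct_susp:
  assumes X: "\<And>i. i \<in> I \<Longrightarrow> X i \<in> Obj T" and P: "P \<in> Obj T"
    and \<iota>: "\<And>i. i \<in> I \<Longrightarrow> \<iota> i \<in> Hom T (X i) P"
  shows "is_coproduct T I (\<lambda>i. Susp T (X i)) (Susp T P) (\<lambda>i. SuspA T (\<iota> i)) \<longleftrightarrow> is_coproduct T I X P \<iota>"
proof
  assume c: "is_coproduct T I X P \<iota>"
  show "is_coproduct T I (\<lambda>i. Susp T (X i)) (Susp T P) (\<lambda>i. SuspA T (\<iota> i))"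
    unfolding is_coproduct_def
  proof (intro conjI ballI allI impI)
    show "Susp T P \<in> Obj T" using P susp_obj by blast
    show "SuspA T (\<iota> i) \<in> Hom T (Susp T (X i)) (Susp T P)" if "i \<in> I" for i
      using \<iota>[OF that] susp_hom by blast
    fix Y f assume Y: "Y \<in> Obj T" and f: "\<forall>i\<in>I. f i \<in> Hom T (Susp T (X i)) Y"
    let ?Y = "Desusp T Y"
    have Y': "?Y \<in> Obj T" "Susp T ?Y = Y" using Y desusp_obj susp_desusp by auto
    have "\<forall>i\<in>I. \<exists>g. g \<in> Hom T (X i) ?Y \<and> SuspA T g = f i"
    proof
      fix i assume i: "i \<in> I"
      then have "f i \<in> Hom T (Susp T (X i)) (Susp T ?Y)" using f Y' by simp
      from susp_hom_ex[OF this X[OF i] Y'(1)] show "\<exists>g. g \<in> Hom T (X i) ?Y \<and> SuspA T g = f i" by blast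
    qed
    then obtain g where g: "\<forall>i\<in>I. g i \<in> Hom T (X i) ?Y \<and> SuspA T (g i) = f i" by metis
    then obtain h where h: "h \<in> Hom T P ?Y" "\<And>i. i \<in> I \<Longrightarrow> h \<cdot> \<iota> i = g i"
      using coproduct_hom_ex[OF c Y'(1), of g] by blast
    show "\<exists>!h. h \<in> Hom T (Susp T P) Y \<and> (\<forall>i\<in>I. h \<cdot> SuspA T (\<iota> i) = f i)"
    proof
      show "SuspA T h \<in> Hom T (Susp T P) Y \<and> (\<forall>i\<in>I. SuspA T h \<cdot> SuspA T (\<iota> i) = f i)"
      proof (intro conjI ballI)
        show "SuspA T h \<in> Hom T (Susp T P) Y" using susp_hom[OF h(1)] Y'(2) by simp
        show "SuspA T h \<cdot> SuspA T (\<iota> i) = f i" if "i \<in> I" for i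
          using susp_comp[OF \<iota>[OF that] h(1)] h(2)[OF that] g that by simp
      qed
      fix k assume k: "k \<in> Hom T (Susp T P) Y \<and> (\<forall>i\<in>I. k \<cdot> SuspA T (\<iota> i) = f i)"
      then have "k \<in> Hom T (Susp T P) (Susp T ?Y)" using Y' by simp
      from susp_hom_ex[OF this P Y'(1)] obtain k' where k': "k' \<in> Hom T P ?Y" "SuspA T k' = k" by blast
      have "k' = h"
      proof (rule coproduct_hom_eqI[OF c k'(1) h(1)])
        fix i assume i: "i \<in> I"
        have "SuspA T (k' \<cdot> \<iota> i) = SuspA T (h \<cdot> \<iota> i)"
          using susp_comp[OF \<iota>[OF i] k'(1)] k k'(2) h(2)[OF i] g i by simp
        then show "k' \<cdot> \<iota> i = h \<cdot> \<iota> i"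
          using susp_inj comp_hom[OF \<iota>[OF i] k'(1)] comp_hom[OF \<iota>[OF i] h(1)] by blast
      qed
      then show "k = SuspA T h" using k' by simp
    qed
  qed
next
  assume c: "is_coproduct T I (\<lambda>i. Susp T (X i)) (Susp T P) (\<lambda>i. SuspA T (\<iota> i))"
  show "is_coproduct T I X P \<iota>"
    unfolding is_coproduct_def
  proof (intro conjI ballI allI impI)
    show "P \<in> Obj T" by (rule P)
    show "\<iota> i \<in> Hom T (X i) P" if "i \<in> I" for i using \<iota>[OF that] .
    fix Y f assume Y: "Y \<in> Obj T" and f: "\<forall>i\<in>I. f i \<in> Hom T (X i) Y"
    obtain h' where h': "h' \<in> Hom T (Susp T P) (Susp T Y)"
      "\<And>i. i \<in> I \<Longrightarrow> h' \<cdot> SuspA T (\<iota> i) = SuspA T (f i)"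
      using coproduct_hom_ex[OF c susp_obj[OF Y], of "\<lambda>i. SuspA T (f i)"] f susp_hom by blast
    obtain h where h: "h \<in> Hom T P Y" "SuspA T h = h'" using susp_hom_ex[OF h'(1) P Y] by blast
    show "\<exists>!h. h \<in> Hom T P Y \<and> (\<forall>i\<in>I. h \<cdot> \<iota> i = f i)"
    proof
      show "h \<in> Hom T P Y \<and> (\<forall>i\<in>I. h \<cdot> \<iota> i = f i)"
      proof (intro conjI ballI)
        show "h \<in> Hom T P Y" by (rule h)
        fix i assume i: "i \<in> I"
        have "SuspA T (h \<cdot> \<iota> i) = SuspA T (f i)"
          using susp_comp[OF \<iota>[OF i] h(1)] h(2) h'(2)[OF i] by simp
        then show "h \<cdot> \<iota> i = f i" using susp_inj comp_hom[OF \<iota>[OF i] h(1)] f i by blast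
      qed
      fix k assume k: "k \<in> Hom T P Y \<and> (\<forall>i\<in>I. k \<cdot> \<iota> i = f i)"
      have "SuspA T k = SuspA T h"
      proof (rule coproduct_hom_eqI[OF c])
        show "SuspA T k \<in> Hom T (Susp T P) (Susp T Y)" "SuspA T h \<in> Hom T (Susp T P) (Susp T Y)"
          using k h susp_hom by blast+
        show "SuspA T k \<cdot> SuspA T (\<iota> i) = SuspA T h \<cdot> SuspA T (\<iota> i)" if i: "i \<in> I" for i
          using susp_comp[OF \<iota>[OF i], of k Y] k i h(2) h'(2)[OF i] by simp
      qed
      then show "k = h" using susp_inj k h(1) by blast
    qed
  qed
qed

end

lemma is_coproduct_cong:
  assumes "\<And>i. i \<in> I \<Longrightarrow> X i = X' i" "\<And>i. i \<in> I \<Longrightarrow> \<iota> i = \<iota>' i"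
  shows "is_coproduct C I X P \<iota> \<longleftrightarrow> is_coproduct C I X' P \<iota>'"
  using assms by (simp add: is_coproduct_def cong: ball_cong)

text \<open>
  Surjectivity of the canonical map in the definition of compactness, as an induction principle:
  every arrow from \<open>G\<close> to a coproduct is a finite sum of arrows into the summands.
\<close>

definition finitary :: "'m rel \<Rightarrow> ('o, 'm, 'z) addcat_scheme \<Rightarrow> 'o \<Rightarrow> bool" where
  "finitary \<kappa> T G \<longleftrightarrow> (\<forall>(I :: 'm set) X P \<iota> Q. small \<kappa> I \<longrightarrow> (\<forall>i\<in>I. X i \<in> Obj T) \<longrightarrow>
     is_coproduct T I X P \<iota> \<longrightarrow> Q (Zero T G P) \<longrightarrow>
     (\<forall>y\<in>Hom T G P. \<forall>y'\<in>Hom T G P. Q y \<longrightarrow> Q y' \<longrightarrow> Q (y \<boxplus>\<^bsub>T\<^esub> y')) \<longrightarrow>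
     (\<forall>i\<in>I. \<forall>x\<in>Hom T G (X i). Q (\<iota> i \<cdot>\<^bsub>T\<^esub> x)) \<longrightarrow> (\<forall>y\<in>Hom T G P. Q y))"

lemma finitaryD:
  fixes T :: "('o, 'm, 'z) addcat_scheme" and I :: "'m set"
  assumes "finitary \<kappa> T G" "small \<kappa> I" "\<And>i. i \<in> I \<Longrightarrow> X i \<in> Obj T" "is_coproduct T I X P \<iota>"
    and "y \<in> Hom T G P" "Q (Zero T G P)"
    and "\<And>y y'. y \<in> Hom T G P \<Longrightarrow> y' \<in> Hom T G P \<Longrightarrow> Q y \<Longrightarrow> Q y' \<Longrightarrow> Q (y \<boxplus>\<^bsub>T\<^esub> y')"
    and "\<And>i x. i \<in> I \<Longrightarrow> x \<in> Hom T G (X i) \<Longrightarrow> Q (\<iota> i \<cdot>\<^bsub>T\<^esub> x)"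
  shows "Q y"
proof -
  note D = assms(1)[unfolded finitary_def, rule_format, of I X P \<iota> Q y]
  show ?thesis by (rule D) (use assms in auto)
qed

lemma (in preadditive_category) compact_object_finitary:
  assumes "compact_object \<kappa> C S"
  shows "finitary \<kappa> C S"
  unfolding finitary_def
proof (intro allI impI ballI)
  fix I :: "'m set" and X P \<iota> Q y
  assume I: "small \<kappa> I" and X: "\<forall>i\<in>I. X i \<in> Obj C" and c: "is_coproduct C I X P \<iota>"
    and Q: "Q (Zero C S P)" "\<forall>y\<in>Hom C S P. \<forall>y'\<in>Hom C S P. Q y \<longrightarrow> Q y' \<longrightarrow> Q (y \<boxplus> y')"
      "\<forall>i\<in>I. \<forall>x\<in>Hom C S (X i). Q (\<iota> i \<cdot> x)"
    and y: "y \<in> Hom C S P"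
  have S: "S \<in> Obj C" and P: "P \<in> Obj C" using y hom_objs by blast+
  let ?H = "hom_group C S P" and ?s = "sum_group I (\<lambda>i. hom_group C S (X i))"
  have "(\<lambda>f. gfinprod ?H (\<lambda>i. \<iota> i \<cdot> f i) I) \<in> iso ?s ?H"
    using assms I X c by (simp add: compact_object_def image_subset_iff)
  then have "(\<lambda>f. gfinprod ?H (\<lambda>i. \<iota> i \<cdot> f i) I) ` carrier ?s = carrier ?H"
    by (simp add: iso_def bij_betw_def)
  moreover have "y \<in> carrier ?H" using y by (simp add: hom_group_def)
  ultimately obtain f where f: "f \<in> carrier ?s" and yf: "y = gfinprod ?H (\<lambda>i. \<iota> i \<cdot> f i) I"
    by (metis (no_types, lifting) imageE)
  have "group (hom_group C S (X i))" if "i \<in> I" for i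
    using hom_comm_group[OF S] X that comm_group.axioms(2) by blast
  then have fi: "f i \<in> Hom C S (X i)" if "i \<in> I" for i
    using f that carrier_sum_group[of I "\<lambda>i. hom_group C S (X i)"] by (auto simp: hom_group_def)
  interpret H: comm_group ?H by (rule hom_comm_group[OF S P])
  have \<iota>f: "\<iota> i \<cdot> f i \<in> Hom C S P" if "i \<in> I" for i
    using c fi[OF that] that comp_hom unfolding is_coproduct_def by blast
  have Q_sum: "Q (finprod ?H (\<lambda>i. \<iota> i \<cdot> f i) F)" if "finite F" "F \<subseteq> I" for F
    using that
  proof (induction F rule: finite_induct)
    case empty
    have "\<one>\<^bsub>?H\<^esub> = Zero C S P" by (simp add: hom_group_def)
    then show ?case using Q(1) by simp
  next
    case (insert i F)
    have F: "(\<lambda>i. \<iota> i \<cdot> f i) \<in> F \<rightarrow> carrier ?H" "\<iota> i \<cdot> f i \<in> carrier ?H"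
      using \<iota>f insert by (auto simp: hom_group_def)
    have "finprod ?H (\<lambda>i. \<iota> i \<cdot> f i) F \<in> Hom C S P"
      using H.finprod_closed[OF F(1)] by (simp add: hom_group_def)
    moreover have "Q (\<iota> i \<cdot> f i)" using Q(3) fi insert by blast
    ultimately have "Q ((\<iota> i \<cdot> f i) \<boxplus> finprod ?H (\<lambda>i. \<iota> i \<cdot> f i) F)"
      using Q(2) insert \<iota>f by blast
    then show ?case using H.finprod_insert[OF insert.hyps F] by (simp add: hom_group_def)
  qed
  show "Q y"
  proof (cases "finite {i \<in> I. \<iota> i \<cdot> f i \<noteq> \<one>\<^bsub>?H\<^esub>}")
    case True
    then show ?thesis using yf Q_sum[of "{i \<in> I. \<iota> i \<cdot> f i \<noteq> \<one>\<^bsub>?H\<^esub>}"] by (simp add: gfinprod_def)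
  next
    case False
    then show ?thesis using yf Q(1) by (simp add: gfinprod_def hom_group_def)
  qed
qed

context triangulated_category
begin

text \<open>
  An arrow from \<open>\<Sigma>G\<close> to a coproduct corresponds to one from \<open>G\<close> to the desuspended coproduct.
\<close>

lemma finitary_susp:
  assumes fin: "finitary \<kappa> T G" and G: "G \<in> Obj T"
  shows "finitary \<kappa> T (Susp T G)"
  unfolding finitary_def
proof (intro allI impI ballI)
  fix I :: "'m set" and X P \<iota> Q y
  assume I: "small \<kappa> I" and X: "\<forall>i\<in>I. X i \<in> Obj T" and c: "is_coproduct T I X P \<iota>"
    and Q: "Q (Zero T (Susp T G) P)"
      "\<forall>y\<in>Hom T (Susp T G) P. \<forall>y'\<in>Hom T (Susp T G) P. Q y \<longrightarrow> Q y' \<longrightarrow> Q (y \<boxplus> y')"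
      "\<forall>i\<in>I. \<forall>x\<in>Hom T (Susp T G) (X i). Q (\<iota> i \<cdot> x)"
    and y: "y \<in> Hom T (Susp T G) P"
  let ?P = "Desusp T P" and ?X = "\<lambda>i. Desusp T (X i)"
  have P': "?P \<in> Obj T" "Susp T ?P = P"
    using hom_cod_obj[OF y] desusp_obj susp_desusp by auto
  have X': "?X i \<in> Obj T" "Susp T (?X i) = X i" if "i \<in> I" for i
    using X that desusp_obj susp_desusp by auto
  have "\<forall>i\<in>I. \<exists>j. j \<in> Hom T (?X i) ?P \<and> SuspA T j = \<iota> i"
  proof
    fix i assume i: "i \<in> I"
    then have "\<iota> i \<in> Hom T (Susp T (?X i)) (Susp T ?P)" using c X' P' by (simp add: is_coproduct_def)
    from susp_hom_ex[OF this X'(1)[OF i] P'(1)]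
    show "\<exists>j. j \<in> Hom T (?X i) ?P \<and> SuspA T j = \<iota> i" by blast
  qed
  then obtain j where j: "\<forall>i\<in>I. j i \<in> Hom T (?X i) ?P \<and> SuspA T (j i) = \<iota> i" by metis
  have "is_coproduct T I (\<lambda>i. Susp T (?X i)) P (\<lambda>i. SuspA T (j i))"
    using c is_coproduct_cong[of I X "\<lambda>i. Susp T (?X i)" \<iota> "\<lambda>i. SuspA T (j i)" T P] X' j by simp
  then have c': "is_coproduct T I ?X ?P j"
    using coproduct_susp[of I ?X ?P j] X' P' j by simp
  have "y \<in> Hom T (Susp T G) (Susp T ?P)" using y P' by simp
  then obtain y' where y': "y' \<in> Hom T G ?P" "SuspA T y' = y" using susp_hom_ex G P'(1) by blast
  have "Q (SuspA T y')"
  proof (rule finitaryD[where Q = "\<lambda>y. Q (SuspA T y)", OF fin I X'(1) c' y'(1)])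
    show "Q (SuspA T (Zero T G ?P))" using Q(1) susp_zero[OF G P'(1)] P'(2) by simp
    show "Q (SuspA T (y \<boxplus> y'))"
      if "y \<in> Hom T G ?P" "y' \<in> Hom T G ?P" "Q (SuspA T y)" "Q (SuspA T y')" for y y'
      using Q(2) that susp_add[OF that(1,2)] susp_hom[OF that(1)] susp_hom[OF that(2)] P'(2) by simp
    show "Q (SuspA T (j i \<cdot> x))" if "i \<in> I" "x \<in> Hom T G (?X i)" for i x
      using Q(3) that susp_comp[OF that(2), of "j i" ?P] j X' susp_hom[OF that(2)] by simp
  qed auto
  then show "Q y" using y'(2) by simp
qed

lemma finitary_desusp:
  assumes fin: "finitary \<kappa> T (Susp T G)" and G: "G \<in> Obj T"
  shows "finitary \<kappa> T G"
  unfolding finitary_def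
proof (intro allI impI ballI)
  fix I :: "'m set" and X P \<iota> Q y
  assume I: "small \<kappa> I" and X: "\<forall>i\<in>I. X i \<in> Obj T" and c: "is_coproduct T I X P \<iota>"
    and Q: "Q (Zero T G P)" "\<forall>y\<in>Hom T G P. \<forall>y'\<in>Hom T G P. Q y \<longrightarrow> Q y' \<longrightarrow> Q (y \<boxplus> y')"
      "\<forall>i\<in>I. \<forall>x\<in>Hom T G (X i). Q (\<iota> i \<cdot> x)"
    and y: "y \<in> Hom T G P"
  have P: "P \<in> Obj T" and \<iota>: "\<And>i. i \<in> I \<Longrightarrow> \<iota> i \<in> Hom T (X i) P"
    using c by (auto simp: is_coproduct_def)
  have c': "is_coproduct T I (\<lambda>i. Susp T (X i)) (Susp T P) (\<lambda>i. SuspA T (\<iota> i))"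
    using coproduct_susp[of I X P \<iota>] X P \<iota> c by simp
  have "\<exists>y'\<in>Hom T G P. SuspA T y' = SuspA T y \<and> Q y'"
  proof (rule finitaryD[where Q = "\<lambda>z. \<exists>y'\<in>Hom T G P. SuspA T y' = z \<and> Q y'", OF fin I _ c' susp_hom[OF y]])
    show "Susp T (X i) \<in> Obj T" if "i \<in> I" for i using X that susp_obj by blast
    show "\<exists>y'\<in>Hom T G P. SuspA T y' = Zero T (Susp T G) (Susp T P) \<and> Q y'"
      using Q(1) susp_zero[OF G P] zero_hom[OF G P] by blast
    show "\<exists>y'\<in>Hom T G P. SuspA T y' = a \<boxplus> b \<and> Q y'"
      if "\<exists>y'\<in>Hom T G P. SuspA T y' = a \<and> Q y'" "\<exists>y'\<in>Hom T G P. SuspA T y' = b \<and> Q y'" for a b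
    proof -
      obtain a' b' where *: "a' \<in> Hom T G P" "SuspA T a' = a" "Q a'" "b' \<in> Hom T G P" "SuspA T b' = b" "Q b'"
        using \<open>\<exists>y'\<in>Hom T G P. SuspA T y' = a \<and> Q y'\<close> \<open>\<exists>y'\<in>Hom T G P. SuspA T y' = b \<and> Q y'\<close> by blast
      have "SuspA T (a' \<boxplus> b') = a \<boxplus> b" using susp_add[OF *(1,4)] *(2,5) by simp
      moreover have "a' \<boxplus> b' \<in> Hom T G P" using add_hom[OF *(1,4)] .
      ultimately show ?thesis using Q(2) * by blast
    qed
    show "\<exists>y'\<in>Hom T G P. SuspA T y' = SuspA T (\<iota> i) \<cdot> x \<and> Q y'"
      if i: "i \<in> I" and x: "x \<in> Hom T (Susp T G) (Susp T (X i))" for i x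
    proof -
      obtain x' where x': "x' \<in> Hom T G (X i)" "SuspA T x' = x" using susp_hom_ex[OF x G] X i by blast
      have "SuspA T (\<iota> i \<cdot> x') = SuspA T (\<iota> i) \<cdot> x" using susp_comp[OF x'(1) \<iota>[OF i]] x'(2) by simp
      then show ?thesis using Q(3) i x' comp_hom[OF x'(1) \<iota>[OF i]] by blast
    qed
  qed
  then show "Q y" using susp_inj[OF _ y] by blast
qed

lemma finitary_susp_pow:
  assumes fin: "finitary \<kappa> T G" and G: "G \<in> Obj T"
  shows "finitary \<kappa> T (susp_pow T n G)"
proof (induction n rule: int_induct[of _ 0])
  case base
  then show ?case using fin by (simp add: susp_pow_0)
next
  case (step1 n)
  then show ?case using susp_pow_Suc[OF G] finitary_susp susp_pow_obj[OF G] by simp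
next
  case (step2 n)
  have "susp_pow T n G = Susp T (susp_pow T (n - 1) G)" using susp_pow_Suc[OF G, of "n - 1"] by simp
  then show ?case using step2 finitary_desusp susp_pow_obj[OF G] by simp
qed

end

lemma universe_cardinal_nat:
  fixes \<kappa> :: "'m rel"
  assumes "universe_cardinal \<kappa>"
  obtains e :: "nat \<Rightarrow> 'm" where "inj e" "\<And>N. small \<kappa> (e ` N)"
proof -
  have \<kappa>: "Card_order \<kappa>" "natLeq <o \<kappa>" using assms by (auto simp: universe_cardinal_def)
  have "natLeq \<le>o |Field \<kappa>|"
    using \<kappa> ordLess_imp_ordLeq ordLeq_ordIso_trans ordIso_symmetric card_of_Field_ordIso by blast
  then have "infinite (Field \<kappa>)" using infinite_iff_natLeq_ordLeq by blast
  then obtain e :: "nat \<Rightarrow> 'm" where e: "inj e" using infinite_countable_subset by blast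
  have "small \<kappa> (e ` N)" for N
  proof -
    have "|e ` N| \<le>o |UNIV :: nat set|"
      using card_of_image[of e N] card_of_mono1[OF subset_UNIV[of N]] ordLeq_transitive by blast
    then have "|e ` N| \<le>o natLeq" using card_of_nat ordLeq_ordIso_trans by blast
    then show ?thesis using \<kappa>(2) ordLeq_ordLess_trans unfolding small_def by blast
  qed
  then show ?thesis using that e by blast
qed

lemma small_subset: "small \<kappa> B \<Longrightarrow> A \<subseteq> B \<Longrightarrow> small \<kappa> A"
  unfolding small_def using card_of_mono1 ordLeq_ordLess_trans by blast

section \<open>Represented modules\<close>

context preadditive_category
begin

lemma End_ring_ring:
  assumes W: "W \<in> Obj C"
  shows "ring (End_ring C W)"
proof (rule ringI)
  show "abelian_group (End_ring C W)"
  proof (rule abelian_groupI)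
    fix x assume "x \<in> carrier (End_ring C W)"
    then have x: "x \<in> Hom C W W" by (simp add: End_ring_def)
    show "\<exists>y\<in>carrier (End_ring C W). y \<oplus>\<^bsub>End_ring C W\<^esub> x = \<zero>\<^bsub>End_ring C W\<^esub>"
      using neg_hom[OF x] neg_add[OF x] by (auto simp: End_ring_def)
  qed (auto simp: End_ring_def W zero_hom add_hom add_assoc zero_add intro: add_comm)
  show "monoid (End_ring C W)"
    using W by (intro monoidI)
      (auto simp: End_ring_def idt_hom comp_idt_left comp_idt_right intro: comp_hom comp_assoc)
qed (auto simp: End_ring_def intro: comp_add_left comp_add_right)

lemma hom_obj_right_module:
  assumes W: "W \<in> Obj C" and X: "X \<in> Obj C"
  shows "right_module (End_ring C W) (hom_obj C W X)"
proof (intro right_module.intro right_module_axioms.intro)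
  show "ring (End_ring C W)" by (rule End_ring_ring[OF W])
  show "abelian_group (hom_obj C W X)"
  proof (rule abelian_groupI)
    fix x assume "x \<in> carrier (hom_obj C W X)"
    then have x: "x \<in> Hom C W X" by (simp add: hom_obj_def)
    show "\<exists>y\<in>carrier (hom_obj C W X). y \<oplus>\<^bsub>hom_obj C W X\<^esub> x = \<zero>\<^bsub>hom_obj C W X\<^esub>"
      using neg_hom[OF x] neg_add[OF x] by (auto simp: hom_obj_def)
  qed (auto simp: hom_obj_def W X zero_hom add_hom add_assoc zero_add intro: add_comm)
qed (auto simp: End_ring_def hom_obj_def comp_idt_right
      intro: comp_hom comp_add_left comp_add_right comp_assoc)

lemma hom_obj_post_comp:
  assumes W: "W \<in> Obj C" and f: "f \<in> Hom C X Y"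
  shows "(\<lambda>x\<in>Hom C W X. f \<cdot> x) \<in> module_homs (End_ring C W) (hom_obj C W X) (hom_obj C W Y)"
proof (rule module_homsI)
  show "(\<lambda>x\<in>Hom C W X. f \<cdot> x) \<in> carrier (hom_obj C W X) \<rightarrow>\<^sub>E carrier (hom_obj C W Y)"
    using comp_hom[OF _ f] by (auto simp: hom_obj_def)
  show "(\<lambda>x\<in>Hom C W X. f \<cdot> x) (x \<oplus>\<^bsub>hom_obj C W X\<^esub> y)
      = (\<lambda>x\<in>Hom C W X. f \<cdot> x) x \<oplus>\<^bsub>hom_obj C W Y\<^esub> (\<lambda>x\<in>Hom C W X. f \<cdot> x) y"
    if "x \<in> carrier (hom_obj C W X)" "y \<in> carrier (hom_obj C W X)" for x y
    using that comp_add_left[OF _ _ f] add_hom by (simp add: hom_obj_def)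
  show "(\<lambda>x\<in>Hom C W X. f \<cdot> x) (a \<odot>\<^bsub>hom_obj C W X\<^esub> x)
      = a \<odot>\<^bsub>hom_obj C W Y\<^esub> (\<lambda>x\<in>Hom C W X. f \<cdot> x) x"
    if "a \<in> carrier (End_ring C W)" "x \<in> carrier (hom_obj C W X)" for a x
    using that comp_assoc[OF _ _ f, of a W W x] comp_hom[of a W W x X]
    by (simp add: hom_obj_def End_ring_def)
qed

lemma End_division_ring_iff:
  assumes W: "W \<in> Obj C"
  shows "division_ring (End_ring C W) \<longleftrightarrow> Idt C W \<noteq> Zero C W W \<and>
    (\<forall>f\<in>Hom C W W. f \<noteq> Zero C W W \<longrightarrow> (\<exists>g\<in>Hom C W W. g \<cdot> f = Idt C W \<and> f \<cdot> g = Idt C W))"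
    (is "_ \<longleftrightarrow> ?R")
proof
  assume "division_ring (End_ring C W)"
  then have 1: "Idt C W \<noteq> Zero C W W"
    and U: "Units (End_ring C W) = Hom C W W - {Zero C W W}"
    by (auto simp: division_ring_def End_ring_def)
  have "\<exists>g\<in>Hom C W W. g \<cdot> f = Idt C W \<and> f \<cdot> g = Idt C W" if "f \<in> Hom C W W" "f \<noteq> Zero C W W" for f
  proof -
    have "f \<in> Units (End_ring C W)" using U that by blast
    then show ?thesis by (simp add: Units_def End_ring_def)
  qed
  then show ?R using 1 by blast
next
  assume R: ?R
  have "Zero C W W \<notin> Units (End_ring C W)"
    using R comp_zero[OF _ W] by (auto simp: Units_def End_ring_def)
  then have "Units (End_ring C W) = Hom C W W - {Zero C W W}"
    using R by (auto simp: Units_def End_ring_def)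
  then show "division_ring (End_ring C W)"
    using R End_ring_ring[OF W] by (simp add: division_ring_def End_ring_def)
qed

lemma comp_inj_on:
  assumes f: "f \<in> Hom C X Y" and ker: "\<And>x. x \<in> Hom C W X \<Longrightarrow> f \<cdot> x = Zero C W Y \<Longrightarrow> x = Zero C W X"
  shows "inj_on (\<lambda>x. f \<cdot> x) (Hom C W X)"
proof (rule inj_onI)
  fix x y assume x: "x \<in> Hom C W X" and y: "y \<in> Hom C W X" and eq: "f \<cdot> x = f \<cdot> y"
  have d: "x \<boxplus> Neg C y \<in> Hom C W X" using add_hom[OF x neg_hom[OF y]] .
  have "f \<cdot> (x \<boxplus> Neg C y) = f \<cdot> x \<boxplus> Neg C (f \<cdot> y)"
    using comp_add_left[OF x neg_hom[OF y] f] comp_neg[OF y f] by simp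
  then have "f \<cdot> (x \<boxplus> Neg C y) = Zero C W Y" using eq add_neg[OF comp_hom[OF y f]] by simp
  then show "x = y" using ker[OF d] diff_zero_eq[OF x y] by blast
qed

lemma comp_bij_betw:
  assumes f: "f \<in> Hom C X Y" and "\<And>x. x \<in> Hom C W X \<Longrightarrow> f \<cdot> x = Zero C W Y \<Longrightarrow> x = Zero C W X"
    and "\<And>y. y \<in> Hom C W Y \<Longrightarrow> \<exists>x\<in>Hom C W X. f \<cdot> x = y"
  shows "bij_betw (\<lambda>x. f \<cdot> x) (Hom C W X) (Hom C W Y)"
  unfolding bij_betw_def using comp_inj_on[OF f assms(2)] assms(3) comp_hom[OF _ f] by blast

lemma comp_bij_kernel:
  assumes "bij_betw (\<lambda>x. f \<cdot> x) (Hom C W X) (Hom C W Y)" "f \<in> Hom C X Y" "x \<in> Hom C W X" "f \<cdot> x = Zero C W Y"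
  shows "x = Zero C W X"
proof -
  have o: "W \<in> Obj C" "X \<in> Obj C" using assms hom_objs by blast+
  have "f \<cdot> x = f \<cdot> Zero C W X" using assms(2,4) comp_zero o by simp
  then show ?thesis using assms(1,3) zero_hom[OF o] by (simp add: bij_betw_def inj_on_def)
qed

lemma comp_bij_surj:
  assumes "bij_betw (\<lambda>x. f \<cdot> x) (Hom C W X) (Hom C W Y)" "y \<in> Hom C W Y"
  obtains x where "x \<in> Hom C W X" "f \<cdot> x = y"
proof -
  have "y \<in> (\<lambda>x. f \<cdot> x) ` Hom C W X" using assms by (simp add: bij_betw_def)
  then show ?thesis using that by blast
qed

lemma hom_zero_bij:
  assumes b: "bij_betw (\<lambda>x. f \<cdot> x) (Hom C W X) (Hom C W Y)" and f: "f \<in> Hom C X Y" and W: "W \<in> Obj C"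
  shows "hom_zero C W X \<longleftrightarrow> hom_zero C W Y"
proof
  have o: "X \<in> Obj C" "Y \<in> Obj C" using f hom_objs by blast+
  {
    assume h: "hom_zero C W X"
    show "hom_zero C W Y"
    proof (rule hom_zeroI[OF W o(2)])
      fix y assume "y \<in> Hom C W Y"
      then obtain x where "x \<in> Hom C W X" "f \<cdot> x = y" by (rule comp_bij_surj[OF b])
      then show "y = Zero C W Y" using hom_zeroD[OF h] comp_zero[OF f W] by metis
    qed
  next
    assume h: "hom_zero C W Y"
    show "hom_zero C W X"
    proof (rule hom_zeroI[OF W o(1)])
      fix x assume x: "x \<in> Hom C W X"
      then show "x = Zero C W X"
        using comp_bij_kernel[OF b f x] hom_zeroD[OF h comp_hom[OF x f]] by blast
    qed
  }
qed

text \<open>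
  The injections of a coproduct of copies of \<open>G\<close> span \<open>Hom(G, P)\<close>, because every arrow from \<open>G\<close>
  to the coproduct is a finite sum of arrows into the summands.
\<close>

lemma coproduct_basis:
  fixes I :: "'m set"
  assumes fin: "finitary \<kappa> C G" and I: "small \<kappa> I" and c: "is_coproduct C I (\<lambda>_. G) P \<iota>" and G: "G \<in> Obj C"
  shows "\<iota> ` I \<subseteq> carrier (hom_obj C G P)"
    and "carrier (hom_obj C G P) \<subseteq> rspan (End_ring C G) (hom_obj C G P) (\<iota> ` I)"
proof -
  have P: "P \<in> Obj C" and \<iota>: "\<And>i. i \<in> I \<Longrightarrow> \<iota> i \<in> Hom C G P" using c by (auto simp: is_coproduct_def)
  let ?M = "hom_obj C G P" and ?R = "End_ring C G"
  show sub: "\<iota> ` I \<subseteq> carrier ?M" using \<iota> by (auto simp: hom_obj_def)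
  interpret M: right_module ?R ?M by (rule hom_obj_right_module[OF G P])
  have "y \<in> rspan ?R ?M (\<iota> ` I)" if "y \<in> Hom C G P" for y
  proof (rule finitaryD[where Q = "\<lambda>y. y \<in> rspan ?R ?M (\<iota> ` I)", OF fin I G c that])
    show "Zero C G P \<in> rspan ?R ?M (\<iota> ` I)"
      using rspan_zero[of ?M ?R "\<iota> ` I"] by (simp add: hom_obj_def)
    show "y \<boxplus> y' \<in> rspan ?R ?M (\<iota> ` I)"
      if "y \<in> rspan ?R ?M (\<iota> ` I)" "y' \<in> rspan ?R ?M (\<iota> ` I)" for y y'
      using M.rspan_add[OF sub that] by (simp add: hom_obj_def)
    show "\<iota> i \<cdot> x \<in> rspan ?R ?M (\<iota> ` I)" if "i \<in> I" "x \<in> Hom C G G" for i x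
    proof -
      have "\<iota> i \<in> rspan ?R ?M (\<iota> ` I)" using M.rspan_base[OF sub] that by blast
      from M.rspan_act[OF sub _ this, of x] show ?thesis
        using that(2) by (simp add: hom_obj_def End_ring_def)
    qed
  qed
  then show "carrier ?M \<subseteq> rspan ?R ?M (\<iota> ` I)" by (auto simp: hom_obj_def)
qed

end

text \<open>
  The projections of the coproduct separate its injections.
\<close>

lemma (in additive_category) coproduct_basis_indep:
  fixes I :: "'m set"
  assumes c: "is_coproduct C I (\<lambda>_. G) P \<iota>" and G: "G \<in> Obj C" and nz: "Idt C G \<noteq> Zero C G G"
  shows "rindep (End_ring C G) (hom_obj C G P) (\<iota> ` I)" and "inj_on \<iota> I"
proof -
  have P: "P \<in> Obj C" and \<iota>: "\<And>i. i \<in> I \<Longrightarrow> \<iota> i \<in> Hom C G P" using c by (auto simp: is_coproduct_def)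
  let ?M = "hom_obj C G P" and ?R = "End_ring C G"
  interpret M: right_module ?R ?M by (rule hom_obj_right_module[OF G P])
  have proj: "\<exists>p\<in>Hom C P G. p \<cdot> \<iota> i = Idt C G \<and> (\<forall>j\<in>I. j \<noteq> i \<longrightarrow> p \<cdot> \<iota> j = Zero C G G)"
    if i: "i \<in> I" for i
  proof -
    have sub: "(\<lambda>_. G) ` I \<subseteq> Obj C" using G by auto
    show ?thesis by (rule coproduct_proj[OF c i sub]) blast
  qed
  show inj: "inj_on \<iota> I"
  proof (rule inj_onI)
    fix i j assume "i \<in> I" "j \<in> I" "\<iota> i = \<iota> j"
    then show "i = j" using proj nz by metis
  qed
  show "rindep ?R ?M (\<iota> ` I)"
    unfolding rindep_def
  proof (intro ballI notI)
    fix u assume "u \<in> \<iota> ` I" and span: "u \<in> rspan ?R ?M (\<iota> ` I - {u})"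
    then obtain i where i: "i \<in> I" "u = \<iota> i" by blast
    obtain p where p: "p \<in> Hom C P G" "p \<cdot> \<iota> i = Idt C G" "\<And>j. j \<in> I \<Longrightarrow> j \<noteq> i \<Longrightarrow> p \<cdot> \<iota> j = Zero C G G"
      using proj[OF i(1)] by blast
    \<comment> \<open>the projection to the \<open>i\<close>-th summand vanishes on the span of the other injections\<close>
    have "rspan ?R ?M (\<iota> ` I - {u}) \<subseteq> {v \<in> Hom C G P. p \<cdot> v = Zero C G G}"
    proof (rule M.rspan_subspace)
      show "\<iota> ` I - {u} \<subseteq> {v \<in> Hom C G P. p \<cdot> v = Zero C G G}" using p(3) \<iota> i by auto
      show "\<zero>\<^bsub>?M\<^esub> \<in> {v \<in> Hom C G P. p \<cdot> v = Zero C G G}"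
        using zero_hom[OF G P] comp_zero[OF p(1) G] by (simp add: hom_obj_def)
      show "x \<oplus>\<^bsub>?M\<^esub> y \<in> {v \<in> Hom C G P. p \<cdot> v = Zero C G G}"
        if "x \<in> {v \<in> Hom C G P. p \<cdot> v = Zero C G G}" "y \<in> {v \<in> Hom C G P. p \<cdot> v = Zero C G G}" for x y
        using that add_hom[of x G P y] comp_add_left[of x G P y p G] p(1) zero_add[OF zero_hom[OF G G]]
        by (simp add: hom_obj_def)
      show "a \<odot>\<^bsub>?M\<^esub> x \<in> {v \<in> Hom C G P. p \<cdot> v = Zero C G G}"
        if "a \<in> carrier ?R" "x \<in> {v \<in> Hom C G P. p \<cdot> v = Zero C G G}" for a x
      proof -
        have a: "a \<in> Hom C G G" and x: "x \<in> Hom C G P" "p \<cdot> x = Zero C G G"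
          using that by (auto simp: End_ring_def)
        show ?thesis
          using comp_hom[OF a x(1)] comp_assoc[OF a x(1) p(1)] x(2) zero_comp[OF a G]
          by (simp add: hom_obj_def)
      qed
    qed
    then show False using span i p(2) nz by auto
  qed
qed

text \<open>
  \<open>\<Sigma>\<close> restricts to an isomorphism between the two endomorphism rings.
\<close>

lemma (in triangulated_category) End_division_ring_susp:
  assumes G: "G \<in> Obj T"
  shows "division_ring (End_ring T (Susp T G)) \<longleftrightarrow> division_ring (End_ring T G)"
proof -
  note sG = susp_obj[OF G]
  note zero = susp_zero[OF G G] and idt = susp_idt[OF G]
  have inj: "SuspA T f = SuspA T g \<longleftrightarrow> f = g" if "f \<in> Hom T G G" "g \<in> Hom T G G" for f g
    using susp_inj[OF that] by blast
  have im: "Hom T (Susp T G) (Susp T G) = SuspA T ` Hom T G G"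
  proof
    show "Hom T (Susp T G) (Susp T G) \<subseteq> SuspA T ` Hom T G G"
    proof
      fix g assume "g \<in> Hom T (Susp T G) (Susp T G)"
      from susp_hom_ex[OF this G G] show "g \<in> SuspA T ` Hom T G G" by blast
    qed
  qed (use susp_hom in blast)
  have comp: "SuspA T f \<cdot> SuspA T g = Idt T (Susp T G) \<longleftrightarrow> f \<cdot> g = Idt T G"
    if "f \<in> Hom T G G" "g \<in> Hom T G G" for f g
    using susp_comp[OF that(2,1)] idt inj[OF comp_hom[OF that(2,1)] idt_hom[OF G]] by simp
  show ?thesis
    unfolding End_division_ring_iff[OF G] End_division_ring_iff[OF sG] im
    using comp inj[OF idt_hom[OF G] zero_hom[OF G G]] inj[OF _ zero_hom[OF G G]]
    by (simp flip: zero idt)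
qed

section \<open>Cellular approximation\<close>

locale corigid_generator = triangulated_category T
  for T :: "('o, 'm, 'z) tricat_scheme" (structure) +
  fixes \<kappa> :: "'m rel" and S :: 'o
  assumes universe: "universe_cardinal \<kappa>"
    and loc_small: "locally_small \<kappa> T"
    and coproducts: "has_small_coproducts \<kappa> T"
    and compact: "compact_object \<kappa> T S"
    and corigid: "simply_connected_corigid T S"
    and generating: "generating_set \<kappa> T (range (\<lambda>i. susp_pow T i S))"
begin

text \<open>
  \<open>Hom(cell i, X)\<close> is the cohomology of \<open>X\<close> in degree \<open>i\<close>.  Shifting the source \<open>S\<close> instead of \<open>X\<close>
  leaves triangles and coproducts unshifted, and a long exact sequence only needs
  \<open>\<Sigma> (cell (i + 1)) = cell i\<close>.
\<close>

definition cell :: "int \<Rightarrow> 'o" where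
  "cell i = susp_pow T (- i) S"

lemma S_obj: "S \<in> Obj T"
  using corigid by (simp add: simply_connected_corigid_def)

lemma cell_obj: "cell i \<in> Obj T"
  by (simp add: cell_def susp_pow_obj S_obj)

lemma cell_0: "cell 0 = S"
  by (simp add: cell_def susp_pow_0)

lemma susp_cell: "Susp T (cell (i + 1)) = cell i"
  using susp_pow_Suc[OF S_obj, of "- (i + 1)"] by (simp add: cell_def)

lemma cell_finitary: "finitary \<kappa> T (cell i)"
  unfolding cell_def using finitary_susp_pow[OF compact_object_finitary[OF compact] S_obj] .

lemma cell_division: "division_ring (End_ring T (cell i))"
proof (induction i rule: int_induct[of _ 0])
  case base
  then show ?case using corigid by (simp add: cell_0 simply_connected_corigid_def)
next
  case (step1 i)
  then show ?case using End_division_ring_susp[OF cell_obj[of "i + 1"]] susp_cell by simp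
next
  case (step2 i)
  then show ?case using End_division_ring_susp[OF cell_obj[of i]] susp_cell[of "i - 1"] by simp
qed

lemma hom_zero_cell: "X \<in> Obj T \<Longrightarrow> hom_zero T S (susp_pow T i X) \<longleftrightarrow> hom_zero T (cell i) X"
  using hom_zero_susp_pow[OF S_obj susp_pow_obj[of X i], of "- i"] susp_pow_add[of X "- i" i]
  by (simp add: cell_def susp_pow_0)

lemma hom_zero_cell_susp: "X \<in> Obj T \<Longrightarrow> hom_zero T (cell i) (Susp T X) \<longleftrightarrow> hom_zero T (cell (i + 1)) X"
  using hom_zero_susp[OF cell_obj[of "i + 1"]] susp_cell by simp

lemma cell_cell_less:
  assumes "i < j"
  shows "hom_zero T (cell i) (cell j)"
proof -
  have "hom_zero T (susp_pow T (j - i) S) S"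
    using corigid assms by (simp add: simply_connected_corigid_def)
  then have "hom_zero T (susp_pow T (- j) (susp_pow T (j - i) S)) (susp_pow T (- j) S)"
    using hom_zero_susp_pow susp_pow_obj S_obj by blast
  then show ?thesis using susp_pow_add[OF S_obj, of "- j" "j - i"] by (simp add: cell_def)
qed

lemma cell_cell_Suc: "hom_zero T (cell (i + 1)) (cell i)"
proof -
  have "hom_zero T S (susp_pow T 1 S)"
    using corigid susp_pow_Suc[OF S_obj, of 0] by (simp add: simply_connected_corigid_def susp_pow_0)
  then have "hom_zero T (susp_pow T (- (i + 1)) S) (susp_pow T (- (i + 1)) (susp_pow T 1 S))"
    using hom_zero_susp_pow susp_pow_obj S_obj by blast
  then show ?thesis using susp_pow_add[OF S_obj, of "- (i + 1)" 1] by (simp add: cell_def)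
qed

lemma zero_object_if_acyclic:
  assumes X: "X \<in> Obj T" and "\<And>i. hom_zero T (cell i) X"
  shows "is_zero_object T X"
proof -
  have "hom_zero T (susp_pow T i S) X" for i using assms(2)[of "- i"] by (simp add: cell_def)
  then show ?thesis using generating X by (simp add: generating_set_def)
qed

lemma hom_zero_coproduct_cells:
  fixes I :: "'m set"
  assumes z: "hom_zero T (cell i) (cell m)" and I: "small \<kappa> I" and c: "is_coproduct T I (\<lambda>_. cell m) P \<iota>"
  shows "hom_zero T (cell i) P"
proof (rule hom_zeroI[OF cell_obj])
  show P: "P \<in> Obj T" using c by (simp add: is_coproduct_def)
  fix y assume y: "y \<in> Hom T (cell i) P"
  show "y = Zero T (cell i) P"
  proof (rule finitaryD[where Q = "\<lambda>y. y = Zero T (cell i) P", OF cell_finitary I cell_obj c y])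
    show "\<iota> j \<cdot> x = Zero T (cell i) P" if "j \<in> I" "x \<in> Hom T (cell i) (cell m)" for j x
      using hom_zeroD[OF z that(2)] comp_zero[OF _ cell_obj] c that(1) by (simp add: is_coproduct_def)
  qed (use zero_add[OF zero_hom[OF cell_obj P]] in auto)
qed

text \<open>
  The index set is a basis of \<open>Hom(cell m, X)\<close>, and \<open>p\<close> restricts on each summand to the
  corresponding basis vector, so that it carries a basis to a basis.
\<close>

lemma cell_cover:
  assumes X: "X \<in> Obj T"
  obtains I :: "'m set" and P \<iota> p where "small \<kappa> I" "is_coproduct T I (\<lambda>_. cell m) P \<iota>" "p \<in> Hom T P X"
    "bij_betw (\<lambda>x. p \<cdot> x) (Hom T (cell m) P) (Hom T (cell m) X)"
proof -
  let ?G = "cell m" and ?R = "End_ring T (cell m)"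
  note G = cell_obj[of m]
  have MX: "right_module ?R (hom_obj T ?G X)" by (rule hom_obj_right_module[OF G X])
  have NX: "right_vector_space ?R (hom_obj T ?G X)"
    using MX cell_division by (simp add: right_vector_space_def right_vector_space_axioms_def)
  interpret X: right_vector_space ?R "hom_obj T ?G X" by (rule NX)
  have emp: "rindep ?R (hom_obj T ?G X) {}" by (simp add: rindep_def)
  obtain I where "{} \<subseteq> I" and I: "I \<subseteq> carrier (hom_obj T ?G X)" "rindep ?R (hom_obj T ?G X) I"
    "carrier (hom_obj T ?G X) \<subseteq> rspan ?R (hom_obj T ?G X) I"
    by (rule X.basis_extension[OF subset_refl empty_subsetI emp])
  have IH: "I \<subseteq> Hom T ?G X" using I(1) by (simp add: hom_obj_def)
  have "small \<kappa> (Hom T ?G X)" using loc_small G X by (simp add: locally_small_def)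
  from small_subset[OF this IH] have sI: "small \<kappa> I" .
  obtain P \<iota> where c: "is_coproduct T I (\<lambda>_. ?G) P \<iota>"
    using coproducts[unfolded has_small_coproducts_def, rule_format, of I "\<lambda>_. ?G"] sI G by blast
  have P: "P \<in> Obj T" and \<iota>: "\<And>i. i \<in> I \<Longrightarrow> \<iota> i \<in> Hom T ?G P" using c by (auto simp: is_coproduct_def)
  obtain p where p: "p \<in> Hom T P X" "\<And>i. i \<in> I \<Longrightarrow> p \<cdot> \<iota> i = i"
    using coproduct_hom_ex[OF c X, of "\<lambda>i. i"] IH by blast
  let ?f = "\<lambda>x\<in>Hom T ?G P. p \<cdot> x"
  have f\<iota>: "?f (\<iota> i) = i" if "i \<in> I" for i using \<iota> p that by simp
  have "?f ` \<iota> ` I = (\<lambda>i. i) ` I" unfolding image_image by (rule image_cong[OF refl f\<iota>])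
  then have im: "?f ` \<iota> ` I = I" by simp
  have "bij_betw ?f (carrier (hom_obj T ?G P)) (carrier (hom_obj T ?G X))"
  proof (rule basis_bij[OF hom_obj_right_module[OF G P] NX hom_obj_post_comp[OF G p(1)]
        coproduct_basis[OF cell_finitary sI c G]])
    show "inj_on ?f (\<iota> ` I)" using f\<iota> by (auto intro!: inj_onI)
    show "rindep ?R (hom_obj T ?G X) (?f ` \<iota> ` I)" unfolding im by (rule I)
    show "carrier (hom_obj T ?G X) \<subseteq> rspan ?R (hom_obj T ?G X) (?f ` \<iota> ` I)" unfolding im by (rule I)
  qed
  then have "bij_betw ?f (Hom T ?G P) (Hom T ?G X)" by (simp add: hom_obj_def)
  then have "bij_betw (\<lambda>x. p \<cdot> x) (Hom T ?G P) (Hom T ?G X)"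
    using bij_betw_cong[of "Hom T ?G P" ?f "\<lambda>x. p \<cdot> x"] by simp
  then show ?thesis using that sI c p(1) by blast
qed

text \<open>
  The cohomology of \<open>P\<close> vanishes in the degrees below \<open>m\<close>, as \<open>S\<close> has none in negative degrees, and
  in degree \<open>m + 1\<close>, as \<open>S\<close> has none in degree \<open>1\<close>.  In the long exact sequence the bijection in
  degree \<open>m\<close> then kills the cohomology of the cone in degree \<open>m\<close> and creates none in degree \<open>m - 1\<close>.
\<close>

lemma attach_cells:
  fixes I :: "'m set"
  assumes I: "small \<kappa> I" and c: "is_coproduct T I (\<lambda>_. cell m) P \<iota>"
    and p: "bij_betw (\<lambda>x. p \<cdot> x) (Hom T (cell m) P) (Hom T (cell m) X)"
    and t: "triangle T P X X' p t w"
  shows "\<And>i. i < m \<Longrightarrow> bij_betw (\<lambda>x. t \<cdot> x) (Hom T (cell i) X) (Hom T (cell i) X')"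
    and "hom_zero T (cell m) X'"
    and "\<And>W g. hom_zero T (cell m) W \<Longrightarrow> g \<in> Hom T X W \<Longrightarrow> \<exists>h\<in>Hom T X' W. h \<cdot> t = g"
proof -
  note o = triangle_objs[OF t]
  have h: "p \<in> Hom T P X" "t \<in> Hom T X X'" using t by (auto simp: triangle_def)
  have zP: "hom_zero T (cell i) P" if "i < m" for i
    using hom_zero_coproduct_cells[OF cell_cell_less[OF that] I c] .
  have zP': "hom_zero T (cell (m + 1)) P" using hom_zero_coproduct_cells[OF cell_cell_Suc I c] .
  have inj: "x = Zero T (cell (i + 1)) P"
    if "i \<le> m" "x \<in> Hom T (cell (i + 1)) P" "p \<cdot> x = Zero T (cell (i + 1)) X" for i x
  proof -
    have "i + 1 < m \<or> i + 1 = m \<or> i + 1 = m + 1" using that(1) by arith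
    then consider "i + 1 < m" | "i + 1 = m" | "i + 1 = m + 1" by blast
    then show ?thesis
    proof cases
      case 1
      then show ?thesis using hom_zeroD[OF zP that(2)] by blast
    next
      case 2
      then show ?thesis using comp_bij_kernel[OF p h(1)] that(2,3) by simp
    next
      case 3
      then show ?thesis using hom_zeroD[OF zP'] that(2) by simp
    qed
  qed
  have surj: "\<exists>x\<in>Hom T (cell i) X. t \<cdot> x = y" if i: "i \<le> m" and y': "y \<in> Hom T (cell i) X'" for i y
  proof -
    have y: "y \<in> Hom T (Susp T (cell (i + 1))) X'" using y' susp_cell by simp
    obtain x where "x \<in> Hom T (Susp T (cell (i + 1))) X" "t \<cdot> x = y"
      by (rule triangle_hom_surj[OF t cell_obj inj[OF i] y])
    then show ?thesis using susp_cell by auto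
  qed
  show "bij_betw (\<lambda>x. t \<cdot> x) (Hom T (cell i) X) (Hom T (cell i) X')" if i: "i < m" for i
  proof (rule comp_bij_betw[OF h(2)])
    fix x assume x: "x \<in> Hom T (cell i) X" "t \<cdot> x = Zero T (cell i) X'"
    obtain c where "c \<in> Hom T (cell i) P" "p \<cdot> c = x" by (rule triangle_lift[OF t x])
    then show "x = Zero T (cell i) X" using hom_zeroD[OF zP[OF i]] comp_zero[OF h(1) cell_obj] by blast
  qed (use surj i in auto)
  show "hom_zero T (cell m) X'"
  proof (rule hom_zeroI[OF cell_obj o(3)])
    fix y assume "y \<in> Hom T (cell m) X'"
    then obtain x where x: "x \<in> Hom T (cell m) X" "t \<cdot> x = y" using surj by blast
    obtain c where c: "c \<in> Hom T (cell m) P" "p \<cdot> c = x" by (rule comp_bij_surj[OF p x(1)])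
    have "t \<cdot> (p \<cdot> c) = Zero T (cell m) X'"
      using comp_assoc[OF c(1) h(1,2)] triangle_comp_zero[OF t] zero_comp[OF c(1) o(3)] by simp
    then show "y = Zero T (cell m) X'" using c x by simp
  qed
  show "\<exists>h\<in>Hom T X' W. h \<cdot> t = g" if W: "hom_zero T (cell m) W" and g: "g \<in> Hom T X W" for W g
  proof -
    have WO: "W \<in> Obj T" using g hom_objs by blast
    have "g \<cdot> p = Zero T P W"
    proof (rule coproduct_hom_eqI[OF c comp_hom[OF h(1) g] zero_hom[OF o(1) WO]])
      fix i assume i: "i \<in> I"
      have \<iota>: "\<iota> i \<in> Hom T (cell m) P" using c i by (simp add: is_coproduct_def)
      have "(g \<cdot> p) \<cdot> \<iota> i \<in> Hom T (cell m) W" using comp_hom[OF \<iota> comp_hom[OF h(1) g]] .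
      then show "(g \<cdot> p) \<cdot> \<iota> i = Zero T P W \<cdot> \<iota> i"
        using hom_zeroD[OF W] zero_comp[OF \<iota> WO] by simp
    qed
    then obtain k where "k \<in> Hom T X' W" "k \<cdot> t = g" by (rule triangle_extend[OF t g])
    then show ?thesis by blast
  qed
qed

text \<open>
  Since \<open>\<kappa>\<close> is uncountable, the natural numbers embed as a small index set into the type of arrows.
\<close>

lemma nat_coproduct:
  assumes X: "\<And>n :: nat. X n \<in> Obj T"
  obtains P \<iota> where "is_coproduct T UNIV X P \<iota>"
    and "\<forall>i Q. Q (Zero T (cell i) P) \<longrightarrow>
      (\<forall>y\<in>Hom T (cell i) P. \<forall>y'\<in>Hom T (cell i) P. Q y \<longrightarrow> Q y' \<longrightarrow> Q (y \<boxplus> y')) \<longrightarrow>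
      (\<forall>n. \<forall>x\<in>Hom T (cell i) (X n). Q (\<iota> n \<cdot> x)) \<longrightarrow> (\<forall>y\<in>Hom T (cell i) P. Q y)"
proof -
  obtain e :: "nat \<Rightarrow> 'm" where e: "inj e" "\<And>N. small \<kappa> (e ` N)"
    using universe_cardinal_nat[OF universe] by blast
  let ?X = "X \<circ> inv_into UNIV e"
  have X': "?X i \<in> Obj T" for i using X by simp
  then obtain P \<iota> where c: "is_coproduct T (e ` UNIV) ?X P \<iota>"
    using coproducts[unfolded has_small_coproducts_def, rule_format, of "e ` UNIV" ?X] e(2)[of UNIV] by blast
  show ?thesis
  proof (rule that)
    show "is_coproduct T UNIV X P (\<iota> \<circ> e)" by (rule is_coproduct_reindex[OF e(1) c])
    show "\<forall>i Q. Q (Zero T (cell i) P) \<longrightarrow>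
      (\<forall>y\<in>Hom T (cell i) P. \<forall>y'\<in>Hom T (cell i) P. Q y \<longrightarrow> Q y' \<longrightarrow> Q (y \<boxplus> y')) \<longrightarrow>
      (\<forall>n. \<forall>x\<in>Hom T (cell i) (X n). Q ((\<iota> \<circ> e) n \<cdot> x)) \<longrightarrow> (\<forall>y\<in>Hom T (cell i) P. Q y)"
    proof (intro allI impI ballI)
      fix i Q y
      assume y: "y \<in> Hom T (cell i) P" and Q: "Q (Zero T (cell i) P)"
        "\<forall>y\<in>Hom T (cell i) P. \<forall>y'\<in>Hom T (cell i) P. Q y \<longrightarrow> Q y' \<longrightarrow> Q (y \<boxplus> y')"
        "\<forall>n. \<forall>x\<in>Hom T (cell i) (X n). Q ((\<iota> \<circ> e) n \<cdot> x)"
      show "Q y"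
      proof (rule finitaryD[where Q = Q, OF cell_finitary e(2) X' c y Q(1)])
        show "Q (\<iota> j \<cdot> x)" if "j \<in> range e" "x \<in> Hom T (cell i) (?X j)" for j x
          using that Q(3) inv_f_f[OF e(1)] by auto
      qed (use Q(2) in blast)
    qed
  qed
qed

end

section \<open>Homotopy colimits and truncation\<close>

context corigid_generator
begin

text \<open>
  \<open>L\<close> is the homotopy colimit of the sequence, the cone of the identity minus the shift on the
  coproduct of the \<open>X n\<close>.  By compactness its cohomology is the colimit of the cohomologies of the
  \<open>X n\<close>: arrows from a cell to the coproduct have finite support, so that identity minus shift
  is injective on them, and modulo its image each of them can be pushed into a single \<open>X n\<close>.
\<close>

lemma telescope:
  assumes X: "\<And>n :: nat. X n \<in> Obj T" and t: "\<And>n. t n \<in> Hom T (X n) (X (Suc n))"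
  obtains L l where "\<forall>n. l n \<in> Hom T (X n) L \<and> l (Suc n) \<cdot> t n = l n"
    and "\<forall>W m. (\<forall>n. m n \<in> Hom T (X n) W \<and> m (Suc n) \<cdot> t n = m n) \<longrightarrow>
      (\<exists>h\<in>Hom T L W. \<forall>n. h \<cdot> l n = m n)"
    and "\<forall>i. \<forall>z\<in>Hom T (cell i) L. \<exists>n. \<exists>x\<in>Hom T (cell i) (X n). l n \<cdot> x = z"
    and "\<forall>i. (\<forall>n. \<forall>y\<in>Hom T (cell i) (X n). t n \<cdot> y = Zero T (cell i) (X (Suc n)) \<longrightarrow>
        y = Zero T (cell i) (X n)) \<longrightarrow>
      (\<forall>x\<in>Hom T (cell i) (X 0). l 0 \<cdot> x = Zero T (cell i) L \<longrightarrow> x = Zero T (cell i) (X 0))"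
proof -
  obtain P \<iota> where c: "is_coproduct T UNIV X P \<iota>"
    and induct': "\<forall>i Q. Q (Zero T (cell i) P) \<longrightarrow>
      (\<forall>y\<in>Hom T (cell i) P. \<forall>y'\<in>Hom T (cell i) P. Q y \<longrightarrow> Q y' \<longrightarrow> Q (y \<boxplus> y')) \<longrightarrow>
      (\<forall>n. \<forall>x\<in>Hom T (cell i) (X n). Q (\<iota> n \<cdot> x)) \<longrightarrow> (\<forall>y\<in>Hom T (cell i) P. Q y)"
    by (rule nat_coproduct[where X = X, OF X])
  have induct: "Q y" if "y \<in> Hom T (cell i) P" "Q (Zero T (cell i) P)"
      "\<And>y y'. y \<in> Hom T (cell i) P \<Longrightarrow> y' \<in> Hom T (cell i) P \<Longrightarrow> Q y \<Longrightarrow> Q y' \<Longrightarrow> Q (y \<boxplus> y')"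
      "\<And>n x. x \<in> Hom T (cell i) (X n) \<Longrightarrow> Q (\<iota> n \<cdot> x)" for i Q y
    by (rule induct'[rule_format, of Q i]) (use that in auto)
  have P: "P \<in> Obj T" and \<iota>: "\<And>n. \<iota> n \<in> Hom T (X n) P" using c by (auto simp: is_coproduct_def)
  have "\<exists>p\<in>Hom T P (X k). p \<cdot> \<iota> k = Idt T (X k) \<and> (\<forall>n. n \<noteq> k \<longrightarrow> p \<cdot> \<iota> n = Zero T (X n) (X k))" for k
  proof -
    have sub: "X ` UNIV \<subseteq> Obj T" using X by auto
    show ?thesis by (rule coproduct_proj[OF c UNIV_I sub]) blast
  qed
  then obtain \<pi> where \<pi>: "\<And>k. \<pi> k \<in> Hom T P (X k)" "\<And>k. \<pi> k \<cdot> \<iota> k = Idt T (X k)"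
    "\<And>k n. n \<noteq> k \<Longrightarrow> \<pi> k \<cdot> \<iota> n = Zero T (X n) (X k)"
    by metis
  note \<iota>t = comp_hom[OF t \<iota>]
  have "\<exists>\<sigma>\<in>Hom T P P. \<forall>n. \<sigma> \<cdot> \<iota> n = \<iota> n \<boxplus> Neg T (\<iota> (Suc n) \<cdot> t n)"
    by (rule coproduct_hom_ex[OF c P, of "\<lambda>n. \<iota> n \<boxplus> Neg T (\<iota> (Suc n) \<cdot> t n)"])
      (use add_hom[OF \<iota> neg_hom[OF \<iota>t]] in blast)+
  then obtain \<sigma> where \<sigma>: "\<sigma> \<in> Hom T P P" "\<And>n. \<sigma> \<cdot> \<iota> n = \<iota> n \<boxplus> Neg T (\<iota> (Suc n) \<cdot> t n)" by blast
  \<comment> \<open>\<open>\<sigma>\<close> is the identity minus the shift; arrows out of its cone are compatible families\<close>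
  obtain L q w where tri: "triangle T P P L \<sigma> q w" by (rule triangle_cone[OF \<sigma>(1)])
  have q: "q \<in> Hom T P L" and L: "L \<in> Obj T" using tri triangle_objs(3)[OF tri] by (auto simp: triangle_def)
  have g\<sigma>: "(g \<cdot> \<sigma>) \<cdot> \<iota> n = g \<cdot> \<iota> n \<boxplus> Neg T (g \<cdot> \<iota> (Suc n) \<cdot> t n)" if g: "g \<in> Hom T P W" for g W n
  proof -
    have "(g \<cdot> \<sigma>) \<cdot> \<iota> n = g \<cdot> (\<iota> n \<boxplus> Neg T (\<iota> (Suc n) \<cdot> t n))"
      using comp_assoc[OF \<iota> \<sigma>(1) g] \<sigma>(2) by simp
    also have "\<dots> = g \<cdot> \<iota> n \<boxplus> Neg T (g \<cdot> \<iota> (Suc n) \<cdot> t n)"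
      using comp_add_left[OF \<iota> neg_hom[OF \<iota>t] g] comp_neg[OF \<iota>t g] comp_assoc[OF t \<iota> g] by simp
    finally show ?thesis .
  qed
  define l where "l n = q \<cdot> \<iota> n" for n
  have l: "l n \<in> Hom T (X n) L" for n unfolding l_def using comp_hom[OF \<iota> q] .
  have lt: "l (Suc n) \<cdot> t n = l n" for n
  proof -
    have "l n \<boxplus> Neg T (l (Suc n) \<cdot> t n) = Zero T (X n) L"
      using g\<sigma>[OF q] triangle_comp_zero[OF tri] zero_comp[OF \<iota> L] by (simp add: l_def)
    then show ?thesis using diff_zero_eq[OF l comp_hom[OF t l]] by metis
  qed
  have ext: "\<exists>h\<in>Hom T L W. \<forall>n. h \<cdot> l n = m n"
    if m: "\<And>n. m n \<in> Hom T (X n) W" and mt: "\<And>n. m (Suc n) \<cdot> t n = m n" for W m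
  proof -
    have W: "W \<in> Obj T" using m hom_objs by blast
    obtain g where g: "g \<in> Hom T P W" "\<And>n. g \<cdot> \<iota> n = m n"
      by (rule coproduct_hom_ex[OF c W, of m]) (use m in blast)+
    have "g \<cdot> \<sigma> = Zero T P W"
    proof (rule coproduct_hom_eqI[OF c comp_hom[OF \<sigma>(1) g(1)] zero_hom[OF P W]])
      show "(g \<cdot> \<sigma>) \<cdot> \<iota> n = Zero T P W \<cdot> \<iota> n" for n
        using g\<sigma>[OF g(1)] g(2) mt add_neg[OF m] zero_comp[OF \<iota> W] by simp
    qed
    then obtain h where h: "h \<in> Hom T L W" "h \<cdot> q = g" by (rule triangle_extend[OF tri g(1)])
    have "h \<cdot> l n = m n" for n using comp_assoc[OF \<iota> q h(1)] h(2) g(2) by (simp add: l_def)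
    then show ?thesis using h(1) by blast
  qed
  \<comment> \<open>\<open>y\<close> is supported on the first \<open>m\<close> summands, as tested by arrows that vanish on these\<close>
  define supp where "supp i m y \<longleftrightarrow> (\<forall>W. \<forall>g\<in>Hom T P W.
      (\<forall>n<m. g \<cdot> \<iota> n = Zero T (X n) W) \<longrightarrow> g \<cdot> y = Zero T (cell i) W)" for i m y
  have support: "\<exists>m. supp i m y"
    if y: "y \<in> Hom T (cell i) P" for i y
  proof (rule induct[OF y])
    show "\<exists>m. supp i m (Zero T (cell i) P)" using comp_zero[OF _ cell_obj] by (auto simp: supp_def)
    fix y y' assume y: "y \<in> Hom T (cell i) P" "y' \<in> Hom T (cell i) P"
      and "\<exists>m. supp i m y" and "\<exists>m. supp i m y'"
    then obtain m m' where m: "supp i m y" "supp i m' y'" by blast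
    have "supp i (max m m') (y \<boxplus> y')"
      unfolding supp_def
    proof (intro allI ballI impI)
      fix W g assume g: "g \<in> Hom T P W" and "\<forall>n<max m m'. g \<cdot> \<iota> n = Zero T (X n) W"
      then have "g \<cdot> y = Zero T (cell i) W" "g \<cdot> y' = Zero T (cell i) W"
        using m by (simp_all add: supp_def)
      moreover have "W \<in> Obj T" using g hom_objs by blast
      ultimately show "g \<cdot> (y \<boxplus> y') = Zero T (cell i) W"
        using comp_add_left[OF y g] zero_add[OF zero_hom[OF cell_obj]] by simp
    qed
    then show "\<exists>m. supp i m (y \<boxplus> y')" by blast
  next
    fix n x assume x: "x \<in> Hom T (cell i) (X n)"
    have "g \<cdot> (\<iota> n \<cdot> x) = Zero T (cell i) W"
      if g: "g \<in> Hom T P W" and "\<forall>n'<Suc n. g \<cdot> \<iota> n' = Zero T (X n') W" for W g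
      using that(2) comp_assoc[OF x \<iota> g] zero_comp[OF x hom_cod_obj[OF g]] by simp
    then show "\<exists>m. supp i m (\<iota> n \<cdot> x)" unfolding supp_def by blast
  qed
  have zero_if_proj: "y = Zero T (cell i) P"
    if y: "y \<in> Hom T (cell i) P" and py: "\<And>k. \<pi> k \<cdot> y = Zero T (cell i) (X k)" for i y
  proof -
    obtain m where m: "supp i m y"
      using support[OF y] by blast
    \<comment> \<open>the bound \<open>m\<close> can be lowered to \<open>0\<close>, by subtracting the contribution of the last summand\<close>
    have "supp i (m - k) y" for k
    proof (induction k)
      case 0
      then show ?case using m by simp
    next
      case (Suc k)
      show ?case
        unfolding supp_def
      proof (intro allI ballI impI)
        fix W g assume g: "g \<in> Hom T P W" and gz: "\<forall>n<m - Suc k. g \<cdot> \<iota> n = Zero T (X n) W"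
        have W: "W \<in> Obj T" using g hom_objs by blast
        let ?j = "m - Suc k"
        let ?e = "(g \<cdot> \<iota> ?j) \<cdot> \<pi> ?j"
        have gj: "g \<cdot> \<iota> ?j \<in> Hom T (X ?j) W" using comp_hom[OF \<iota> g] .
        have e: "?e \<in> Hom T P W" using comp_hom[OF \<pi>(1) gj] .
        have d: "g \<boxplus> Neg T ?e \<in> Hom T P W" using add_hom[OF g neg_hom[OF e]] .
        have e\<iota>: "?e \<cdot> \<iota> n = (if n = ?j then g \<cdot> \<iota> n else Zero T (X n) W)" for n
          using comp_assoc[OF \<iota> \<pi>(1) gj, of n] \<pi>(2,3) comp_idt_right[OF gj] comp_zero[OF gj X] by simp
        have "(g \<boxplus> Neg T ?e) \<cdot> \<iota> n = Zero T (X n) W" if "n < m - k" for n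
        proof -
          have "(g \<boxplus> Neg T ?e) \<cdot> \<iota> n = g \<cdot> \<iota> n \<boxplus> Neg T (?e \<cdot> \<iota> n)"
            using comp_add_right[OF \<iota> g neg_hom[OF e]] neg_comp[OF \<iota> e] by simp
          also have "\<dots> = Zero T (X n) W"
          proof (cases "n = ?j")
            case True
            then show ?thesis using e\<iota> add_neg[OF gj] by simp
          next
            case False
            then have "n < m - Suc k" using that by linarith
            then show ?thesis
              using e\<iota>[of n] gz False neg_zero[OF X W] zero_add[OF zero_hom[OF X W]] by simp
          qed
          finally show ?thesis .
        qed
        then have 1: "(g \<boxplus> Neg T ?e) \<cdot> y = Zero T (cell i) W" using Suc d by (simp add: supp_def)
        have 2: "?e \<cdot> y = Zero T (cell i) W"
          using comp_assoc[OF y \<pi>(1) gj] py comp_zero[OF gj cell_obj] by simp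
        have "g \<cdot> y \<boxplus> Neg T (?e \<cdot> y) = Zero T (cell i) W"
          using 1 comp_add_right[OF y g neg_hom[OF e]] neg_comp[OF y e] by simp
        then show "g \<cdot> y = Zero T (cell i) W"
          using 2 diff_zero_eq[OF comp_hom[OF y g] comp_hom[OF y e]] by simp
      qed
    qed
    from this[of m] have "Idt T P \<cdot> y = Zero T (cell i) P" using idt_hom[OF P] by (simp add: supp_def)
    then show ?thesis using comp_idt_left[OF y] by simp
  qed
  have proj0: "\<pi> 0 \<cdot> \<sigma> = \<pi> 0"
  proof (rule coproduct_hom_eqI[OF c comp_hom[OF \<sigma>(1) \<pi>(1)] \<pi>(1)])
    show "(\<pi> 0 \<cdot> \<sigma>) \<cdot> \<iota> n = \<pi> 0 \<cdot> \<iota> n" for n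
      using g\<sigma>[OF \<pi>(1)] \<pi>(3)[of "Suc n" 0] zero_comp[OF t X] neg_zero[OF X X] add_zero[OF comp_hom[OF \<iota> \<pi>(1)]]
      by simp
  qed
  have projSuc: "\<pi> (Suc k) \<cdot> \<sigma> = \<pi> (Suc k) \<boxplus> Neg T (t k \<cdot> \<pi> k)" for k
  proof (rule coproduct_hom_eqI[OF c comp_hom[OF \<sigma>(1) \<pi>(1)] add_hom[OF \<pi>(1) neg_hom[OF comp_hom[OF \<pi>(1) t]]]])
    fix n
    have "\<pi> (Suc k) \<cdot> \<iota> (Suc n) \<cdot> t n = (t k \<cdot> \<pi> k) \<cdot> \<iota> n"
    proof (cases "n = k")
      case True
      then show ?thesis
        using \<pi>(2) comp_assoc[OF \<iota> \<pi>(1) t] comp_idt_left[OF t] comp_idt_right[OF t] by simp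
    next
      case False
      then show ?thesis
        using \<pi>(3)[of "Suc n" "Suc k"] \<pi>(3)[of n k] comp_assoc[OF \<iota> \<pi>(1) t] zero_comp[OF t X] comp_zero[OF t X]
        by simp
    qed
    then show "(\<pi> (Suc k) \<cdot> \<sigma>) \<cdot> \<iota> n = (\<pi> (Suc k) \<boxplus> Neg T (t k \<cdot> \<pi> k)) \<cdot> \<iota> n"
      using g\<sigma>[OF \<pi>(1)] comp_add_right[OF \<iota> \<pi>(1) neg_hom[OF comp_hom[OF \<pi>(1) t]]]
        neg_comp[OF \<iota> comp_hom[OF \<pi>(1) t]] by simp
  qed
  have proj_\<sigma>: "\<pi> 0 \<cdot> (\<sigma> \<cdot> y) = \<pi> 0 \<cdot> y"
    "\<pi> (Suc k) \<cdot> (\<sigma> \<cdot> y) = \<pi> (Suc k) \<cdot> y \<boxplus> Neg T (t k \<cdot> (\<pi> k \<cdot> y))"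
    if y: "y \<in> Hom T (cell i) P" for i y k
  proof -
    show "\<pi> 0 \<cdot> (\<sigma> \<cdot> y) = \<pi> 0 \<cdot> y" using comp_assoc[OF y \<sigma>(1) \<pi>(1)] proj0 by metis
    have "\<pi> (Suc k) \<cdot> (\<sigma> \<cdot> y) = (\<pi> (Suc k) \<boxplus> Neg T (t k \<cdot> \<pi> k)) \<cdot> y"
      using comp_assoc[OF y \<sigma>(1) \<pi>(1)] projSuc by metis
    then show "\<pi> (Suc k) \<cdot> (\<sigma> \<cdot> y) = \<pi> (Suc k) \<cdot> y \<boxplus> Neg T (t k \<cdot> (\<pi> k \<cdot> y))"
      using comp_add_right[OF y \<pi>(1) neg_hom[OF comp_hom[OF \<pi>(1) t]]]
        neg_comp[OF y comp_hom[OF \<pi>(1) t]] comp_assoc[OF y \<pi>(1) t] by simp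
  qed
  have \<sigma>_inj: "y = Zero T (cell i) P"
    if y: "y \<in> Hom T (cell i) P" and z: "\<sigma> \<cdot> y = Zero T (cell i) P" for i y
  proof (rule zero_if_proj[OF y])
    show "\<pi> k \<cdot> y = Zero T (cell i) (X k)" for k
    proof (induction k)
      case 0
      then show ?case using proj_\<sigma>(1)[OF y] z comp_zero[OF \<pi>(1) cell_obj] by simp
    next
      case (Suc k)
      have "\<pi> (Suc k) \<cdot> y \<boxplus> Neg T (t k \<cdot> (\<pi> k \<cdot> y)) = Zero T (cell i) (X (Suc k))"
        using proj_\<sigma>(2)[OF y] z comp_zero[OF \<pi>(1) cell_obj] by simp
      moreover have "t k \<cdot> (\<pi> k \<cdot> y) = Zero T (cell i) (X (Suc k))"
        using Suc comp_zero[OF t cell_obj] by simp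
      ultimately show ?case
        using diff_zero_eq[OF comp_hom[OF y \<pi>(1)] zero_hom[OF cell_obj X]] by simp
    qed
  qed
  have push: "\<exists>x'\<in>Hom T (cell i) (X (n + k)). l (n + k) \<cdot> x' = l n \<cdot> x"
    if x: "x \<in> Hom T (cell i) (X n)" for i n k x
  proof (induction k)
    case 0
    then show ?case using x by auto
  next
    case (Suc k)
    then obtain x' where x': "x' \<in> Hom T (cell i) (X (n + k))" "l (n + k) \<cdot> x' = l n \<cdot> x" by blast
    have "l (Suc (n + k)) \<cdot> (t (n + k) \<cdot> x') = l n \<cdot> x"
      using comp_assoc[OF x'(1) t l] lt x'(2) by simp
    moreover have "t (n + k) \<cdot> x' \<in> Hom T (cell i) (X (Suc (n + k)))" using comp_hom[OF x'(1) t] .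
    ultimately show ?case by auto
  qed
  have S1: "\<exists>n. \<exists>x\<in>Hom T (cell i) (X n). l n \<cdot> x = z" if z: "z \<in> Hom T (cell i) L" for i z
  proof -
    have z': "z \<in> Hom T (Susp T (cell (i + 1))) L" using z susp_cell by simp
    obtain y where "y \<in> Hom T (Susp T (cell (i + 1))) P" and qy: "q \<cdot> y = z"
      by (rule triangle_hom_surj[OF tri cell_obj \<sigma>_inj z'])
    then have y: "y \<in> Hom T (cell i) P" using susp_cell by simp
    have "\<exists>n. \<exists>x\<in>Hom T (cell i) (X n). l n \<cdot> x = q \<cdot> y"
    proof (rule induct[OF y])
      show "\<exists>n. \<exists>x\<in>Hom T (cell i) (X n). l n \<cdot> x = q \<cdot> Zero T (cell i) P"
        using zero_hom[OF cell_obj X] comp_zero[OF l cell_obj] comp_zero[OF q cell_obj] by metis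
      show "\<exists>n'. \<exists>x'\<in>Hom T (cell i) (X n'). l n' \<cdot> x' = q \<cdot> (\<iota> n \<cdot> x)" if x: "x \<in> Hom T (cell i) (X n)" for n x
        using x comp_assoc[OF x \<iota> q] by (auto simp: l_def)
      fix y y' assume y: "y \<in> Hom T (cell i) P" "y' \<in> Hom T (cell i) P"
        and "\<exists>n. \<exists>x\<in>Hom T (cell i) (X n). l n \<cdot> x = q \<cdot> y"
        and "\<exists>n. \<exists>x\<in>Hom T (cell i) (X n). l n \<cdot> x = q \<cdot> y'"
      then obtain n x n' x' where x: "x \<in> Hom T (cell i) (X n)" "l n \<cdot> x = q \<cdot> y"
        "x' \<in> Hom T (cell i) (X n')" "l n' \<cdot> x' = q \<cdot> y'" by metis
      obtain a where a: "a \<in> Hom T (cell i) (X (n + n'))" "l (n + n') \<cdot> a = q \<cdot> y"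
        using push[OF x(1), of n'] x(2) by auto
      obtain b where b: "b \<in> Hom T (cell i) (X (n + n'))" "l (n + n') \<cdot> b = q \<cdot> y'"
        using push[OF x(3), of n] x(4) by (auto simp: add.commute)
      have "l (n + n') \<cdot> (a \<boxplus> b) = q \<cdot> (y \<boxplus> y')"
        using comp_add_left[OF a(1) b(1) l] a(2) b(2) comp_add_left[OF y q] by simp
      then show "\<exists>n. \<exists>x\<in>Hom T (cell i) (X n). l n \<cdot> x = q \<cdot> (y \<boxplus> y')"
        using add_hom[OF a(1) b(1)] by blast
    qed
    then show ?thesis using qy by simp
  qed
  have S2: "x = Zero T (cell i) (X 0)"
    if inj: "\<And>n y. y \<in> Hom T (cell i) (X n) \<Longrightarrow> t n \<cdot> y = Zero T (cell i) (X (Suc n)) \<Longrightarrow>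
        y = Zero T (cell i) (X n)"
      and x: "x \<in> Hom T (cell i) (X 0)" and lx: "l 0 \<cdot> x = Zero T (cell i) L" for i x
  proof -
    have \<iota>x: "\<iota> 0 \<cdot> x \<in> Hom T (cell i) P" using comp_hom[OF x \<iota>] .
    have "q \<cdot> (\<iota> 0 \<cdot> x) = Zero T (cell i) L" using lx comp_assoc[OF x \<iota> q] by (simp add: l_def)
    then obtain y where y: "y \<in> Hom T (cell i) P" "\<sigma> \<cdot> y = \<iota> 0 \<cdot> x"
      by (rule triangle_lift[OF tri \<iota>x])
    have y0: "\<pi> 0 \<cdot> y = x"
      using proj_\<sigma>(1)[OF y(1)] y(2) comp_assoc[OF x \<iota> \<pi>(1)] \<pi>(2) comp_idt_left[OF x] by metis
    have ySuc: "\<pi> (Suc k) \<cdot> y = t k \<cdot> (\<pi> k \<cdot> y)" for k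
    proof -
      have "\<pi> (Suc k) \<cdot> (\<iota> 0 \<cdot> x) = Zero T (cell i) (X (Suc k))"
        using comp_assoc[OF x \<iota> \<pi>(1), of "Suc k"] \<pi>(3)[of 0 "Suc k"] zero_comp[OF x X] by simp
      then have "\<pi> (Suc k) \<cdot> y \<boxplus> Neg T (t k \<cdot> (\<pi> k \<cdot> y)) = Zero T (cell i) (X (Suc k))"
        using proj_\<sigma>(2)[OF y(1), of k] y(2) by simp
      then show ?thesis using diff_zero_eq[OF comp_hom[OF y(1) \<pi>(1)] comp_hom[OF comp_hom[OF y(1) \<pi>(1)] t]] by blast
    qed
    obtain m where m: "supp i m y"
      using support[OF y(1)] by blast
    have "\<pi> m \<cdot> y = Zero T (cell i) (X m)" using m \<pi>(1,3) by (simp add: supp_def)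
    then have "\<pi> (m - k) \<cdot> y = Zero T (cell i) (X (m - k))" for k
    proof (induction k)
      case (Suc k)
      show ?case
      proof (cases "k < m")
        case True
        then have "m - k = Suc (m - Suc k)" by simp
        then show ?thesis using Suc ySuc inj[OF comp_hom[OF y(1) \<pi>(1)]] by metis
      next
        case False
        then show ?thesis using Suc by simp
      qed
    qed simp
    from this[of m] show ?thesis using y0 by simp
  qed
  show ?thesis
  proof (rule that)
    show "\<forall>n. l n \<in> Hom T (X n) L \<and> l (Suc n) \<cdot> t n = l n" using l lt by blast
    show "\<forall>W m. (\<forall>n. m n \<in> Hom T (X n) W \<and> m (Suc n) \<cdot> t n = m n) \<longrightarrow>
      (\<exists>h\<in>Hom T L W. \<forall>n. h \<cdot> l n = m n)"
      using ext by blast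
    show "\<forall>i. \<forall>z\<in>Hom T (cell i) L. \<exists>n. \<exists>x\<in>Hom T (cell i) (X n). l n \<cdot> x = z" using S1 by blast
    show "\<forall>i. (\<forall>n. \<forall>y\<in>Hom T (cell i) (X n). t n \<cdot> y = Zero T (cell i) (X (Suc n)) \<longrightarrow>
        y = Zero T (cell i) (X n)) \<longrightarrow>
      (\<forall>x\<in>Hom T (cell i) (X 0). l 0 \<cdot> x = Zero T (cell i) L \<longrightarrow> x = Zero T (cell i) (X 0))"
      using S2 by blast
  qed
qed

text \<open>
  Starting from \<open>X\<close>, the vector spaces in degrees \<open>N, N + 1, \<dots>\<close> are killed one after the other by
  attaching cells.  No cell attached in degree \<open>m\<close> disturbs a degree below \<open>m\<close>, and maps to an
  object that vanishes in degrees \<open>\<ge> N\<close> extend over each of the cells.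
\<close>

lemma truncation:
  assumes X: "X \<in> Obj T"
  obtains L l where "l \<in> Hom T X L" "\<forall>i\<ge>N. hom_zero T (cell i) L"
    and "\<forall>i<N. bij_betw (\<lambda>x. l \<cdot> x) (Hom T (cell i) X) (Hom T (cell i) L)"
    and "\<forall>W g. (\<forall>i\<ge>N. hom_zero T (cell i) W) \<longrightarrow> g \<in> Hom T X W \<longrightarrow> (\<exists>h\<in>Hom T L W. h \<cdot> l = g)"
proof -
  define step where "step m Y Y' t \<longleftrightarrow> t \<in> Hom T Y Y' \<and>
      (\<forall>i<m. bij_betw (\<lambda>x. t \<cdot> x) (Hom T (cell i) Y) (Hom T (cell i) Y')) \<and> hom_zero T (cell m) Y' \<and>
      (\<forall>W g. hom_zero T (cell m) W \<longrightarrow> g \<in> Hom T Y W \<longrightarrow> (\<exists>h\<in>Hom T Y' W. h \<cdot> t = g))" for m Y Y' t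
  have step_ex: "\<exists>Y' t. step m Y Y' t" if Y: "Y \<in> Obj T" for m Y
  proof -
    obtain I :: "'m set" and P \<iota> p where I: "small \<kappa> I" and c: "is_coproduct T I (\<lambda>_. cell m) P \<iota>"
      and p: "p \<in> Hom T P Y" and b: "bij_betw (\<lambda>x. p \<cdot> x) (Hom T (cell m) P) (Hom T (cell m) Y)"
      by (rule cell_cover[OF Y])
    obtain Y' t w where t: "triangle T P Y Y' p t w" by (rule triangle_cone[OF p])
    have "step m Y Y' t"
      using attach_cells[OF I c b t] t by (simp add: step_def triangle_def)
    then show ?thesis by blast
  qed
  have "\<exists>Z. \<forall>n. (Z n \<in> Obj T \<and> (n = 0 \<longrightarrow> Z n = X)) \<and> (\<exists>t. step (N + int n) (Z n) (Z (Suc n)) t)"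
  proof (rule dependent_nat_choice)
    show "\<exists>Y. Y \<in> Obj T \<and> (0 = (0 :: nat) \<longrightarrow> Y = X)" using X by blast
    fix Y and n :: nat assume "Y \<in> Obj T \<and> (n = 0 \<longrightarrow> Y = X)"
    then obtain Y' t where t: "step (N + int n) Y Y' t" using step_ex by blast
    then have "Y' \<in> Obj T" using hom_objs unfolding step_def by blast
    then show "\<exists>Y'. (Y' \<in> Obj T \<and> (Suc n = 0 \<longrightarrow> Y' = X)) \<and> (\<exists>t. step (N + int n) Y Y' t)"
      using t by blast
  qed
  then obtain Z where Z: "\<And>n. Z n \<in> Obj T" and Z0: "Z 0 = X"
    and ex: "\<forall>n. \<exists>t. step (N + int n) (Z n) (Z (Suc n)) t" by metis
  obtain t where t: "\<And>n. step (N + int n) (Z n) (Z (Suc n)) (t n)" using choice[OF ex] by blast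
  have th: "t n \<in> Hom T (Z n) (Z (Suc n))" for n using t[of n] by (simp add: step_def)
  have tb: "bij_betw (\<lambda>x. t n \<cdot> x) (Hom T (cell i) (Z n)) (Hom T (cell i) (Z (Suc n)))"
    if "i < N + int n" for i n
    using t[of n] that by (simp add: step_def)
  have tz: "hom_zero T (cell (N + int n)) (Z (Suc n))" for n using t[of n] by (simp add: step_def)
  have te: "\<exists>h\<in>Hom T (Z (Suc n)) W. h \<cdot> t n = g"
    if "hom_zero T (cell (N + int n)) W" "g \<in> Hom T (Z n) W" for n W g
    using t[of n] that by (simp add: step_def)
  obtain L l where l': "\<forall>n. l n \<in> Hom T (Z n) L \<and> l (Suc n) \<cdot> t n = l n"
    and ext: "\<forall>W m. (\<forall>n. m n \<in> Hom T (Z n) W \<and> m (Suc n) \<cdot> t n = m n) \<longrightarrow>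
      (\<exists>h\<in>Hom T L W. \<forall>n. h \<cdot> l n = m n)"
    and S1: "\<forall>i. \<forall>z\<in>Hom T (cell i) L. \<exists>n. \<exists>x\<in>Hom T (cell i) (Z n). l n \<cdot> x = z"
    and S2: "\<forall>i. (\<forall>n. \<forall>y\<in>Hom T (cell i) (Z n). t n \<cdot> y = Zero T (cell i) (Z (Suc n)) \<longrightarrow>
        y = Zero T (cell i) (Z n)) \<longrightarrow>
      (\<forall>x\<in>Hom T (cell i) (Z 0). l 0 \<cdot> x = Zero T (cell i) L \<longrightarrow> x = Zero T (cell i) (Z 0))"
    by (rule telescope[where X = Z and t = t, OF Z th])
  have l: "l n \<in> Hom T (Z n) L" "l (Suc n) \<cdot> t n = l n" for n using l' by blast+
  have L: "L \<in> Obj T" using l hom_objs by blast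
  have push: "\<exists>x'\<in>Hom T (cell i) (Z (n + k)). l (n + k) \<cdot> x' = l n \<cdot> x"
    if x: "x \<in> Hom T (cell i) (Z n)" for i n k x
  proof (induction k)
    case 0
    then show ?case using x by auto
  next
    case (Suc k)
    then obtain x' where x': "x' \<in> Hom T (cell i) (Z (n + k))" "l (n + k) \<cdot> x' = l n \<cdot> x" by blast
    have "l (Suc (n + k)) \<cdot> (t (n + k) \<cdot> x') = l n \<cdot> x"
      using comp_assoc[OF x'(1) th l(1)] l(2) x'(2) by simp
    moreover have "t (n + k) \<cdot> x' \<in> Hom T (cell i) (Z (Suc (n + k)))" using comp_hom[OF x'(1) th] .
    ultimately show ?case by auto
  qed
  have Zz: "hom_zero T (cell (N + int j)) (Z (Suc j + k))" for j k
  proof (induction k)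
    case 0
    then show ?case using tz by simp
  next
    case (Suc k)
    then show ?case using hom_zero_bij[OF tb th cell_obj, of "N + int j" "Suc j + k"] by simp
  qed
  have pull: "\<exists>x'\<in>Hom T (cell i) (Z 0). l 0 \<cdot> x' = l n \<cdot> x"
    if i: "i < N" and x: "x \<in> Hom T (cell i) (Z n)" for i n x
    using x
  proof (induction n arbitrary: x)
    case (Suc n)
    have "i < N + int n" using i by simp
    then obtain x' where x': "x' \<in> Hom T (cell i) (Z n)" "t n \<cdot> x' = x"
      using comp_bij_surj[OF tb Suc.prems] by blast
    then have "l n \<cdot> x' = l (Suc n) \<cdot> x" using comp_assoc[OF x'(1) th l(1)] l(2) by metis
    then show ?case using Suc.IH[OF x'(1)] by simp
  qed blast
  show ?thesis
  proof (rule that[of "l 0" L])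
    show "l 0 \<in> Hom T X L" using l(1)[of 0] Z0 by simp
    show "\<forall>i\<ge>N. hom_zero T (cell i) L"
    proof (intro allI impI hom_zeroI[OF cell_obj L])
      fix i z assume i: "i \<ge> N" and z: "z \<in> Hom T (cell i) L"
      obtain j where j: "i = N + int j" using i zle_iff_zadd by blast
      obtain n x where x: "x \<in> Hom T (cell i) (Z n)" "l n \<cdot> x = z" using S1 z by blast
      obtain x' where x': "x' \<in> Hom T (cell i) (Z (n + Suc j))" "l (n + Suc j) \<cdot> x' = z"
        using push[OF x(1), of "Suc j"] x(2) by blast
      have "hom_zero T (cell i) (Z (n + Suc j))" using Zz[of j n] j by (simp add: add.commute)
      then show "z = Zero T (cell i) L"
        using hom_zeroD x' comp_zero[OF l(1) cell_obj] by metis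
    qed
    show "\<forall>i<N. bij_betw (\<lambda>x. l 0 \<cdot> x) (Hom T (cell i) X) (Hom T (cell i) L)"
    proof (intro allI impI)
      fix i assume i: "i < N"
      show "bij_betw (\<lambda>x. l 0 \<cdot> x) (Hom T (cell i) X) (Hom T (cell i) L)"
        unfolding Z0[symmetric]
      proof (rule comp_bij_betw[OF l(1)])
        have "y = Zero T (cell i) (Z n)"
          if "y \<in> Hom T (cell i) (Z n)" "t n \<cdot> y = Zero T (cell i) (Z (Suc n))" for n y
          using comp_bij_kernel[OF tb th that] i by simp
        then show "x = Zero T (cell i) (Z 0)"
          if "x \<in> Hom T (cell i) (Z 0)" "l 0 \<cdot> x = Zero T (cell i) L" for x
          using S2 that by blast
        show "\<exists>x\<in>Hom T (cell i) (Z 0). l 0 \<cdot> x = y" if "y \<in> Hom T (cell i) L" for y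
        proof -
          obtain n x where "x \<in> Hom T (cell i) (Z n)" "l n \<cdot> x = y" using S1 \<open>y \<in> Hom T (cell i) L\<close> by blast
          then show ?thesis using pull[OF i] by blast
        qed
      qed
    qed
    show "\<forall>W g. (\<forall>i\<ge>N. hom_zero T (cell i) W) \<longrightarrow> g \<in> Hom T X W \<longrightarrow> (\<exists>h\<in>Hom T L W. h \<cdot> l 0 = g)"
    proof (intro allI impI)
      fix W g assume W: "\<forall>i\<ge>N. hom_zero T (cell i) W" and g: "g \<in> Hom T X W"
      have "\<exists>m. \<forall>n. (m n \<in> Hom T (Z n) W \<and> (n = 0 \<longrightarrow> m n = g)) \<and> m (Suc n) \<cdot> t n = m n"
      proof (rule dependent_nat_choice)
        show "\<exists>m. m \<in> Hom T (Z 0) W \<and> (0 = (0 :: nat) \<longrightarrow> m = g)" using g Z0 by blast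
        fix m and n :: nat assume "m \<in> Hom T (Z n) W \<and> (n = 0 \<longrightarrow> m = g)"
        then obtain h where "h \<in> Hom T (Z (Suc n)) W" "h \<cdot> t n = m" using te[of n W m] W by auto
        then show "\<exists>h. (h \<in> Hom T (Z (Suc n)) W \<and> (Suc n = 0 \<longrightarrow> h = g)) \<and> h \<cdot> t n = m" by blast
      qed
      then obtain m where m: "\<forall>n. m n \<in> Hom T (Z n) W \<and> m (Suc n) \<cdot> t n = m n" "m 0 = g" by blast
      then obtain h where "h \<in> Hom T L W" "\<forall>n. h \<cdot> l n = m n" using ext by blast
      then show "\<exists>h\<in>Hom T L W. h \<cdot> l 0 = g" using m(2) by blast
    qed
  qed
qed

text \<open>
  Truncating \<open>X\<close> at \<open>n\<close> yields an object without cohomology, hence zero, over which every map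
  \<open>X \<rightarrow> W\<close> factors.
\<close>

lemma orthogonality:
  assumes X: "X \<in> Obj T" "\<And>i. i < n \<Longrightarrow> hom_zero T (cell i) X"
    and W: "W \<in> Obj T" "\<And>i. i \<ge> n \<Longrightarrow> hom_zero T (cell i) W"
  shows "hom_zero T X W"
proof (rule hom_zeroI[OF X(1) W(1)])
  obtain L l where l: "l \<in> Hom T X L" and L: "\<forall>i\<ge>n. hom_zero T (cell i) L"
    "\<forall>i<n. bij_betw (\<lambda>x. l \<cdot> x) (Hom T (cell i) X) (Hom T (cell i) L)"
    and ext: "\<forall>W g. (\<forall>i\<ge>n. hom_zero T (cell i) W) \<longrightarrow> g \<in> Hom T X W \<longrightarrow> (\<exists>h\<in>Hom T L W. h \<cdot> l = g)"
    by (rule truncation[OF X(1)])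
  have LO: "L \<in> Obj T" using l hom_objs by blast
  have "hom_zero T (cell i) L" for i
    using L hom_zero_bij[OF _ l cell_obj, of i] X(2) by (cases "i < n") auto
  then have zL: "is_zero_object T L" using zero_object_if_acyclic[OF LO] by blast
  fix g assume "g \<in> Hom T X W"
  then obtain h where h: "h \<in> Hom T L W" "h \<cdot> l = g" using ext W(2) by blast
  have "h = Zero T L W" using hom_zeroD[OF zero_object_hom_zero(2)[OF zL W(1)] h(1)] .
  then show "g = Zero T X W" using h(2) zero_comp[OF l W(1)] by simp
qed

end

section \<open>The co-t-structure and the abelian coheart\<close>

context corigid_generator
begin

definition degree_ge0 :: "'o set" where
  "degree_ge0 = {X \<in> Obj T. \<forall>i<0. hom_zero T (cell i) X}"

definition degree_le0 :: "'o set" where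
  "degree_le0 = {X \<in> Obj T. \<forall>i>0. hom_zero T (cell i) X}"

lemma hom_zero_cell_susp_pow:
  "X \<in> Obj T \<Longrightarrow> hom_zero T (cell i) (susp_pow T n X) \<longleftrightarrow> hom_zero T (cell (i + n)) X"
  using hom_zero_cell[OF susp_pow_obj[of X n], of i] hom_zero_cell[of X "i + n"] susp_pow_add[of X i n]
  by simp

lemma hom_zero_cell_desusp:
  "X \<in> Obj T \<Longrightarrow> hom_zero T (cell i) (Desusp T X) \<longleftrightarrow> hom_zero T (cell (i - 1)) X"
  using hom_zero_cell_susp_pow[of X i "-1"] susp_pow_pred[of X 0] by (simp add: susp_pow_0)

text \<open>
  The truncation \<open>l : X \<rightarrow> L\<close> at \<open>1\<close> is bijective in the degrees \<open>\<le> 0\<close>, so its cone has no cohomology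
  in negative degrees.
\<close>

lemma co_t_triangle:
  assumes X: "X \<in> Obj T"
  shows "\<exists>Y\<in>degree_ge0. \<exists>Z\<in>degree_le0. \<exists>u\<in>Hom T (Desusp T Y) X. \<exists>v\<in>Hom T X Z. \<exists>w\<in>Hom T Z Y.
    (u, v, w) \<in> Tri T"
proof -
  obtain L l where l: "l \<in> Hom T X L" and L: "\<forall>i\<ge>1. hom_zero T (cell i) L"
    and b: "\<forall>i<1. bij_betw (\<lambda>x. l \<cdot> x) (Hom T (cell i) X) (Hom T (cell i) L)"
    and "\<forall>W g. (\<forall>i\<ge>1. hom_zero T (cell i) W) \<longrightarrow> g \<in> Hom T X W \<longrightarrow> (\<exists>h\<in>Hom T L W. h \<cdot> l = g)"
    by (rule truncation[OF X, of 1])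
  obtain Y v w where t: "triangle T X L Y l v w" by (rule triangle_cone[OF l])
  note o = triangle_objs[OF t]
  have v: "v \<in> Hom T L Y" using t by (simp add: triangle_def)
  have Y: "Y \<in> degree_ge0"
    unfolding degree_ge0_def
  proof (intro CollectI conjI allI impI o hom_zeroI[OF cell_obj])
    fix i :: int and y assume i: "i < 0" and "y \<in> Hom T (cell i) Y"
    then have y: "y \<in> Hom T (Susp T (cell (i + 1))) Y" using susp_cell by simp
    have inj: "c = Zero T (cell (i + 1)) X"
      if "c \<in> Hom T (cell (i + 1)) X" "l \<cdot> c = Zero T (cell (i + 1)) L" for c
      using comp_bij_kernel[OF b[rule_format] l that] i by simp
    obtain z where z: "z \<in> Hom T (Susp T (cell (i + 1))) L" "v \<cdot> z = y"
      by (rule triangle_hom_surj[OF t cell_obj inj y])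
    have "z \<in> Hom T (cell i) L" using z(1) susp_cell by simp
    then obtain x where x: "x \<in> Hom T (cell i) X" "l \<cdot> x = z"
      using comp_bij_surj[OF b[rule_format]] i by (metis less_trans zero_less_one)
    then have "y = (v \<cdot> l) \<cdot> x" using z(2) comp_assoc[OF x(1) l v] by simp
    then show "y = Zero T (cell i) Y" using triangle_comp_zero[OF t] zero_comp[OF x(1) o(3)] by simp
  qed
  have Ld: "L \<in> degree_le0" using L o by (simp add: degree_le0_def)
  have YO: "Desusp T Y \<in> Obj T" "Susp T (Desusp T Y) = Y" using desusp_obj susp_desusp o by auto
  then obtain u where "triangle T (Desusp T Y) X L u l v"
    using triangle_unrotate[of X L "Desusp T Y" l v w] t by auto
  then have "(u, l, v) \<in> Tri T" "u \<in> Hom T (Desusp T Y) X" by (simp_all add: triangle_def)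
  then show ?thesis using Y Ld l v by blast
qed

lemma summand_hom_zero:
  assumes "is_biproduct T X Y P i j p q" "hom_zero T W P" "W \<in> Obj T"
  shows "hom_zero T W X"
  using assms hom_zero_retract[of W P i X p] by (simp add: is_biproduct_def)

lemma nondegenerate: "nondegenerate_co_t_structure T degree_ge0 degree_le0"
  unfolding nondegenerate_co_t_structure_def co_t_structure_def
proof (intro conjI)
  show "degree_ge0 \<subseteq> Obj T" "degree_le0 \<subseteq> Obj T" by (auto simp: degree_ge0_def degree_le0_def)
  show "closed_under_summands T degree_ge0" "closed_under_summands T degree_le0"
    unfolding closed_under_summands_def degree_ge0_def degree_le0_def
    using summand_hom_zero[OF _ _ cell_obj] by (auto simp: is_biproduct_def)
  show "Desusp T ` degree_ge0 \<subseteq> degree_ge0"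
    using hom_zero_cell_desusp desusp_obj by (auto simp: degree_ge0_def)
  show "degree_le0 \<subseteq> Desusp T ` degree_le0"
  proof
    fix X assume X: "X \<in> degree_le0"
    then have XO: "X \<in> Obj T" by (simp add: degree_le0_def)
    then have "Susp T X \<in> degree_le0"
      using X hom_zero_cell_susp susp_obj by (simp add: degree_le0_def)
    then show "X \<in> Desusp T ` degree_le0" using desusp_susp[OF XO] by (metis imageI)
  qed
  show "\<forall>X\<in>degree_ge0. \<forall>Y\<in>degree_le0. hom_zero T (Desusp T X) Y"
  proof (intro ballI)
    fix X Y assume X: "X \<in> degree_ge0" and Y: "Y \<in> degree_le0"
    then have XO: "X \<in> Obj T" and YO: "Y \<in> Obj T" by (simp_all add: degree_ge0_def degree_le0_def)
    show "hom_zero T (Desusp T X) Y"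
    proof (rule orthogonality[where n = 1, OF desusp_obj[OF XO] _ YO])
      show "hom_zero T (cell i) (Desusp T X)" if "i < 1" for i
        using that X hom_zero_cell_desusp[OF XO, of i] by (simp add: degree_ge0_def)
      show "hom_zero T (cell i) Y" if "i \<ge> 1" for i using that Y by (simp add: degree_le0_def)
    qed
  qed
  show "\<forall>X\<in>Obj T. \<exists>Y\<in>degree_ge0. \<exists>Z\<in>degree_le0. \<exists>u\<in>Hom T (Desusp T Y) X. \<exists>v\<in>Hom T X Z.
      \<exists>w\<in>Hom T Z Y. (u, v, w) \<in> Tri T"
    using co_t_triangle by blast
  have zero: "Z \<in> susp_pow T n ` degree_ge0 \<and> Z \<in> susp_pow T n ` degree_le0" if Z: "is_zero_object T Z" for Z n
  proof -
    have ZO: "Z \<in> Obj T" using Z by (simp add: is_zero_object_def)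
    let ?Z = "susp_pow T (- n) Z"
    have "hom_zero T (cell i) ?Z" for i
      using hom_zero_cell_susp_pow[OF ZO] zero_object_hom_zero(1)[OF Z cell_obj] by simp
    then have "?Z \<in> degree_ge0" "?Z \<in> degree_le0"
      using susp_pow_obj[OF ZO] by (simp_all add: degree_ge0_def degree_le0_def)
    moreover have "Z = susp_pow T n ?Z" using susp_pow_add[OF ZO, of n "- n"] by (simp add: susp_pow_0)
    ultimately show ?thesis by blast
  qed
  show "(\<Inter>n. susp_pow T n ` degree_ge0) = {X. is_zero_object T X}"
  proof (intro equalityI subsetI CollectI)
    fix X assume X: "X \<in> (\<Inter>n. susp_pow T n ` degree_ge0)"
    have *: "X \<in> Obj T \<and> hom_zero T (cell i) X" for i
    proof -
      have "X \<in> susp_pow T (- i - 1) ` degree_ge0" using X by (rule INT_D) simp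
      then obtain Y where Y: "X = susp_pow T (- i - 1) Y" "Y \<in> degree_ge0" by (rule imageE)
      then show ?thesis
        using hom_zero_cell_susp_pow[of Y i "- i - 1"] susp_pow_obj[of Y] by (simp add: degree_ge0_def)
    qed
    then show "is_zero_object T X" using zero_object_if_acyclic by blast
  qed (use zero in blast)
  show "(\<Inter>n. susp_pow T n ` degree_le0) = {X. is_zero_object T X}"
  proof (intro equalityI subsetI CollectI)
    fix X assume X: "X \<in> (\<Inter>n. susp_pow T n ` degree_le0)"
    have *: "X \<in> Obj T \<and> hom_zero T (cell i) X" for i
    proof -
      have "X \<in> susp_pow T (- i + 1) ` degree_le0" using X by (rule INT_D) simp
      then obtain Y where Y: "X = susp_pow T (- i + 1) Y" "Y \<in> degree_le0" by (rule imageE)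
      then show ?thesis
        using hom_zero_cell_susp_pow[of Y i "- i + 1"] susp_pow_obj[of Y] by (simp add: degree_le0_def)
    qed
    then show "is_zero_object T X" using zero_object_if_acyclic by blast
  qed (use zero in blast)
qed

text \<open>
  The cone \<open>Q\<close> of a cover \<open>p : P \<rightarrow> X\<close> by copies of \<open>S\<close> has cohomology in positive degrees only,
  so that neither \<open>Q\<close> nor its desuspension maps to \<open>Y\<close>.
\<close>

lemma cover_cone:
  assumes X: "X \<in> degree_ge0" and Y: "Y \<in> degree_le0"
  obtains I :: "'m set" and P \<iota> p Q v w where "small \<kappa> I" "is_coproduct T I (\<lambda>_. S) P \<iota>"
    "bij_betw (\<lambda>x. p \<cdot> x) (Hom T S P) (Hom T S X)" "triangle T P X Q p v w"
    "hom_zero T Q Y" "hom_zero T Q (Susp T Y)"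
proof -
  have XO: "X \<in> Obj T" and YO: "Y \<in> Obj T" using X Y by (auto simp: degree_ge0_def degree_le0_def)
  obtain I :: "'m set" and P \<iota> p where I: "small \<kappa> I" and c: "is_coproduct T I (\<lambda>_. cell 0) P \<iota>"
    and p: "p \<in> Hom T P X" and b: "bij_betw (\<lambda>x. p \<cdot> x) (Hom T (cell 0) P) (Hom T (cell 0) X)"
    by (rule cell_cover[OF XO])
  obtain Q v w where t: "triangle T P X Q p v w" by (rule triangle_cone[OF p])
  note o = triangle_objs[OF t]
  have v: "v \<in> Hom T X Q" using t by (simp add: triangle_def)
  have "hom_zero T (cell i) Q" if i: "i \<le> 0" for i
  proof (cases "i < 0")
    case True
    then show ?thesis
      using hom_zero_bij[OF attach_cells(1)[OF I c b t] v cell_obj] X by (simp add: degree_ge0_def)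
  next
    case False
    then show ?thesis using i attach_cells(2)[OF I c b t] by simp
  qed
  then have Q: "hom_zero T (cell i) Q" if "i < 1" for i using that by simp
  have zY: "hom_zero T (cell i) Y" if "i \<ge> 1" for i using that Y by (simp add: degree_le0_def)
  have zsY: "hom_zero T (cell i) (Susp T Y)" if "i \<ge> 1" for i
    using that Y hom_zero_cell_susp[OF YO, of i] by (simp add: degree_le0_def)
  have "hom_zero T Q Y" "hom_zero T Q (Susp T Y)"
    using orthogonality[OF o(3) Q YO zY] orthogonality[OF o(3) Q susp_obj[OF YO] zsY] by blast+
  then show ?thesis by (rule that[OF I c[unfolded cell_0] b[unfolded cell_0] t])
qed

text \<open>
  An arrow that vanishes on \<open>Hom(S, X)\<close> vanishes on the cover \<open>P\<close>, hence factors through its cone.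
\<close>

lemma hom_S_faithful:
  assumes X: "X \<in> degree_ge0" and Y: "Y \<in> degree_le0" and f: "f \<in> Hom T X Y" and g: "g \<in> Hom T X Y"
    and eq: "\<And>x. x \<in> Hom T S X \<Longrightarrow> f \<cdot> x = g \<cdot> x"
  shows "f = g"
proof -
  obtain I :: "'m set" and P \<iota> p Q v w where c: "is_coproduct T I (\<lambda>_. S) P \<iota>"
    and t: "triangle T P X Q p v w" and z: "hom_zero T Q Y"
    by (rule cover_cone[OF X Y])
  have p: "p \<in> Hom T P X" and v: "v \<in> Hom T X Q" using t by (auto simp: triangle_def)
  have YO: "Y \<in> Obj T" using f hom_objs by blast
  have "f \<cdot> p = g \<cdot> p"
  proof (rule coproduct_hom_eqI[OF c comp_hom[OF p f] comp_hom[OF p g]])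
    fix i assume "i \<in> I"
    then have \<iota>: "\<iota> i \<in> Hom T S P" using c by (simp add: is_coproduct_def)
    show "(f \<cdot> p) \<cdot> \<iota> i = (g \<cdot> p) \<cdot> \<iota> i"
      using comp_assoc[OF \<iota> p f] comp_assoc[OF \<iota> p g] eq[OF comp_hom[OF \<iota> p]] by simp
  qed
  then have "(f \<boxplus> Neg T g) \<cdot> p = Zero T P Y"
    using comp_add_right[OF p f neg_hom[OF g]] neg_comp[OF p g] add_neg[OF comp_hom[OF p g]] by simp
  then obtain h where h: "h \<in> Hom T Q Y" "h \<cdot> v = f \<boxplus> Neg T g"
    by (rule triangle_extend[OF t add_hom[OF f neg_hom[OF g]]])
  have "f \<boxplus> Neg T g = Zero T X Y" using h hom_zeroD[OF z h(1)] zero_comp[OF v YO] by simp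
  then show ?thesis by (rule diff_zero_eq[OF f g])
qed

text \<open>
  A linear map prescribes an arrow on each summand of the cover \<open>P\<close>, and the obstruction to
  extending the resulting arrow \<open>P \<rightarrow> Y\<close> to \<open>X\<close> lies in \<open>Hom(Q, \<Sigma>Y) = 0\<close>.
\<close>

lemma hom_S_full:
  assumes X: "X \<in> degree_ge0" and Y: "Y \<in> degree_le0"
    and \<phi>: "\<phi> \<in> module_homs (End_ring T S) (hom_obj T S X) (hom_obj T S Y)"
  shows "\<exists>f\<in>Hom T X Y. \<forall>x\<in>Hom T S X. f \<cdot> x = \<phi> x"
proof -
  obtain I :: "'m set" and P \<iota> p Q v w where I: "small \<kappa> I" and c: "is_coproduct T I (\<lambda>_. S) P \<iota>"
    and b: "bij_betw (\<lambda>x. p \<cdot> x) (Hom T S P) (Hom T S X)"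
    and t: "triangle T P X Q p v w" and z: "hom_zero T Q (Susp T Y)"
    by (rule cover_cone[OF X Y])
  have p: "p \<in> Hom T P X" and w: "w \<in> Hom T Q (Susp T P)" using t by (auto simp: triangle_def)
  note o = triangle_objs[OF t]
  have YO: "Y \<in> Obj T" using Y by (simp add: degree_le0_def)
  have \<iota>: "\<iota> i \<in> Hom T S P" if "i \<in> I" for i using c that by (simp add: is_coproduct_def)
  have \<phi>H: "\<phi> x \<in> Hom T S Y" if "x \<in> Hom T S X" for x
    using module_homs_closed[OF \<phi>, of x] that by (simp add: hom_obj_def)
  obtain g where g: "g \<in> Hom T P Y" and g\<iota>: "\<And>i. i \<in> I \<Longrightarrow> g \<cdot> \<iota> i = \<phi> (p \<cdot> \<iota> i)"
    using coproduct_hom_ex[OF c YO, of "\<lambda>i. \<phi> (p \<cdot> \<iota> i)"] \<phi>H[OF comp_hom[OF \<iota> p]] by blast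
  have "SuspA T g \<cdot> w \<in> Hom T Q (Susp T Y)" using comp_hom[OF w susp_hom[OF g]] .
  then have "SuspA T g \<cdot> w = Zero T Q (Susp T Y)" by (rule hom_zeroD[OF z])
  then obtain f where f: "f \<in> Hom T X Y" "f \<cdot> p = g" by (rule triangle_extend3[OF t g])
  let ?f = "\<lambda>x\<in>Hom T S P. f \<cdot> (p \<cdot> x)" and ?\<phi> = "\<lambda>x\<in>Hom T S P. \<phi> (p \<cdot> x)"
  let ?R = "End_ring T S" and ?M = "hom_obj T S P" and ?N = "hom_obj T S Y"
  have M: "right_module ?R ?M" and N: "right_module ?R ?N"
    using hom_obj_right_module S_obj o YO by blast+
  note pm = hom_obj_post_comp[OF S_obj p]
  have f': "?f \<in> module_homs ?R ?M ?N"
  proof -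
    have "compose (carrier ?M) (\<lambda>x\<in>Hom T S X. f \<cdot> x) (\<lambda>x\<in>Hom T S P. p \<cdot> x) = ?f"
      using comp_hom[OF _ p] by (auto simp: compose_def hom_obj_def)
    then show ?thesis using module_homs_compose[OF pm hom_obj_post_comp[OF S_obj f(1)] M] by simp
  qed
  have \<phi>': "?\<phi> \<in> module_homs ?R ?M ?N"
  proof -
    have "compose (carrier ?M) \<phi> (\<lambda>x\<in>Hom T S P. p \<cdot> x) = ?\<phi>"
      by (auto simp: compose_def hom_obj_def)
    then show ?thesis using module_homs_compose[OF pm \<phi> M] by simp
  qed
  have fin: "finitary \<kappa> T S" using compact_object_finitary[OF compact] .
  have "f \<cdot> (p \<cdot> x) = \<phi> (p \<cdot> x)" if x: "x \<in> Hom T S P" for x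
  proof -
    have "?f x = ?\<phi> x"
    proof (rule module_homs_eq_on_rspan[where f = ?f and g = ?\<phi> and v = x,
          OF f' \<phi>' M N coproduct_basis(1)[OF fin I c S_obj]])
      show "x \<in> rspan ?R ?M (\<iota> ` I)"
        using coproduct_basis(2)[OF fin I c S_obj] x by (auto simp: hom_obj_def)
      show "?f u = ?\<phi> u" if u: "u \<in> \<iota> ` I" for u
      proof -
        obtain i where i: "i \<in> I" "u = \<iota> i" using u by blast
        then show ?thesis using \<iota> g\<iota> comp_assoc[OF \<iota> p f(1)] f(2) by simp
      qed
    qed
    then show ?thesis using x by simp
  qed
  then have "f \<cdot> x = \<phi> x" if "x \<in> Hom T S X" for x
    using comp_bij_surj[OF b that] by metis
  then show ?thesis using f(1) by blast
qed

text \<open>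
  The coproduct of copies of \<open>S\<close> indexed by a basis of \<open>M\<close> realizes \<open>M\<close> in degree \<open>0\<close>.  Truncation at
  \<open>1\<close> moves it into the coheart without changing the cohomology in degrees \<open>\<le> 0\<close>.
\<close>

lemma coheart_realization:
  fixes M :: "('m, 'm) module"
  assumes M: "right_module (End_ring T S) M" and small: "small \<kappa> (carrier M)"
  obtains L \<theta> where "L \<in> degree_ge0 \<inter> degree_le0" "\<theta> \<in> module_homs (End_ring T S) M (hom_obj T S L)"
    "bij_betw \<theta> (carrier M) (carrier (hom_obj T S L))"
proof -
  let ?R = "End_ring T S"
  have div: "division_ring ?R" using corigid by (simp add: simply_connected_corigid_def)
  then have nz: "Idt T S \<noteq> Zero T S S" by (simp add: End_division_ring_iff[OF S_obj])
  have VM: "right_vector_space ?R M"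
    using M div by (simp add: right_vector_space_def right_vector_space_axioms_def)
  interpret M: right_vector_space ?R M by (rule VM)
  have emp: "rindep ?R M {}" by (simp add: rindep_def)
  obtain I where "{} \<subseteq> I" and I: "I \<subseteq> carrier M" "rindep ?R M I" "carrier M \<subseteq> rspan ?R M I"
    by (rule M.basis_extension[OF subset_refl empty_subsetI emp])
  have sI: "small \<kappa> I" using small_subset[OF small I(1)] .
  obtain P \<iota> where c: "is_coproduct T I (\<lambda>_. S) P \<iota>"
    using coproducts[unfolded has_small_coproducts_def, rule_format, of I "\<lambda>_. S"] sI S_obj by blast
  have P: "P \<in> Obj T" using c by (simp add: is_coproduct_def)
  have fin: "finitary \<kappa> T S" using compact_object_finitary[OF compact] .
  note basis = coproduct_basis[OF fin sI c S_obj] and indep = coproduct_basis_indep[OF c S_obj nz]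
  have MP: "right_module ?R (hom_obj T S P)" by (rule hom_obj_right_module[OF S_obj P])
  have VP: "right_vector_space ?R (hom_obj T S P)"
    using MP div by (simp add: right_vector_space_def right_vector_space_axioms_def)
  have \<iota>: "\<iota> u \<in> carrier (hom_obj T S P)" if "u \<in> I" for u using basis(1) that by blast
  obtain \<psi> where \<psi>: "\<psi> \<in> module_homs ?R M (hom_obj T S P)" "\<forall>u\<in>I. \<psi> u = \<iota> u"
    using linear_extension[where d = \<iota>, OF VM MP I \<iota>] by blast
  have im: "\<psi> ` I = \<iota> ` I" using \<psi>(2) by simp
  have "inj_on \<psi> I" using indep(2) \<psi>(2) by (simp cong: inj_on_cong)
  then have b: "bij_betw \<psi> (carrier M) (carrier (hom_obj T S P))"
    using basis_bij[OF M VP \<psi>(1) I(1,3)] im basis indep(1) by simp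
  obtain L l where l: "l \<in> Hom T P L" and L: "\<forall>i\<ge>1. hom_zero T (cell i) L"
    and lb: "\<forall>i<1. bij_betw (\<lambda>x. l \<cdot> x) (Hom T (cell i) P) (Hom T (cell i) L)"
    and "\<forall>W g. (\<forall>i\<ge>1. hom_zero T (cell i) W) \<longrightarrow> g \<in> Hom T P W \<longrightarrow> (\<exists>h\<in>Hom T L W. h \<cdot> l = g)"
    by (rule truncation[OF P, of 1])
  have LO: "L \<in> Obj T" using l hom_objs by blast
  have "hom_zero T (cell i) L" if "i < 0" for i
    using hom_zero_bij[OF lb[rule_format] l cell_obj, of i] that
      hom_zero_coproduct_cells[OF cell_cell_less[OF that] sI] c by (simp add: cell_0)
  then have LC: "L \<in> degree_ge0 \<inter> degree_le0" using L LO by (simp add: degree_ge0_def degree_le0_def)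
  let ?l = "\<lambda>x\<in>Hom T S P. l \<cdot> x"
  have "bij_betw (\<lambda>x. l \<cdot> x) (Hom T S P) (Hom T S L)" using lb[rule_format, of 0] by (simp add: cell_0)
  then have "bij_betw ?l (Hom T S P) (Hom T S L)"
    using bij_betw_cong[of "Hom T S P" ?l "\<lambda>x. l \<cdot> x"] by simp
  then have lb': "bij_betw ?l (carrier (hom_obj T S P)) (carrier (hom_obj T S L))" by (simp add: hom_obj_def)
  have "bij_betw (compose (carrier M) ?l \<psi>) (carrier M) (carrier (hom_obj T S L))"
    by (rule bij_betw_compose[OF b lb'])
  then show ?thesis
    using that[OF LC module_homs_compose[OF \<psi>(1) hom_obj_post_comp[OF S_obj l] M]] by blast
qed

end

lemma Hom_full_subcat: "f \<in> Hom (full_subcat C A) X Y \<longleftrightarrow> f \<in> Hom C X Y \<and> X \<in> A \<and> Y \<in> A"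
  by (auto simp: Hom_def full_subcat_def)

lemma full_subcat_simps [simp]:
  "Obj (full_subcat C A) = A" "Comp (full_subcat C A) = Comp C" "Idt (full_subcat C A) = Idt C"
  "Add (full_subcat C A) = Add C" "Zero (full_subcat C A) = Zero C"
  "Dom (full_subcat C A) = Dom C" "Cod (full_subcat C A) = Cod C"
  by (simp_all add: full_subcat_def)

lemma (in preadditive_category) full_subcat_preadditive:
  assumes A: "A \<subseteq> Obj C"
  shows "preadditive_category (full_subcat C A)"
proof (intro preadditive_category.intro category.intro preadditive_category_axioms.intro,
    unfold Hom_full_subcat full_subcat_simps)
  fix f assume "f \<in> Arr (full_subcat C A)"
  then show "Dom C f \<in> A" "Cod C f \<in> A" by (simp_all add: full_subcat_def)
next
  fix X assume "X \<in> A"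
  then show "Idt C X \<in> Hom C X X \<and> X \<in> A \<and> X \<in> A" using A idt_hom by blast
next
  fix X Y assume XY: "X \<in> A" "Y \<in> A"
  then have "Hom (full_subcat C A) X Y = Hom C X Y" by (auto simp: Hom_full_subcat)
  then have "hom_group (full_subcat C A) X Y = hom_group C X Y" by (simp add: hom_group_def)
  then show "comm_group (hom_group (full_subcat C A) X Y)"
    using hom_comm_group[OF subsetD[OF A XY(1)] subsetD[OF A XY(2)]] by simp
next
  fix f X Y g Z assume "f \<in> Hom C X Y \<and> X \<in> A \<and> Y \<in> A" "g \<in> Hom C Y Z \<and> Y \<in> A \<and> Z \<in> A"
  then show "g \<cdot> f \<in> Hom C X Z \<and> X \<in> A \<and> Z \<in> A" using comp_hom[of f X Y g Z] by simp
next
  fix f X Y assume "f \<in> Hom C X Y \<and> X \<in> A \<and> Y \<in> A"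
  then show "Idt C Y \<cdot> f = f" "f \<cdot> Idt C X = f"
    using comp_idt_left[of f X Y] comp_idt_right[of f X Y] by simp_all
next
  fix f W X g Y h Z
  assume "f \<in> Hom C W X \<and> W \<in> A \<and> X \<in> A" "g \<in> Hom C X Y \<and> X \<in> A \<and> Y \<in> A"
    "h \<in> Hom C Y Z \<and> Y \<in> A \<and> Z \<in> A"
  then show "(h \<cdot> g) \<cdot> f = h \<cdot> (g \<cdot> f)" using comp_assoc[of f W X g Y h Z] by simp
next
  fix f X Y f' g Z
  assume "f \<in> Hom C X Y \<and> X \<in> A \<and> Y \<in> A" "f' \<in> Hom C X Y \<and> X \<in> A \<and> Y \<in> A"
    "g \<in> Hom C Y Z \<and> Y \<in> A \<and> Z \<in> A"
  then show "g \<cdot> (f \<boxplus> f') = g \<cdot> f \<boxplus> g \<cdot> f'" using comp_add_left[of f X Y f' g Z] by simp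
next
  fix f X Y g Z g'
  assume "f \<in> Hom C X Y \<and> X \<in> A \<and> Y \<in> A" "g \<in> Hom C Y Z \<and> Y \<in> A \<and> Z \<in> A"
    "g' \<in> Hom C Y Z \<and> Y \<in> A \<and> Z \<in> A"
  then show "(g \<boxplus> g') \<cdot> f = g \<cdot> f \<boxplus> g' \<cdot> f" using comp_add_right[of f X Y g Z g'] by simp
qed

lemma (in additive_category) full_subcat_additive:
  assumes A: "A \<subseteq> Obj C" and zero: "\<And>Z. is_zero_object C Z \<Longrightarrow> Z \<in> A"
    and biprod: "\<And>X Y P i j p q. X \<in> A \<Longrightarrow> Y \<in> A \<Longrightarrow> is_biproduct C X Y P i j p q \<Longrightarrow> P \<in> A"
  shows "additive_category (full_subcat C A)"
proof (intro additive_category.intro additive_category_axioms.intro)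
  show "preadditive_category (full_subcat C A)" by (rule full_subcat_preadditive[OF A])
  obtain Z where Z: "is_zero_object C Z" using ex_zero_object by blast
  have "is_zero_object (full_subcat C A) Z"
    using Z zero[OF Z] A by (simp add: is_zero_object_def Hom_full_subcat subset_iff)
  then show "\<exists>Z. is_zero_object (full_subcat C A) Z" by blast
next
  fix X Y assume "X \<in> Obj (full_subcat C A)" "Y \<in> Obj (full_subcat C A)"
  then have XY: "X \<in> A" "Y \<in> A" by simp_all
  then obtain P i j p q where b: "is_biproduct C X Y P i j p q" using ex_biproduct A by blast
  then have "P \<in> A" using biprod XY by blast
  then have "is_biproduct (full_subcat C A) X Y P i j p q"
    using b XY by (simp add: is_biproduct_def Hom_full_subcat)
  then show "\<exists>P i j p q. is_biproduct (full_subcat C A) X Y P i j p q" by blast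
qed

context corigid_generator
begin

text \<open>
  The fixed vectors of \<open>e\<close> form a subspace of \<open>Hom(S, X)\<close>.  An object of the coheart that realizes it
  is the image of \<open>e\<close>, since the inclusion of the subspace and the projection to it lift to arrows.
\<close>

lemma coheart_split:
  assumes X: "X \<in> degree_ge0 \<inter> degree_le0" and e: "e \<in> Hom T X X" "e \<cdot> e = e"
  shows "\<exists>K\<in>degree_ge0 \<inter> degree_le0. \<exists>s\<in>Hom T K X. \<exists>r\<in>Hom T X K. s \<cdot> r = e \<and> r \<cdot> s = Idt T K"
proof -
  let ?R = "End_ring T S" and ?X = "hom_obj T S X"
  have XO: "X \<in> Obj T" using e hom_objs by blast
  define V where "V = {x \<in> Hom T S X. e \<cdot> x = x}"
  define M where "M = ?X\<lparr>carrier := V\<rparr>"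
  have VX: "V \<subseteq> Hom T S X" by (auto simp: V_def)
  have MX: "right_module ?R ?X" by (rule hom_obj_right_module[OF S_obj XO])
  have M: "right_module ?R M"
    unfolding M_def
  proof (rule right_module.submodule[OF MX])
    show "V \<subseteq> carrier ?X" using VX by (simp add: hom_obj_def)
    show "\<zero>\<^bsub>?X\<^esub> \<in> V"
      using zero_hom[OF S_obj XO] comp_zero[OF e(1) S_obj] by (simp add: V_def hom_obj_def)
    show "x \<oplus>\<^bsub>?X\<^esub> y \<in> V" if "x \<in> V" "y \<in> V" for x y
      using that comp_add_left[of x S X y e X] e(1) add_hom[of x S X y] by (simp add: V_def hom_obj_def)
    show "a \<odot>\<^bsub>?X\<^esub> x \<in> V" if "a \<in> carrier ?R" "x \<in> V" for a x
      using that comp_assoc[of a S S x X e X] e(1) comp_hom[of a S S x X]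
      by (simp add: V_def hom_obj_def End_ring_def)
  qed
  have "small \<kappa> (Hom T S X)" using loc_small S_obj XO by (simp add: locally_small_def)
  then have sM: "small \<kappa> (carrier M)" using small_subset[OF _ VX] by (simp add: M_def)
  obtain K \<theta> where K: "K \<in> degree_ge0 \<inter> degree_le0" and \<theta>: "\<theta> \<in> module_homs ?R M (hom_obj T S K)"
    and b: "bij_betw \<theta> (carrier M) (carrier (hom_obj T S K))"
    by (rule coheart_realization[OF M sM])
  have KO: "K \<in> Obj T" using K by (simp add: degree_ge0_def)
  have bV: "bij_betw \<theta> V (Hom T S K)" using b by (simp add: M_def hom_obj_def)
  let ?i = "inv_into V \<theta>"
  have i: "?i y \<in> V" "\<theta> (?i y) = y" if "y \<in> Hom T S K" for y
    using that bV bij_betw_inv_into_right[OF bV] inv_into_into[of y \<theta> V] by (simp_all add: bij_betw_def)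
  have i\<theta>: "?i (\<theta> x) = x" if "x \<in> V" for x using bij_betw_inv_into_left[OF bV that] .
  have \<theta>c: "\<theta> x \<in> Hom T S K" if "x \<in> V" for x using bV that by (auto simp: bij_betw_def)
  have "(\<lambda>y\<in>Hom T S K. ?i y) \<in> module_homs ?R (hom_obj T S K) M"
    using module_homs_inverse[OF \<theta> b M hom_obj_right_module[OF S_obj KO]]
    by (simp add: M_def hom_obj_def)
  then have "(\<lambda>y\<in>Hom T S K. ?i y) \<in> module_homs ?R (hom_obj T S K) ?X"
    using VX by (auto simp: module_homs_def M_def hom_obj_def)
  then obtain s where s: "s \<in> Hom T K X" "\<And>y. y \<in> Hom T S K \<Longrightarrow> s \<cdot> y = ?i y"
    using hom_S_full[of K X] K X by fastforce
  have eV: "e \<cdot> x \<in> V" if "x \<in> Hom T S X" for x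
    using comp_hom[OF that e(1)] comp_assoc[OF that e(1) e(1)] e(2) by (simp add: V_def)
  have "(\<lambda>x\<in>Hom T S X. e \<cdot> x) \<in> module_homs ?R ?X M"
    using hom_obj_post_comp[OF S_obj e(1)] eV by (auto simp: module_homs_def M_def hom_obj_def)
  from module_homs_compose[OF this \<theta> MX]
  obtain r where r: "r \<in> Hom T X K" "\<And>x. x \<in> Hom T S X \<Longrightarrow> r \<cdot> x = \<theta> (e \<cdot> x)"
    using hom_S_full[of X K] K X by (fastforce simp: compose_def hom_obj_def)
  have "s \<cdot> r = e"
  proof (rule hom_S_faithful[of X X])
    show "(s \<cdot> r) \<cdot> x = e \<cdot> x" if x: "x \<in> Hom T S X" for x
      using comp_assoc[OF x r(1) s(1)] r(2)[OF x] s(2)[OF \<theta>c[OF eV[OF x]]] i\<theta>[OF eV[OF x]] by simp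
  qed (use X e comp_hom[OF r(1) s(1)] in auto)
  moreover have "r \<cdot> s = Idt T K"
  proof (rule hom_S_faithful[of K K])
    show "(r \<cdot> s) \<cdot> y = Idt T K \<cdot> y" if y: "y \<in> Hom T S K" for y
    proof -
      have iy: "?i y \<in> Hom T S X" "e \<cdot> ?i y = ?i y" using i(1)[OF y] by (auto simp: V_def)
      show ?thesis
        using comp_assoc[OF y s(1) r(1)] s(2)[OF y] r(2)[OF iy(1)] iy(2) i(2)[OF y] comp_idt_left[OF y]
        by simp
    qed
  qed (use K idt_hom[OF KO] comp_hom[OF s(1) r(1)] in auto)
  ultimately show ?thesis using K s(1) r(1) by blast
qed

text \<open>
  The statement holds for the linear map induced on \<open>Hom(S, -)\<close>, and \<open>g\<close> is a lift of the linear map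
  found there.
\<close>

lemma coheart_regular:
  assumes X: "X \<in> degree_ge0 \<inter> degree_le0" and Y: "Y \<in> degree_ge0 \<inter> degree_le0" and f: "f \<in> Hom T X Y"
  shows "\<exists>g\<in>Hom T Y X. f \<cdot> (g \<cdot> f) = f"
proof -
  have XO: "X \<in> Obj T" and YO: "Y \<in> Obj T" using f hom_objs by blast+
  let ?R = "End_ring T S"
  have VY: "right_vector_space ?R (hom_obj T S Y)"
    using hom_obj_right_module[OF S_obj YO] corigid
    by (simp add: right_vector_space_def right_vector_space_axioms_def simply_connected_corigid_def)
  obtain \<gamma> where \<gamma>: "\<gamma> \<in> module_homs ?R (hom_obj T S Y) (hom_obj T S X)"
    "\<And>x. x \<in> carrier (hom_obj T S X) \<Longrightarrow>
      (\<lambda>x\<in>Hom T S X. f \<cdot> x) (\<gamma> ((\<lambda>x\<in>Hom T S X. f \<cdot> x) x)) = (\<lambda>x\<in>Hom T S X. f \<cdot> x) x"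
    using module_hom_regular[OF hom_obj_right_module[OF S_obj XO] VY hom_obj_post_comp[OF S_obj f]] by blast
  obtain g where g: "g \<in> Hom T Y X" "\<forall>y\<in>Hom T S Y. g \<cdot> y = \<gamma> y"
    using hom_S_full[OF _ _ \<gamma>(1)] X Y by blast
  have "f \<cdot> (g \<cdot> f) = f"
  proof (rule hom_S_faithful[of X Y])
    fix x assume x: "x \<in> Hom T S X"
    have fx: "f \<cdot> x \<in> Hom T S Y" and gfx: "g \<cdot> (f \<cdot> x) \<in> Hom T S X"
      using comp_hom[OF x f] comp_hom[OF comp_hom[OF x f] g(1)] .
    have "(f \<cdot> (g \<cdot> f)) \<cdot> x = f \<cdot> (g \<cdot> (f \<cdot> x))"
      using comp_assoc[OF x comp_hom[OF f g(1)] f] comp_assoc[OF x f g(1)] by simp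
    also have "\<dots> = f \<cdot> x" using \<gamma>(2)[of x] x fx gfx g(2) by (simp add: hom_obj_def)
    finally show "(f \<cdot> (g \<cdot> f)) \<cdot> x = f \<cdot> x" .
  qed (use X Y f comp_hom[OF comp_hom[OF f g(1)] f] in auto)
  then show ?thesis using g(1) by blast
qed

lemma coheart_abelian: "abelian_category (coheart T degree_ge0 degree_le0)"
proof -
  let ?K = "degree_ge0 \<inter> degree_le0"
  have KO: "?K \<subseteq> Obj T" by (auto simp: degree_ge0_def)
  have zero: "Z \<in> ?K" if "is_zero_object T Z" for Z
    using that zero_object_hom_zero(1)[OF that cell_obj]
    by (simp add: degree_ge0_def degree_le0_def is_zero_object_def)
  have biprod: "P \<in> ?K" if XY: "X \<in> ?K" "Y \<in> ?K" and b: "is_biproduct T X Y P i j p q" for X Y P i j p q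
  proof -
    have h: "P \<in> Obj T" "i \<in> Hom T X P" "j \<in> Hom T Y P" "p \<in> Hom T P X" "q \<in> Hom T P Y"
      "i \<cdot> p \<boxplus> j \<cdot> q = Idt T P"
      using b by (simp_all add: is_biproduct_def)
    have "hom_zero T W P" if z: "hom_zero T W X" "hom_zero T W Y" "W \<in> Obj T" for W
    proof (rule hom_zeroI[OF z(3) h(1)])
      fix f assume f: "f \<in> Hom T W P"
      have "f = (i \<cdot> p \<boxplus> j \<cdot> q) \<cdot> f" using h(6) comp_idt_left[OF f] by simp
      also have "\<dots> = i \<cdot> (p \<cdot> f) \<boxplus> j \<cdot> (q \<cdot> f)"
        using comp_add_right[OF f comp_hom[OF h(4,2)] comp_hom[OF h(5,3)]]
          comp_assoc[OF f h(4,2)] comp_assoc[OF f h(5,3)] by simp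
      also have "\<dots> = Zero T W P"
        using hom_zeroD[OF z(1) comp_hom[OF f h(4)]] hom_zeroD[OF z(2) comp_hom[OF f h(5)]]
          comp_zero[OF h(2) z(3)] comp_zero[OF h(3) z(3)] zero_add[OF zero_hom[OF z(3) h(1)]] by simp
      finally show "f = Zero T W P" .
    qed
    then show ?thesis using XY h(1) cell_obj by (auto simp: degree_ge0_def degree_le0_def)
  qed
  interpret K: additive_category "full_subcat T ?K" by (rule full_subcat_additive[OF KO zero biprod])
  show ?thesis
    unfolding coheart_def
  proof (rule K.abelian_if_regular)
    show "\<exists>g\<in>Hom (full_subcat T ?K) Y X. f \<cdot>\<^bsub>full_subcat T ?K\<^esub> (g \<cdot>\<^bsub>full_subcat T ?K\<^esub> f) = f"
      if "f \<in> Hom (full_subcat T ?K) X Y" for X Y f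
      using that coheart_regular[of X Y f] by (simp add: Hom_full_subcat Bex_def)
    show "\<exists>K. \<exists>s\<in>Hom (full_subcat T ?K) K X. \<exists>r\<in>Hom (full_subcat T ?K) X K.
        s \<cdot>\<^bsub>full_subcat T ?K\<^esub> r = e \<and> r \<cdot>\<^bsub>full_subcat T ?K\<^esub> s = Idt (full_subcat T ?K) K"
      if "e \<in> Hom (full_subcat T ?K) X X" "e \<cdot>\<^bsub>full_subcat T ?K\<^esub> e = e" for X e
    proof -
      have "X \<in> ?K" "e \<in> Hom T X X" "e \<cdot> e = e" using that by (simp_all add: Hom_full_subcat)
      from coheart_split[OF this] obtain L s r where "L \<in> ?K" "s \<in> Hom T L X" "r \<in> Hom T X L"
        "s \<cdot> r = e" "r \<cdot> s = Idt T L" by blast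
      then show ?thesis using \<open>X \<in> ?K\<close> by (simp add: Hom_full_subcat Bex_def) blast
    qed
  qed
qed

end

section \<open>The equivalence with modules\<close>

context category
begin

lemma isoI:
  assumes "f \<in> Hom C X Y" "g \<in> Hom C Y X" "g \<cdot> f = Idt C X" "f \<cdot> g = Idt C Y"
  shows "is_iso C f"
  using assms by (auto simp: is_iso_def Hom_def)

lemma isoE:
  assumes "is_iso C f" "f \<in> Hom C X Y"
  obtains g where "g \<in> Hom C Y X" "g \<cdot> f = Idt C X" "f \<cdot> g = Idt C Y"
  using assms by (auto simp: is_iso_def Hom_def)

end

text \<open>
  The quasi-inverse is obtained by choosing an isomorphism \<open>\<theta> M : M \<rightarrow> F (G M)\<close> for every \<open>M\<close> and
  transporting arrows along these.
\<close>

lemma (in cat_functor) equivalence_if_fully_faithful: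
  assumes ff: "\<And>X Y. X \<in> Obj C \<Longrightarrow> Y \<in> Obj C \<Longrightarrow> bij_betw Fa (Hom C X Y) (Hom D (Fo X) (Fo Y))"
    and ess: "\<And>M. M \<in> Obj D \<Longrightarrow> \<exists>X\<in>Obj C. \<exists>\<theta>\<in>Hom D M (Fo X). is_iso D \<theta>"
  shows "equivalence_of_categories C D Fo Fa"
proof -
  have "\<exists>X \<theta> \<theta>'. X \<in> Obj C \<and> \<theta> \<in> Hom D M (Fo X) \<and> \<theta>' \<in> Hom D (Fo X) M \<and>
      \<theta>' \<cdot>\<^bsub>D\<^esub> \<theta> = Idt D M \<and> \<theta> \<cdot>\<^bsub>D\<^esub> \<theta>' = Idt D (Fo X)" if M: "M \<in> Obj D" for M
  proof -
    obtain X \<theta> where X: "X \<in> Obj C" and \<theta>: "\<theta> \<in> Hom D M (Fo X)" and iso: "is_iso D \<theta>" using ess[OF M] by blast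
    obtain \<theta>' where "\<theta>' \<in> Hom D (Fo X) M" "\<theta>' \<cdot>\<^bsub>D\<^esub> \<theta> = Idt D M" "\<theta> \<cdot>\<^bsub>D\<^esub> \<theta>' = Idt D (Fo X)"
      by (rule D.isoE[OF iso \<theta>])
    then show ?thesis using X \<theta> by blast
  qed
  then have "\<forall>M. \<exists>X \<theta> \<theta>'. M \<in> Obj D \<longrightarrow> X \<in> Obj C \<and> \<theta> \<in> Hom D M (Fo X) \<and> \<theta>' \<in> Hom D (Fo X) M \<and>
      \<theta>' \<cdot>\<^bsub>D\<^esub> \<theta> = Idt D M \<and> \<theta> \<cdot>\<^bsub>D\<^esub> \<theta>' = Idt D (Fo X)" by blast
  then obtain Go \<theta> \<theta>' where "\<forall>M. M \<in> Obj D \<longrightarrow> Go M \<in> Obj C \<and> \<theta> M \<in> Hom D M (Fo (Go M)) \<and>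
      \<theta>' M \<in> Hom D (Fo (Go M)) M \<and> \<theta>' M \<cdot>\<^bsub>D\<^esub> \<theta> M = Idt D M \<and> \<theta> M \<cdot>\<^bsub>D\<^esub> \<theta>' M = Idt D (Fo (Go M))"
    unfolding choice_iff by blast
  then have Go: "Go M \<in> Obj C" and \<theta>: "\<theta> M \<in> Hom D M (Fo (Go M))" and \<theta>': "\<theta>' M \<in> Hom D (Fo (Go M)) M"
    and \<theta>'\<theta>: "\<theta>' M \<cdot>\<^bsub>D\<^esub> \<theta> M = Idt D M" and \<theta>\<theta>': "\<theta> M \<cdot>\<^bsub>D\<^esub> \<theta>' M = Idt D (Fo (Go M))"
    if "M \<in> Obj D" for M
    using that by simp_all
  have inj: "f = g" if "f \<in> Hom C X Y" "g \<in> Hom C X Y" "Fa f = Fa g" for f g X Y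
  proof -
    have "inj_on Fa (Hom C X Y)" using ff[of X Y] C.hom_objs[OF that(1)] by (simp add: bij_betw_def)
    then show ?thesis using that by (simp add: inj_on_def)
  qed
  define lift where "lift X Y h = inv_into (Hom C X Y) Fa h" for X Y h
  have lift: "lift X Y h \<in> Hom C X Y" "Fa (lift X Y h) = h"
    if "X \<in> Obj C" "Y \<in> Obj C" "h \<in> Hom D (Fo X) (Fo Y)" for X Y h
  proof -
    have "h \<in> Fa ` Hom C X Y" using ff[OF that(1,2)] that(3) by (simp add: bij_betw_def)
    then show "lift X Y h \<in> Hom C X Y" "Fa (lift X Y h) = h"
      unfolding lift_def by (rule inv_into_into, rule f_inv_into_f)
  qed
  define conj where "conj f = \<theta> (Cod D f) \<cdot>\<^bsub>D\<^esub> (f \<cdot>\<^bsub>D\<^esub> \<theta>' (Dom D f))" for f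
  define Ga where "Ga f = lift (Go (Dom D f)) (Go (Cod D f)) (conj f)" for f
  have conj: "conj f \<in> Hom D (Fo (Go M)) (Fo (Go N))" "conj f = \<theta> N \<cdot>\<^bsub>D\<^esub> (f \<cdot>\<^bsub>D\<^esub> \<theta>' M)"
    if f: "f \<in> Hom D M N" for f M N
  proof -
    have o: "M \<in> Obj D" "N \<in> Obj D" using D.hom_objs[OF f] .
    show eq: "conj f = \<theta> N \<cdot>\<^bsub>D\<^esub> (f \<cdot>\<^bsub>D\<^esub> \<theta>' M)" using HomD(2,3)[OF f] by (simp add: conj_def)
    show "conj f \<in> Hom D (Fo (Go M)) (Fo (Go N))"
      unfolding eq using D.comp_hom[OF D.comp_hom[OF \<theta>'[OF o(1)] f] \<theta>[OF o(2)]] .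
  qed
  have Ga: "Ga f \<in> Hom C (Go M) (Go N)" "Fa (Ga f) = \<theta> N \<cdot>\<^bsub>D\<^esub> (f \<cdot>\<^bsub>D\<^esub> \<theta>' M)"
    if f: "f \<in> Hom D M N" for f M N
  proof -
    have o: "M \<in> Obj D" "N \<in> Obj D" using D.hom_objs[OF f] .
    have eq: "Ga f = lift (Go M) (Go N) (conj f)" using HomD(2,3)[OF f] by (simp add: Ga_def)
    show "Ga f \<in> Hom C (Go M) (Go N)" "Fa (Ga f) = \<theta> N \<cdot>\<^bsub>D\<^esub> (f \<cdot>\<^bsub>D\<^esub> \<theta>' M)"
      unfolding eq using lift[OF Go[OF o(1)] Go[OF o(2)] conj(1)[OF f]] conj(2)[OF f] by simp_all
  qed
  have slide: "Fa (Ga f) \<cdot>\<^bsub>D\<^esub> \<theta> M = \<theta> N \<cdot>\<^bsub>D\<^esub> f" if f: "f \<in> Hom D M N" for f M N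
  proof -
    have o: "M \<in> Obj D" "N \<in> Obj D" using D.hom_objs[OF f] .
    note t = \<theta>[OF o(1)] \<theta>'[OF o(1)] \<theta>[OF o(2)]
    have "Fa (Ga f) \<cdot>\<^bsub>D\<^esub> \<theta> M = \<theta> N \<cdot>\<^bsub>D\<^esub> ((f \<cdot>\<^bsub>D\<^esub> \<theta>' M) \<cdot>\<^bsub>D\<^esub> \<theta> M)"
      using Ga(2)[OF f] D.comp_assoc[OF t(1) D.comp_hom[OF t(2) f] t(3)] by simp
    also have "(f \<cdot>\<^bsub>D\<^esub> \<theta>' M) \<cdot>\<^bsub>D\<^esub> \<theta> M = f"
      using D.comp_assoc[OF t(1,2) f] \<theta>'\<theta>[OF o(1)] D.comp_idt_right[OF f] by simp
    finally show ?thesis .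
  qed
  have G: "cat_functor D C Go Ga"
  proof (intro cat_functor.intro cat_functor_axioms.intro)
    show "category D" "category C" by (rule D.category_axioms, rule C.category_axioms)
    show "Go M \<in> Obj C" if "M \<in> Obj D" for M using Go[OF that] .
    show "Ga f \<in> Hom C (Go M) (Go N)" if "f \<in> Hom D M N" for f M N using Ga(1)[OF that] .
    show "Ga (Idt D M) = Idt C (Go M)" if M: "M \<in> Obj D" for M
    proof (rule inj[OF Ga(1)[OF D.idt_hom[OF M]] C.idt_hom[OF Go[OF M]]])
      show "Fa (Ga (Idt D M)) = Fa (Idt C (Go M))"
        using Ga(2)[OF D.idt_hom[OF M]] D.comp_idt_left[OF \<theta>'[OF M]] \<theta>\<theta>'[OF M] map_idt[OF Go[OF M]] by simp
    qed
    fix f g M N P assume f: "f \<in> Hom D M N" and g: "g \<in> Hom D N P"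
    have o: "M \<in> Obj D" "N \<in> Obj D" "P \<in> Obj D" using D.hom_objs[OF f] D.hom_objs[OF g] by blast+
    note t = \<theta>'[OF o(1)] \<theta>[OF o(2)] \<theta>[OF o(3)]
    show "Ga (g \<cdot>\<^bsub>D\<^esub> f) = Ga g \<cdot>\<^bsub>C\<^esub> Ga f"
    proof (rule inj[OF Ga(1)[OF D.comp_hom[OF f g]] C.comp_hom[OF Ga(1)[OF f] Ga(1)[OF g]]])
      have h: "Fa (Ga g) \<in> Hom D (Fo (Go N)) (Fo (Go P))" using map_hom[OF Ga(1)[OF g]] .
      have "Fa (Ga g \<cdot>\<^bsub>C\<^esub> Ga f) = Fa (Ga g) \<cdot>\<^bsub>D\<^esub> (\<theta> N \<cdot>\<^bsub>D\<^esub> (f \<cdot>\<^bsub>D\<^esub> \<theta>' M))"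
        using map_comp[OF Ga(1)[OF f] Ga(1)[OF g]] Ga(2)[OF f] by simp
      also have "\<dots> = (Fa (Ga g) \<cdot>\<^bsub>D\<^esub> \<theta> N) \<cdot>\<^bsub>D\<^esub> (f \<cdot>\<^bsub>D\<^esub> \<theta>' M)"
        using D.comp_assoc[OF D.comp_hom[OF t(1) f] t(2) h] by simp
      also have "\<dots> = \<theta> P \<cdot>\<^bsub>D\<^esub> (g \<cdot>\<^bsub>D\<^esub> (f \<cdot>\<^bsub>D\<^esub> \<theta>' M))"
        using slide[OF g] D.comp_assoc[OF D.comp_hom[OF t(1) f] g t(3)] by simp
      also have "\<dots> = Fa (Ga (g \<cdot>\<^bsub>D\<^esub> f))"
        using Ga(2)[OF D.comp_hom[OF f g]] D.comp_assoc[OF t(1) f g] by simp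
      finally show "Fa (Ga (g \<cdot>\<^bsub>D\<^esub> f)) = Fa (Ga g \<cdot>\<^bsub>C\<^esub> Ga f)" by simp
    qed
  qed
  define \<eta> where "\<eta> X = lift X (Go (Fo X)) (\<theta> (Fo X))" for X
  have \<eta>: "\<eta> X \<in> Hom C X (Go (Fo X))" "Fa (\<eta> X) = \<theta> (Fo X)" if X: "X \<in> Obj C" for X
    using lift[OF X Go[OF map_obj[OF X]] \<theta>[OF map_obj[OF X]]] by (simp_all add: \<eta>_def)
  have "natural_iso C C id id (Go \<circ> Fo) (Ga \<circ> Fa) \<eta>"
    unfolding natural_iso_def id_apply comp_apply
  proof (intro conjI ballI allI)
    fix X assume X: "X \<in> Obj C"
    note FX = map_obj[OF X]
    note GX = Go[OF FX]
    show "\<eta> X \<in> Hom C X (Go (Fo X))" by (rule \<eta>(1)[OF X])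
    have i: "lift (Go (Fo X)) X (\<theta>' (Fo X)) \<in> Hom C (Go (Fo X)) X"
      "Fa (lift (Go (Fo X)) X (\<theta>' (Fo X))) = \<theta>' (Fo X)" using lift[OF GX X \<theta>'[OF FX]] by blast+
    show "is_iso C (\<eta> X)"
    proof (rule C.isoI[OF \<eta>(1)[OF X] i(1)])
      show "lift (Go (Fo X)) X (\<theta>' (Fo X)) \<cdot>\<^bsub>C\<^esub> \<eta> X = Idt C X"
        by (rule inj[OF C.comp_hom[OF \<eta>(1)[OF X] i(1)] C.idt_hom[OF X]])
          (simp add: map_comp[OF \<eta>(1)[OF X] i(1)] i(2) \<eta>(2)[OF X] \<theta>'\<theta>[OF FX] map_idt[OF X])
      show "\<eta> X \<cdot>\<^bsub>C\<^esub> lift (Go (Fo X)) X (\<theta>' (Fo X)) = Idt C (Go (Fo X))"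
        by (rule inj[OF C.comp_hom[OF i(1) \<eta>(1)[OF X]] C.idt_hom[OF GX]])
          (simp add: map_comp[OF i(1) \<eta>(1)[OF X]] i(2) \<eta>(2)[OF X] \<theta>\<theta>'[OF FX] map_idt[OF GX])
    qed
  next
    fix X Y f assume f: "f \<in> Hom C X Y"
    have X: "X \<in> Obj C" and Y: "Y \<in> Obj C" using C.hom_objs[OF f] .
    note Ff = map_hom[OF f]
    show "\<eta> Y \<cdot>\<^bsub>C\<^esub> f = Ga (Fa f) \<cdot>\<^bsub>C\<^esub> \<eta> X"
      by (rule inj[OF C.comp_hom[OF f \<eta>(1)[OF Y]] C.comp_hom[OF \<eta>(1)[OF X] Ga(1)[OF Ff]]])
        (simp add: map_comp[OF f \<eta>(1)[OF Y]] map_comp[OF \<eta>(1)[OF X] Ga(1)[OF Ff]] \<eta>(2)[OF X] \<eta>(2)[OF Y]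
          slide[OF Ff])
  qed
  moreover have "natural_iso D D (Fo \<circ> Go) (Fa \<circ> Ga) id id \<theta>'"
    unfolding natural_iso_def id_apply comp_apply
  proof (intro conjI ballI allI)
    fix M assume M: "M \<in> Obj D"
    show "\<theta>' M \<in> Hom D (Fo (Go M)) M" by (rule \<theta>'[OF M])
    show "is_iso D (\<theta>' M)" by (rule D.isoI[OF \<theta>'[OF M] \<theta>[OF M] \<theta>\<theta>'[OF M] \<theta>'\<theta>[OF M]])
  next
    fix M N f assume f: "f \<in> Hom D M N"
    have M: "M \<in> Obj D" and N: "N \<in> Obj D" using D.hom_objs[OF f] .
    note f' = D.comp_hom[OF \<theta>'[OF M] f]
    show "\<theta>' N \<cdot>\<^bsub>D\<^esub> Fa (Ga f) = f \<cdot>\<^bsub>D\<^esub> \<theta>' M"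
      using Ga(2)[OF f] D.comp_assoc[OF f' \<theta>[OF N] \<theta>'[OF N]] \<theta>'\<theta>[OF N] D.comp_idt_left[OF f'] by simp
  qed
  ultimately show ?thesis
    unfolding equivalence_of_categories_def using cat_functor_axioms G by blast
qed

lemma Hom_right_Mod:
  "h \<in> Hom (right_Mod \<kappa> R) M N \<longleftrightarrow> (\<exists>f. h = (M, f, N) \<and> f \<in> module_homs R M N \<and>
     right_module R M \<and> small \<kappa> (carrier M) \<and> right_module R N \<and> small \<kappa> (carrier N))"
  by (auto simp: Hom_def right_Mod_def)

lemma right_Mod_simps [simp]:
  "Obj (right_Mod \<kappa> R) = {M. right_module R M \<and> small \<kappa> (carrier M)}"
  "Idt (right_Mod \<kappa> R) M = (M, \<lambda>x\<in>carrier M. x, M)"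
  "(N, g, P) \<cdot>\<^bsub>right_Mod \<kappa> R\<^esub> (M, f, N') = (M, compose (carrier M) g f, P)"
  by (simp_all add: right_Mod_def)

lemma right_Mod_category:
  "category (right_Mod \<kappa> R :: (('a, 'b) module, ('a, 'b) module_arr) cat)"
proof (intro category.intro)
  fix f :: "('a, 'b) module_arr" assume "f \<in> Arr (right_Mod \<kappa> R)"
  then show "Dom (right_Mod \<kappa> R) f \<in> Obj (right_Mod \<kappa> R)" "Cod (right_Mod \<kappa> R) f \<in> Obj (right_Mod \<kappa> R)"
    by (auto simp: right_Mod_def)
next
  fix M assume "M \<in> Obj (right_Mod \<kappa> R)"
  then show "Idt (right_Mod \<kappa> R) M \<in> Hom (right_Mod \<kappa> R) M M"
    using module_homs_id by (auto simp: Hom_right_Mod)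
next
  fix f M N g P assume "f \<in> Hom (right_Mod \<kappa> R) M N" "g \<in> Hom (right_Mod \<kappa> R) N P"
  then show "g \<cdot>\<^bsub>right_Mod \<kappa> R\<^esub> f \<in> Hom (right_Mod \<kappa> R) M P"
    using module_homs_compose by (auto simp: Hom_right_Mod)
next
  fix h M N assume "h \<in> Hom (right_Mod \<kappa> R) M N"
  then obtain f where h: "h = (M, f, N)" and "f \<in> module_homs R M N"
    by (auto simp: Hom_right_Mod)
  note f = module_homs_funcset[OF this(2)]
  have "f \<in> carrier M \<rightarrow> carrier N" "f \<in> extensional (carrier M)" using f by (auto simp: PiE_def)
  then show "Idt (right_Mod \<kappa> R) N \<cdot>\<^bsub>right_Mod \<kappa> R\<^esub> h = h" "h \<cdot>\<^bsub>right_Mod \<kappa> R\<^esub> Idt (right_Mod \<kappa> R) M = h"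
    unfolding h by (simp_all add: Id_compose compose_Id)
next
  fix f W M g N h P
  assume "f \<in> Hom (right_Mod \<kappa> R) W M" "g \<in> Hom (right_Mod \<kappa> R) M N" "h \<in> Hom (right_Mod \<kappa> R) N P"
  then obtain f' g' h' where eq: "f = (W, f', M)" "g = (M, g', N)" "h = (N, h', P)"
    and "f' \<in> module_homs R W M"
    by (auto simp: Hom_right_Mod)
  then have f': "f' \<in> carrier W \<rightarrow> carrier M" using module_homs_closed[of f' R W M] by (intro funcsetI)
  show "h \<cdot>\<^bsub>right_Mod \<kappa> R\<^esub> g \<cdot>\<^bsub>right_Mod \<kappa> R\<^esub> f = h \<cdot>\<^bsub>right_Mod \<kappa> R\<^esub> (g \<cdot>\<^bsub>right_Mod \<kappa> R\<^esub> f)"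
    unfolding eq by (simp add: compose_assoc[OF f'])
qed

lemma right_Mod_isoI:
  assumes f: "f \<in> module_homs R M N" and b: "bij_betw f (carrier M) (carrier N)"
    and M: "right_module R M" "small \<kappa> (carrier M)" and N: "right_module R N" "small \<kappa> (carrier N)"
  shows "is_iso (right_Mod \<kappa> R) (M, f, N)"
proof (rule category.isoI[OF right_Mod_category])
  let ?g = "\<lambda>y\<in>carrier N. inv_into (carrier M) f y"
  show "(M, f, N) \<in> Hom (right_Mod \<kappa> R) M N" using f M N by (simp add: Hom_right_Mod)
  show "(N, ?g, M) \<in> Hom (right_Mod \<kappa> R) N M"
    using module_homs_inverse[OF f b M(1) N(1)] M N by (simp add: Hom_right_Mod)
  have "compose (carrier M) ?g f = (\<lambda>x\<in>carrier M. x)"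
    using bij_betw_inv_into_left[OF b] module_homs_closed[OF f] by (auto simp: compose_def)
  then show "(N, ?g, M) \<cdot>\<^bsub>right_Mod \<kappa> R\<^esub> (M, f, N) = Idt (right_Mod \<kappa> R) M" by simp
  have "compose (carrier N) f ?g = (\<lambda>x\<in>carrier N. x)"
    using bij_betw_inv_into_right[OF b] by (auto simp: compose_def)
  then show "(M, f, N) \<cdot>\<^bsub>right_Mod \<kappa> R\<^esub> (N, ?g, M) = Idt (right_Mod \<kappa> R) N" by simp
qed

context corigid_generator
begin

lemma coheart_equivalence:
  "equivalence_of_categories (coheart T degree_ge0 degree_le0) (right_Mod \<kappa> (End_ring T S))
    (hom_obj T S) (hom_arr T S)"
proof -
  let ?K = "degree_ge0 \<inter> degree_le0" and ?D = "right_Mod \<kappa> (End_ring T S)"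
  let ?C = "full_subcat T ?K"
  have KO: "X \<in> Obj T" if "X \<in> ?K" for X using that by (simp add: degree_ge0_def)
  have obj: "right_module (End_ring T S) (hom_obj T S X)" "small \<kappa> (carrier (hom_obj T S X))"
    if "X \<in> Obj T" for X
    using hom_obj_right_module[OF S_obj that] loc_small S_obj that
    by (simp_all add: locally_small_def hom_obj_def)
  have arr: "hom_arr T S f = (hom_obj T S X, \<lambda>g\<in>Hom T S X. f \<cdot> g, hom_obj T S Y)"
    if "f \<in> Hom T X Y" for f X Y
    using HomD(2,3)[OF that] by (simp add: hom_arr_def)
  have hom: "hom_arr T S f \<in> Hom ?D (hom_obj T S X) (hom_obj T S Y)" if "f \<in> Hom T X Y" for f X Y
    using arr[OF that] hom_obj_post_comp[OF S_obj that] obj hom_objs[OF that] by (simp add: Hom_right_Mod)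
  have "cat_functor ?C ?D (hom_obj T S) (hom_arr T S)"
  proof (intro cat_functor.intro cat_functor_axioms.intro)
    show "category ?C"
      using full_subcat_preadditive[of ?K] KO by (auto simp: preadditive_category_def)
    show "category ?D" by (rule right_Mod_category)
    show "hom_obj T S X \<in> Obj ?D" if "X \<in> Obj ?C" for X using that obj KO by simp
    show "hom_arr T S f \<in> Hom ?D (hom_obj T S X) (hom_obj T S Y)" if "f \<in> Hom ?C X Y" for f X Y
      using that hom by (simp add: Hom_full_subcat)
    show "hom_arr T S (Idt ?C X) = Idt ?D (hom_obj T S X)" if "X \<in> Obj ?C" for X
    proof -
      have X: "X \<in> Obj T" using that KO by simp
      have "(\<lambda>g\<in>Hom T S X. Idt T X \<cdot> g) = (\<lambda>g\<in>Hom T S X. g)"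
        using comp_idt_left by (intro restrict_ext) blast
      then show ?thesis using arr[OF idt_hom[OF X]] by (simp add: hom_obj_def)
    qed
    show "hom_arr T S (g \<cdot>\<^bsub>?C\<^esub> f) = hom_arr T S g \<cdot>\<^bsub>?D\<^esub> hom_arr T S f"
      if "f \<in> Hom ?C X Y" "g \<in> Hom ?C Y Z" for f X Y g Z
    proof -
      have f: "f \<in> Hom T X Y" and g: "g \<in> Hom T Y Z" using that by (simp_all add: Hom_full_subcat)
      have "compose (Hom T S X) (\<lambda>h\<in>Hom T S Y. g \<cdot> h) (\<lambda>h\<in>Hom T S X. f \<cdot> h) = (\<lambda>h\<in>Hom T S X. (g \<cdot> f) \<cdot> h)"
        using comp_hom[OF _ f] comp_assoc[OF _ f g] by (auto simp: compose_def)
      then show ?thesis using arr[OF f] arr[OF g] arr[OF comp_hom[OF f g]] by (simp add: hom_obj_def)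
    qed
  qed
  then interpret F: cat_functor ?C ?D "hom_obj T S" "hom_arr T S" .
  show ?thesis
    unfolding coheart_def
  proof (rule F.equivalence_if_fully_faithful)
    fix X Y assume "X \<in> Obj ?C" "Y \<in> Obj ?C"
    then have X: "X \<in> ?K" and Y: "Y \<in> ?K" by simp_all
    have H: "Hom ?C X Y = Hom T X Y" using X Y by (auto simp: Hom_full_subcat)
    show "bij_betw (hom_arr T S) (Hom ?C X Y) (Hom ?D (hom_obj T S X) (hom_obj T S Y))"
      unfolding bij_betw_def H
    proof (intro conjI inj_onI equalityI subsetI)
      fix f g assume f: "f \<in> Hom T X Y" and g: "g \<in> Hom T X Y" and eq: "hom_arr T S f = hom_arr T S g"
      have "(\<lambda>h\<in>Hom T S X. f \<cdot> h) = (\<lambda>h\<in>Hom T S X. g \<cdot> h)" using eq arr[OF f] arr[OF g] by simp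
      then have "f \<cdot> x = g \<cdot> x" if "x \<in> Hom T S X" for x using that by (metis restrict_apply')
      then show "f = g" using hom_S_faithful[OF _ _ f g] X Y by blast
    next
      show "h \<in> Hom ?D (hom_obj T S X) (hom_obj T S Y)" if "h \<in> hom_arr T S ` Hom T X Y" for h
        using that hom by blast
    next
      fix h assume "h \<in> Hom ?D (hom_obj T S X) (hom_obj T S Y)"
      then obtain \<phi> where h: "h = (hom_obj T S X, \<phi>, hom_obj T S Y)"
        and \<phi>: "\<phi> \<in> module_homs (End_ring T S) (hom_obj T S X) (hom_obj T S Y)"
        by (auto simp: Hom_right_Mod)
      obtain f where f: "f \<in> Hom T X Y" "\<forall>x\<in>Hom T S X. f \<cdot> x = \<phi> x"
        using hom_S_full[OF _ _ \<phi>] X Y by blast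
      have "(\<lambda>g\<in>Hom T S X. f \<cdot> g) = \<phi>"
        by (rule module_homs_eqI[OF hom_obj_post_comp[OF S_obj f(1)] \<phi>]) (use f(2) in \<open>simp add: hom_obj_def\<close>)
      then have "hom_arr T S f = h" using arr[OF f(1)] h by simp
      then show "h \<in> hom_arr T S ` Hom T X Y" using f(1) by blast
    qed
  next
    fix M :: "('m, 'm) module" assume "M \<in> Obj ?D"
    then have M: "right_module (End_ring T S) M" "small \<kappa> (carrier M)" by simp_all
    obtain L \<theta> where L: "L \<in> ?K" and \<theta>: "\<theta> \<in> module_homs (End_ring T S) M (hom_obj T S L)"
      and b: "bij_betw \<theta> (carrier M) (carrier (hom_obj T S L))"
      by (rule coheart_realization[OF M])
    have "(M, \<theta>, hom_obj T S L) \<in> Hom ?D M (hom_obj T S L)"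
      using \<theta> M obj[OF KO[OF L]] by (simp add: Hom_right_Mod)
    moreover have "is_iso ?D (M, \<theta>, hom_obj T S L)"
      by (rule right_Mod_isoI[OF \<theta> b M obj[OF KO[OF L]]])
    ultimately show "\<exists>X\<in>Obj ?C. \<exists>\<theta>\<in>Hom ?D M (hom_obj T S X). is_iso ?D \<theta>" using L by auto
  qed
qed

end

theorem theorem2p4:
  fixes T :: "('o, 'm, 'z) tricat_scheme" and \<kappa> :: "'m rel" and S :: 'o and A B :: "'o set"
  assumes "universe_cardinal \<kappa>"
    and "triangulated_category T"
    and "locally_small \<kappa> T"
    and "has_small_coproducts \<kappa> T"
    and "compact_object \<kappa> T S"
    and "simply_connected_corigid T S"
    and "generating_set \<kappa> T (range (\<lambda>i. susp_pow T i S))"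
    and "A = {X \<in> Obj T. \<forall>i<0. hom_zero T S (susp_pow T i X)}"
    and "B = {X \<in> Obj T. \<forall>i>0. hom_zero T S (susp_pow T i X)}"
  shows "nondegenerate_co_t_structure T A B
    \<and> abelian_category (coheart T A B)
    \<and> equivalence_of_categories (coheart T A B) (right_Mod \<kappa> (End_ring T S))
        (hom_obj T S) (hom_arr T S)"
proof -
  interpret corigid_generator T \<kappa> S
    using assms by (simp add: corigid_generator_def corigid_generator_axioms_def)
  have "A = degree_ge0" and "B = degree_le0"
    unfolding assms(8,9) degree_ge0_def degree_le0_def using hom_zero_cell by (simp_all cong: conj_cong)
  then show ?thesis using nondegenerate coheart_abelian coheart_equivalence by simp
qed

end
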